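(* Let $\rho_1,\rho_2\in\mathcal{D}(\mathcal{H}_A)$ and $\sigma_{AB}\in\mathcal{D}(\mathcal{H}_A\otimes\mathcal{H}_B)$ be unknown states and $\phi\in[0,2\pi)$. Let $$H=\tfrac12\cos(\phi)\{\rho_1,\rho_2\}+\tfrac12\sin(\phi)\,i[\rho_1,\rho_2].$$ For $t\in\mathbb{R}$, $\delta>0$, there is a protocol (fixed independently of the unknown states) using $n=O(t^2/\delta)$ copies each of $\rho_1$ and $\rho_2$ that transforms $\sigma_{AB}$ into $\tilde\sigma_{AB}$ with $$\tfrac12\big\|(e^{-iHt}\otimes\mathbb{1}_B)\sigma_{AB}(e^{iHt}\otimes\mathbb{1}_B)-\tilde\sigma_{AB}\big\|_1\le O(\delta).$$ In particular ($\phi=0$ and $\phi=\pi/2$) this simulates $\tfrac12\{\rho_1,\rho_2\}$ and $\tfrac12 i[\rho_1,\rho_2]$.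
   Context: $\{A,B\}=AB+BA$ and $i[A,B]=i(AB-BA)$. $\mathcal{D}(\mathcal{H})$ denotes density operators on $\mathcal{H}$; $\|A\|_1=\operatorname{Tr}\sqrt{AA^\dagger}$. *)

theory Defs
  imports "Jordan_Normal_Form.Matrix" Complex_Main
begin

definition cadj :: "complex mat \<Rightarrow> complex mat" where
  "cadj A = mat (dim_col A) (dim_row A) (\<lambda>(i,j). cnj (A $$ (j,i)))"

definition mtrace :: "complex mat \<Rightarrow> complex" where
  "mtrace A = (\<Sum>i<dim_row A. A $$ (i,i))"

definition psd_mat :: "nat \<Rightarrow> complex mat \<Rightarrow> bool" where
  "psd_mat d A \<longleftrightarrow> A \<in> carrier_mat d d \<and> cadj A = A \<and>
     (\<forall>v :: nat \<Rightarrow> complex. 0 \<le> Re (\<Sum>i<d. \<Sum>j<d. cnj (v i) * A $$ (i,j) * v j))"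

definition density :: "nat \<Rightarrow> complex mat \<Rightarrow> bool" where
  "density d \<rho> \<longleftrightarrow> psd_mat d \<rho> \<and> mtrace \<rho> = 1"

definition kron :: "complex mat \<Rightarrow> complex mat \<Rightarrow> complex mat" where
  "kron A B = mat (dim_row A * dim_row B) (dim_col A * dim_col B)
     (\<lambda>(i,j). A $$ (i div dim_row B, j div dim_col B) * B $$ (i mod dim_row B, j mod dim_col B))"

fun kron_pow :: "complex mat \<Rightarrow> nat \<Rightarrow> complex mat" where
  "kron_pow A 0 = 1\<^sub>m 1"
| "kron_pow A (Suc n) = kron A (kron_pow A n)"

definition mat_exp :: "complex mat \<Rightarrow> complex mat" where
  "mat_exp A = mat (dim_row A) (dim_row A)
     (\<lambda>(i,j). (\<Sum>k. (A ^\<^sub>m k) $$ (i,j) / of_nat (fact k)))"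

definition psd_sqrt :: "complex mat \<Rightarrow> complex mat" where
  "psd_sqrt M = (THE S. psd_mat (dim_row M) S \<and> S * S = M)"

definition trace_norm :: "complex mat \<Rightarrow> real" where
  "trace_norm A = Re (mtrace (psd_sqrt (A * cadj A)))"

definition is_channel :: "nat \<Rightarrow> nat \<Rightarrow> complex mat list \<Rightarrow> bool" where
  "is_channel din dout Ks \<longleftrightarrow> (\<forall>K \<in> set Ks. K \<in> carrier_mat dout din) \<and>
     mat din din (\<lambda>(i,j). \<Sum>K\<leftarrow>Ks. (cadj K * K) $$ (i,j)) = 1\<^sub>m din"

definition kraus_apply :: "nat \<Rightarrow> complex mat list \<Rightarrow> complex mat \<Rightarrow> complex mat" where
  "kraus_apply dout Ks X = mat dout dout (\<lambda>(i,j). \<Sum>K\<leftarrow>Ks. (K * X * cadj K) $$ (i,j))"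

definition ham :: "real \<Rightarrow> complex mat \<Rightarrow> complex mat \<Rightarrow> complex mat" where
  "ham \<phi> r1 r2 =
     (complex_of_real (cos \<phi> / 2)) \<cdot>\<^sub>m (r1 * r2 + r2 * r1)
   + (complex_of_real (sin \<phi> / 2)) \<cdot>\<^sub>m (\<i> \<cdot>\<^sub>m (r1 * r2 - r2 * r1))"

end

theory Submission
  imports Defs "Jordan_Normal_Form.Spectral_Radius" "HOL-Analysis.L2_Norm"
begin

text \<open>
  Let \<open>W = cis \<phi> \<cdot> P\<close> with \<open>P\<close> the cyclic shift of three copies of the system \<open>A\<close>. Tracing out the first two
  factors of \<open>W (\<rho>1 \<otimes> \<rho>2 \<otimes> \<sigma>)\<close> and of its analogue for the adjoint of \<open>W\<close> gives \<open>cis \<phi> \<rho>1 \<rho>2 \<sigma>\<close> and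
  \<open>cis (-\<phi>) \<rho>2 \<rho>1 \<sigma>\<close>, whose mean is \<open>H \<sigma>\<close>. Hence the channel with Kraus operators proportional to
  \<open>1 - \<i> \<tau> W\<close> and \<open>1 - \<i> \<tau> W\<^sup>*\<close>, followed by this partial trace, maps \<open>\<sigma>\<close> exactly to
  \<open>(\<sigma> - \<i> \<tau> [H, \<sigma>] + \<tau>\<^sup>2 (\<rho>1 + \<rho>2)/2 \<otimes> Tr\<^sub>A \<sigma>) / (1 + \<tau>\<^sup>2)\<close>. This differs from the evolution by \<open>H\<close> for
  time \<open>\<tau>\<close> by at most \<open>6 \<tau>\<^sup>2\<close> in trace norm, for every \<open>\<tau>\<close>. With \<open>n\<close> steps of length \<open>\<tau> = t / n\<close> the errors
  add up to \<open>6 t\<^sup>2 / n\<close>. Trace norms are bounded by duality, that is, by \<open>|Tr (Z X)|\<close> for contractions \<open>Z\<close>;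
  square roots, exponentials and operator norms are all read off from the spectral theorem.
\<close>

section \<open>Matrix preliminaries\<close>

text \<open>One Kraus operator 1 - i \<tau> W is not trace preserving: its Gram matrix is 1 +
  \<tau>^2 plus a cross term in W and its adjoint. The operator built from the adjoint of W has the
  opposite cross term, so the pair normalises exactly, by 2 (1 + \<tau>^2), for every \<tau>. The
  pair also yields the commutator: each of \<rho>1 \<rho>2 and \<rho>2 \<rho>1 appears to the left
  of \<sigma> from one member and to the right from the other, with opposite signs. The step is
  compared with conjugation by L = (1 - i \<tau> H) / sqrt (1 + \<tau>^2). As H has norm at most 1,
  L is a contraction, so \<tau> need not be small. In the constant 6, a 2 is paid on each side of
  \<sigma> for replacing the evolution by L, and 1 for each of the two positive second-order terms.
  In the accumulation the old error is conjugated by the exact evolution instead of being sent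
  through the channel; of the channel it is then enough that it maps densities to densities. The
  input groups the copies by state, while the steps consume them in pairs. Reconciling the two
  orders is the purpose of the index arithmetic, in which i * b + k is the composite index used by
  \<open>kron\<close>.\<close>

lemma sum_lessThan_mult:
  fixes f :: "nat \<Rightarrow> 'a::comm_monoid_add"
  shows "(\<Sum>k<a * b. f k) = (\<Sum>i<a. \<Sum>j<b. f (i * b + j))"
proof (induction a)
  case (Suc a)
  have "(\<Sum>k<a * b + c. f k) = (\<Sum>k<a * b. f k) + (\<Sum>j<c. f (a * b + j))" for c
    by (induction c) (auto simp: add.assoc)
  then show ?case using Suc by (simp add: add.commute)
qed simp

lemma mult_add_less_mult:
  assumes "(i::nat) < a" "j < b"
  shows "i * b + j < a * b"
proof -
  have "i * b + j < Suc i * b" using assms by simp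
  also have "\<dots> \<le> a * b" using assms by (intro mult_le_mono1) simp
  finally show ?thesis .
qed

lemma mat_index_mult_sum:
  "A \<in> carrier_mat m n \<Longrightarrow> B \<in> carrier_mat n p \<Longrightarrow> i < m \<Longrightarrow> j < p \<Longrightarrow>
    (A * B) $$ (i, j) = (\<Sum>k<n. A $$ (i, k) * B $$ (k, j))"
  by (simp add: scalar_prod_def atLeast0LessThan)

lemma cadj_carrier [simp]: "A \<in> carrier_mat m n \<Longrightarrow> cadj A \<in> carrier_mat n m"
  by (auto simp: cadj_def)

lemma cadj_index [simp]: "i < dim_col A \<Longrightarrow> j < dim_row A \<Longrightarrow> cadj A $$ (i, j) = cnj (A $$ (j, i))"
  by (auto simp: cadj_def)

lemma cadj_dim [simp]: "dim_row (cadj A) = dim_col A" "dim_col (cadj A) = dim_row A"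
  by (auto simp: cadj_def)

lemma cadj_cadj [simp]: "cadj (cadj A) = A"
  by (rule eq_matI) auto

lemma cadj_one [simp]: "cadj (1\<^sub>m n) = 1\<^sub>m n"
  by (rule eq_matI) auto

lemma cadj_mult:
  assumes "A \<in> carrier_mat m n" "B \<in> carrier_mat n p"
  shows "cadj (A * B) = cadj B * cadj A"
  by (rule eq_matI) (use assms in \<open>auto simp: scalar_prod_def mult.commute\<close>)

lemma cadj_add:
  assumes "A \<in> carrier_mat m n" "B \<in> carrier_mat m n"
  shows "cadj (A + B) = cadj A + cadj B"
  by (rule eq_matI) (use assms in auto)

lemma cadj_minus:
  assumes "A \<in> carrier_mat m n" "B \<in> carrier_mat m n"
  shows "cadj (A - B) = cadj A - cadj B"
  by (rule eq_matI) (use assms in auto)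

lemma cadj_smult: "cadj (c \<cdot>\<^sub>m A) = cnj c \<cdot>\<^sub>m cadj A"
  by (rule eq_matI) auto

lemma cadj_eqI:
  assumes "A \<in> carrier_mat n n" "\<And>i j. i < n \<Longrightarrow> j < n \<Longrightarrow> cnj (A $$ (j, i)) = A $$ (i, j)"
  shows "cadj A = A"
  by (rule eq_matI) (use assms in auto)

lemma mtrace_mult_comm:
  assumes "A \<in> carrier_mat m n" "B \<in> carrier_mat n m"
  shows "mtrace (A * B) = mtrace (B * A)"
proof -
  have "mtrace (A * B) = (\<Sum>i<m. \<Sum>k<n. A $$ (i, k) * B $$ (k, i))"
    using assms by (simp add: mtrace_def scalar_prod_def atLeast0LessThan)
  also have "\<dots> = (\<Sum>k<n. \<Sum>i<m. B $$ (k, i) * A $$ (i, k))"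
    by (subst sum.swap) (simp add: mult.commute)
  also have "\<dots> = mtrace (B * A)"
    using assms by (simp add: mtrace_def scalar_prod_def atLeast0LessThan)
  finally show ?thesis .
qed

text \<open>This rule and the next fix a single dimension \<open>n\<close>, so that as conditional
  rewrite rules they leave no intermediate dimension to be guessed.\<close>

lemma mult_carrier_square: "A \<in> carrier_mat n n \<Longrightarrow> B \<in> carrier_mat n n \<Longrightarrow> A * B \<in> carrier_mat n n"
  by simp

lemma assoc_mult_square:
  "A \<in> carrier_mat n n \<Longrightarrow> B \<in> carrier_mat n n \<Longrightarrow> C \<in> carrier_mat n n \<Longrightarrow>
    A * B * C = A * (B * C :: 'a::semiring_0 mat)"
  by simp

lemma mtrace_add:
  "A \<in> carrier_mat n n \<Longrightarrow> B \<in> carrier_mat n n \<Longrightarrow> mtrace (A + B) = mtrace A + mtrace B"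
  by (simp add: mtrace_def sum.distrib)

lemma mtrace_smult: "A \<in> carrier_mat n n \<Longrightarrow> mtrace (c \<cdot>\<^sub>m A) = c * mtrace A"
  by (simp add: mtrace_def sum_distrib_left)

section \<open>Unitary diagonalisation\<close>

definition unitary_mat :: "nat \<Rightarrow> complex mat \<Rightarrow> bool" where
  "unitary_mat n V \<longleftrightarrow> V \<in> carrier_mat n n \<and> cadj V * V = 1\<^sub>m n \<and> V * cadj V = 1\<^sub>m n"

text \<open>For unitary \<open>V\<close> this is the functional calculus of a matrix whose
  eigenvectors are the columns of \<open>V\<close>. It respects products and adjoints in
  \<open>f\<close>, so identities between functions of one matrix reduce to scalar identities at the
  eigenvalues.\<close>

definition spec_mat :: "nat \<Rightarrow> complex mat \<Rightarrow> (nat \<Rightarrow> complex) \<Rightarrow> complex mat" where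
  "spec_mat n V f = V * mat_diag n f * cadj V"

lemma unitary_matD:
  assumes "unitary_mat n V"
  shows "V \<in> carrier_mat n n" "cadj V \<in> carrier_mat n n" "cadj V * V = 1\<^sub>m n" "V * cadj V = 1\<^sub>m n"
  using assms by (auto simp: unitary_mat_def)

lemma spec_mat_carrier [simp]: "V \<in> carrier_mat n n \<Longrightarrow> spec_mat n V f \<in> carrier_mat n n"
  by (auto simp: spec_mat_def)

lemma spec_mat_index:
  assumes "V \<in> carrier_mat n n" "i < n" "j < n"
  shows "spec_mat n V f $$ (i, j) = (\<Sum>k<n. V $$ (i, k) * f k * cnj (V $$ (j, k)))"
  unfolding spec_mat_def using assms
  by (simp add: mat_diag_mult_right scalar_prod_def atLeast0LessThan)

lemma cadj_spec_mat:
  assumes "V \<in> carrier_mat n n"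
  shows "cadj (spec_mat n V f) = spec_mat n V (\<lambda>k. cnj (f k))"
proof (rule eq_matI)
  have d: "dim_row (spec_mat n V g) = n" "dim_col (spec_mat n V g) = n" for g
    using assms by (auto simp: spec_mat_def)
  fix i j assume "i < dim_row (spec_mat n V (\<lambda>k. cnj (f k)))" "j < dim_col (spec_mat n V (\<lambda>k. cnj (f k)))"
  then have "i < n" "j < n" by (auto simp: d)
  then show "cadj (spec_mat n V f) $$ (i, j) = spec_mat n V (\<lambda>k. cnj (f k)) $$ (i, j)"
    by (simp add: d spec_mat_index[OF assms] mult_ac)
qed (use assms in \<open>auto simp: spec_mat_def\<close>)

lemma mult_cancel_left_inverse:
  fixes A :: "complex mat"
  assumes "U \<in> carrier_mat n n" "V \<in> carrier_mat n n" "U * V = 1\<^sub>m n" "A \<in> carrier_mat n m"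
  shows "U * (V * A) = A"
proof -
  have "U * (V * A) = (U * V) * A" by (rule assoc_mult_mat[OF assms(1,2,4), symmetric])
  then show ?thesis using assms(3) left_mult_one_mat[OF assms(4)] by simp
qed

lemma spec_mat_mult:
  assumes "unitary_mat n V"
  shows "spec_mat n V f * spec_mat n V g = spec_mat n V (\<lambda>k. f k * g k)"
proof -
  note V = unitary_matD[OF assms]
  have "spec_mat n V f * spec_mat n V g
      = V * (mat_diag n f * (cadj V * (V * (mat_diag n g * cadj V))))"
    unfolding spec_mat_def using V(1,2) by (simp add: assoc_mult_square[of _ n] mult_carrier_square[of _ n] del: assoc_mult_mat)
  also have "\<dots> = V * (mat_diag n f * (mat_diag n g * cadj V))"
    using V by (subst mult_cancel_left_inverse[of "cadj V" n V _ n]) (simp_all add: mult_carrier_square[of _ n])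
  also have "\<dots> = spec_mat n V (\<lambda>k. f k * g k)"
    unfolding spec_mat_def using V(1,2)
    by (simp add: assoc_mult_square[of _ n] mult_carrier_square[of _ n] flip: mat_diag_diag)
  finally show ?thesis .
qed

lemma spec_mat_one: "unitary_mat n V \<Longrightarrow> spec_mat n V (\<lambda>_. 1) = 1\<^sub>m n"
  by (simp add: spec_mat_def unitary_mat_def right_mult_one_mat[of V n n])

lemma spec_mat_conj:
  assumes "U \<in> carrier_mat n n" "V \<in> carrier_mat n n"
  shows "U * spec_mat n V f * cadj U = spec_mat n (U * V) f"
  unfolding spec_mat_def using assms
  by (simp add: assoc_mult_square[of _ n] mult_carrier_square[of _ n] cadj_mult[of _ n n _ n] del: assoc_mult_mat)

lemma unitary_mat_mult:
  assumes "unitary_mat n U" "unitary_mat n V"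
  shows "unitary_mat n (U * V)"
proof -
  note U = unitary_matD[OF assms(1)] and V = unitary_matD[OF assms(2)]
  have "cadj (U * V) * (U * V) = cadj V * (cadj U * (U * V))"
    "(U * V) * cadj (U * V) = U * (V * (cadj V * cadj U))"
    using U(1,2) V(1,2) by (simp_all add: assoc_mult_square[of _ n] mult_carrier_square[of _ n] cadj_mult[of _ n n _ n] del: assoc_mult_mat)
  then show ?thesis
    using U V mult_cancel_left_inverse[of "cadj U" n U V] mult_cancel_left_inverse[of V n "cadj V" "cadj U"]
    by (simp add: unitary_mat_def)
qed

lemma mtrace_spec_mat:
  assumes "unitary_mat n V"
  shows "mtrace (spec_mat n V f) = (\<Sum>k<n. f k)"
proof -
  note V = unitary_matD[OF assms]
  have "mtrace (spec_mat n V f) = mtrace (cadj V * (V * mat_diag n f))"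
    unfolding spec_mat_def using V by (intro mtrace_mult_comm[of _ n n]) auto
  also have "cadj V * (V * mat_diag n f) = mat_diag n f"
    using V by (intro mult_cancel_left_inverse[of _ n _ _ n]) auto
  finally show ?thesis by (simp add: mtrace_def mat_diag_def)
qed

text \<open>A Householder reflection; choosing \<open>v\<^sub>0 \<le> 0\<close> keeps \<open>v - e\<^sub>0\<close> nonzero.\<close>

lemma reflection_first_column:
  fixes v :: "nat \<Rightarrow> complex"
  assumes norm: "(\<Sum>i<Suc n. v i * cnj (v i)) = 1" and v0: "v 0 = complex_of_real a" "a \<le> 0"
  obtains U where "unitary_mat (Suc n) U" "cadj U = U" "\<And>i. i < Suc n \<Longrightarrow> U $$ (i, 0) = v i"
proof -
  define u where "u i = (if i = 0 then v 0 - 1 else v i)" for i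
  \<comment> \<open>The Householder coefficient 2 / |u|^2: since \<open>v\<close> is a unit vector
    with real first entry \<open>a\<close>, |u|^2 = 2 - 2 a.\<close>
  define c where "c = complex_of_real (1 / (1 - a))"
  define U where "U = mat (Suc n) (Suc n) (\<lambda>(i, j). (if i = j then 1 else 0) - c * u i * cnj (u j))"
  have split: "(\<Sum>i<Suc n. f i) = f 0 + (\<Sum>i<n. f (Suc i))" for f :: "nat \<Rightarrow> complex"
    by (rule sum.lessThan_Suc_shift)
  have "c * complex_of_real (1 - a) = 1"
    unfolding c_def of_real_mult[symmetric] using v0 by simp
  then have c1: "c * (1 - complex_of_real a) = 1" by simp
  have c: "c * (2 - 2 * complex_of_real a) = 2"
    using arg_cong[OF c1, of "\<lambda>x. 2 * x"] by (simp add: algebra_simps)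
  have uu: "(\<Sum>k<Suc n. u k * cnj (u k)) = 2 - 2 * complex_of_real a"
  proof -
    have "(\<Sum>k<n. v (Suc k) * cnj (v (Suc k))) = 1 - v 0 * cnj (v 0)"
      using norm unfolding split by (simp add: eq_diff_eq add.commute)
    then have "(\<Sum>k<Suc n. u k * cnj (u k)) = (v 0 - 1) * cnj (v 0 - 1) + (1 - v 0 * cnj (v 0))"
      unfolding split by (simp add: u_def)
    then show ?thesis unfolding v0(1) by (simp add: algebra_simps)
  qed
  have [simp]: "cnj c = c" by (simp add: c_def)
  have Uc: "U \<in> carrier_mat (Suc n) (Suc n)" by (simp add: U_def)
  have adj: "cadj U = U"
    by (rule cadj_eqI[OF Uc]) (auto simp: U_def mult_ac)
  have sq: "U * U = 1\<^sub>m (Suc n)"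
  proof (rule eq_matI)
    fix i j assume "i < dim_row (1\<^sub>m (Suc n) :: complex mat)" "j < dim_col (1\<^sub>m (Suc n) :: complex mat)"
    then have ij: "i < Suc n" "j < Suc n" by auto
    have "(U * U) $$ (i, j) = (\<Sum>k<Suc n. ((if i = k then 1 else 0) - c * u i * cnj (u k))
        * ((if k = j then 1 else 0) - c * u k * cnj (u j)))"
      using ij by (subst mat_index_mult_sum[OF Uc Uc]) (auto simp: U_def)
    also have "\<dots> = (\<Sum>k<Suc n. (if k = i then if i = j then 1 else 0 else 0)
        - (if k = i then c * u i * cnj (u j) else 0)
        - (if k = j then c * u i * cnj (u j) else 0) + c * (c * u i * cnj (u j)) * (u k * cnj (u k)))"
      by (rule sum.cong) (auto simp: algebra_simps)
    also have "\<dots> = (if i = j then 1 else 0) - c * u i * cnj (u j) - c * u i * cnj (u j)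
        + c * (c * u i * cnj (u j)) * (\<Sum>k<Suc n. u k * cnj (u k))"
      unfolding sum.distrib sum_subtractf sum_distrib_left[symmetric]
      using ij by (simp add: sum.delta del: sum.lessThan_Suc)
    also have "c * (c * u i * cnj (u j)) * (\<Sum>k<Suc n. u k * cnj (u k)) = 2 * (c * u i * cnj (u j))"
      unfolding uu using c by (metis mult.assoc mult.commute)
    finally show "(U * U) $$ (i, j) = 1\<^sub>m (Suc n) $$ (i, j)" using ij by simp
  qed (use Uc in auto)
  have "U $$ (i, 0) = v i" if "i < Suc n" for i
  proof -
    have "U $$ (i, 0) = (if i = 0 then 1 else 0) + c * (1 - complex_of_real a) * u i"
      using that v0(1) by (simp add: U_def u_def algebra_simps)
    then show ?thesis unfolding c1 by (simp add: u_def)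
  qed
  then show thesis using that[of U] Uc adj sq by (auto simp: unitary_mat_def)
qed

text \<open>Deflation by induction on the dimension: a reflection that takes the first basis vector
  to a unit eigenvector clears the first column outside the diagonal. Hermitian symmetry clears the
  first row too, and the remaining block falls under the induction hypothesis.\<close>

theorem hermitian_diagonalisable:
  assumes "A \<in> carrier_mat n n" "cadj A = A"
  obtains V f where "unitary_mat n V" "A = spec_mat n V (\<lambda>k. complex_of_real (f k))"
proof -
  have "\<exists>V (f :: nat \<Rightarrow> real). unitary_mat n V \<and> A = spec_mat n V (\<lambda>k. complex_of_real (f k))"
    using assms
  proof (induction n arbitrary: A)
    case 0
    then show ?case
      by (intro exI[of _ "1\<^sub>m 0"] exI[of _ "\<lambda>_. 0"]) (auto simp: unitary_mat_def spec_mat_def)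
  next
    case (Suc n)
    note A = Suc.prems
    obtain e w where "eigenvector A w e"
      using spectrum_non_empty[OF A(1)] by (auto simp: spectrum_def eigenvalue_def)
    then have w: "w \<in> carrier_vec (Suc n)" "w \<noteq> 0\<^sub>v (Suc n)" "A *\<^sub>v w = e \<cdot>\<^sub>v w"
      using A(1) by (auto simp: eigenvector_def)
    define r where "r = L2_set (\<lambda>i. cmod (w $ i)) {..<Suc n}"
    have "r \<noteq> 0"
    proof
      assume "r = 0"
      then have "\<forall>i<Suc n. w $ i = 0" by (simp add: r_def L2_set_eq_0_iff del: sum.lessThan_Suc)
      then show False using w by (auto intro!: eq_vecI)
    qed
    then have r: "r > 0" by (simp add: r_def L2_set_nonneg order.not_eq_order_implies_strict)
    \<comment> \<open>A phase that makes the first coordinate of the eigenvector real and at most 0,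
      as \<open>reflection_first_column\<close> demands.\<close>
    obtain p where p: "cmod p = 1" "p * w $ 0 = - complex_of_real (cmod (w $ 0))"
    proof (cases "w $ 0 = 0")
      case True
      then show thesis using that[of 1] by simp
    next
      case False
      then show thesis
        using that[of "- (of_real (cmod (w $ 0)) / w $ 0)"] by (simp add: norm_divide)
    qed
    define v where "v i = p * w $ i / complex_of_real r" for i
    have "(\<Sum>i<Suc n. v i * cnj (v i)) = complex_of_real (\<Sum>i<Suc n. (cmod (w $ i))\<^sup>2 / r\<^sup>2)"
      unfolding of_real_sum
      by (rule sum.cong)
        (auto simp: v_def norm_mult norm_divide p power_divide simp flip: complex_norm_square simp del: complex_cnj_mult complex_cnj_divide)
    also have "(\<Sum>i<Suc n. (cmod (w $ i))\<^sup>2 / r\<^sup>2) = 1"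
      unfolding sum_divide_distrib[symmetric] using r
      by (simp add: r_def L2_set_def sum_nonneg del: sum.lessThan_Suc)
    finally have vnorm: "(\<Sum>i<Suc n. v i * cnj (v i)) = 1" by simp
    have v0: "v 0 = complex_of_real (- cmod (w $ 0) / r)" using p by (simp add: v_def)
    obtain U where U: "unitary_mat (Suc n) U" "cadj U = U" "\<And>i. i < Suc n \<Longrightarrow> U $$ (i, 0) = v i"
      using reflection_first_column[OF vnorm v0] r by auto
    note Uc = unitary_matD[OF U(1), unfolded U(2)]
    have Av: "(\<Sum>j<Suc n. A $$ (i, j) * v j) = e * v i" if "i < Suc n" for i
    proof -
      have "(\<Sum>j<Suc n. A $$ (i, j) * w $ j) = e * w $ i"
        using arg_cong[OF w(3), of "\<lambda>x. x $ i"] that A w(1)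
        by (simp add: scalar_prod_def atLeast0LessThan del: sum.lessThan_Suc)
      then have "p / r * (\<Sum>j<Suc n. A $$ (i, j) * w $ j) = p / r * (e * w $ i)" by simp
      then show ?thesis
        by (simp add: v_def sum_distrib_left mult_ac del: sum.lessThan_Suc)
    qed
    define A' where "A' = U * A * U"
    have A': "A' \<in> carrier_mat (Suc n) (Suc n)" using Uc A by (simp add: A'_def)
    have A'h: "cadj A' = A'"
      unfolding A'_def using Uc A U(2)
      by (simp add: cadj_mult[of _ "Suc n" "Suc n" _ "Suc n"] assoc_mult_square[of _ "Suc n"] mult_carrier_square[of _ "Suc n"] del: assoc_mult_mat)
    have col0: "A' $$ (i, 0) = (if i = 0 then e else 0)" if i: "i < Suc n" for i
    proof -
      have "A' $$ (i, 0) = (U * (A * U)) $$ (i, 0)"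
        using Uc A by (simp add: A'_def assoc_mult_square[of _ "Suc n"] mult_carrier_square[of _ "Suc n"] del: assoc_mult_mat)
      also have "\<dots> = (\<Sum>k<Suc n. U $$ (i, k) * (A * U) $$ (k, 0))"
        using i Uc A by (intro mat_index_mult_sum) auto
      also have "\<dots> = (\<Sum>k<Suc n. e * (U $$ (i, k) * U $$ (k, 0)))"
      proof (rule sum.cong)
        fix k assume "k \<in> {..<Suc n}"
        then have "(A * U) $$ (k, 0) = e * v k"
          using Av[of k] by (subst mat_index_mult_sum[OF A(1) Uc(1)]) (auto simp: U(3) simp del: sum.lessThan_Suc)
        then show "U $$ (i, k) * (A * U) $$ (k, 0) = e * (U $$ (i, k) * U $$ (k, 0))"
          using U(3) \<open>k \<in> _\<close> by simp
      qed simp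
      also have "\<dots> = e * (U * U) $$ (i, 0)"
        using i by (subst mat_index_mult_sum[OF Uc(1) Uc(1)]) (auto simp: sum_distrib_left simp del: sum.lessThan_Suc)
      finally show ?thesis using Uc i by simp
    qed
    have sym: "cnj (A' $$ (j, i)) = A' $$ (i, j)" if "i < Suc n" "j < Suc n" for i j
      using arg_cong[OF A'h, of "\<lambda>X. X $$ (i, j)"] that A' by simp
    \<comment> \<open>The conjugated matrix is now block diagonal, with blocks \<open>e\<close> and
      \<open>B\<close>; its corner entry equals its own conjugate, so the eigenvalue is
      real.\<close>
    have row0: "A' $$ (0, i) = (if i = 0 then e else 0)" if i: "i < Suc n" for i
      using sym[of 0 i] col0[OF i] col0[of 0] sym[of 0 0] i by auto
    have ereal: "e = complex_of_real (Re e)"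
      using sym[of 0 0] col0[of 0] by (simp add: complex_eq_iff)
    define B where "B = mat n n (\<lambda>(i, j). A' $$ (Suc i, Suc j))"
    have "cadj B = B" by (rule cadj_eqI[of _ n]) (auto simp: B_def sym)
    then obtain W g where W: "unitary_mat n W" "B = spec_mat n W (\<lambda>k. complex_of_real (g k))"
      using Suc.IH[of B] by (auto simp: B_def)
    note Wc = unitary_matD[OF W(1)]
    \<comment> \<open>The block matrix with the blocks 1 and \<open>W\<close>.\<close>
    define V where "V = mat (Suc n) (Suc n) (\<lambda>(i, j). case (i, j) of
        (0, 0) \<Rightarrow> 1 | (Suc i, Suc j) \<Rightarrow> W $$ (i, j) | _ \<Rightarrow> 0)"
    define f where "f = case_nat (Re e) g"
    have Vc: "V \<in> carrier_mat (Suc n) (Suc n)" by (simp add: V_def)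
    have one: "(\<Sum>k<n. cnj (W $$ (k, i)) * W $$ (k, j)) = (if i = j then 1 else 0)"
      "(\<Sum>k<n. W $$ (i, k) * cnj (W $$ (j, k))) = (if i = j then 1 else 0)"
      if "i < n" "j < n" for i j
      using arg_cong[OF Wc(3), of "\<lambda>X. X $$ (i, j)"] arg_cong[OF Wc(4), of "\<lambda>X. X $$ (i, j)"] that Wc(1)
      by (simp_all add: scalar_prod_def atLeast0LessThan)
    have VU: "unitary_mat (Suc n) V"
      unfolding unitary_mat_def
    proof (intro conjI Vc eq_matI)
      fix i j assume "i < dim_row (1\<^sub>m (Suc n) :: complex mat)" "j < dim_col (1\<^sub>m (Suc n) :: complex mat)"
      then have ij: "i < Suc n" "j < Suc n" by auto
      have "(cadj V * V) $$ (i, j) = (\<Sum>k<Suc n. cnj (V $$ (k, i)) * V $$ (k, j))"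
        using ij Vc by (subst mat_index_mult_sum[OF cadj_carrier[OF Vc] Vc]) (auto intro!: sum.cong)
      then show "(cadj V * V) $$ (i, j) = 1\<^sub>m (Suc n) $$ (i, j)"
        using ij by (cases i; cases j) (simp_all add: sum.lessThan_Suc_shift V_def one del: sum.lessThan_Suc)
      have "(V * cadj V) $$ (i, j) = (\<Sum>k<Suc n. V $$ (i, k) * cnj (V $$ (j, k)))"
        using ij Vc by (subst mat_index_mult_sum[OF Vc cadj_carrier[OF Vc]]) (auto intro!: sum.cong)
      then show "(V * cadj V) $$ (i, j) = 1\<^sub>m (Suc n) $$ (i, j)"
        using ij by (cases i; cases j) (simp_all add: sum.lessThan_Suc_shift V_def one del: sum.lessThan_Suc)
    qed (use Vc in auto)
    have A'_eq: "A' = spec_mat (Suc n) V (\<lambda>k. complex_of_real (f k))"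
    proof (rule eq_matI)
      fix i j assume "i < dim_row (spec_mat (Suc n) V (\<lambda>k. complex_of_real (f k)))"
        "j < dim_col (spec_mat (Suc n) V (\<lambda>k. complex_of_real (f k)))"
      then have ij: "i < Suc n" "j < Suc n" using Vc by (auto simp: spec_mat_def)
      have "A' $$ (Suc i', Suc j') = (\<Sum>k<n. W $$ (i', k) * complex_of_real (g k) * cnj (W $$ (j', k)))"
        if "i' < n" "j' < n" for i' j'
        using arg_cong[OF W(2), of "\<lambda>X. X $$ (i', j')"] that Wc(1) by (simp add: B_def spec_mat_index)
      then show "A' $$ (i, j) = spec_mat (Suc n) V (\<lambda>k. complex_of_real (f k)) $$ (i, j)"
        using ij row0 col0 ereal unfolding spec_mat_index[OF Vc ij]
        by (cases i; cases j) (simp_all add: sum.lessThan_Suc_shift V_def f_def del: sum.lessThan_Suc)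
    qed (use A' Vc in \<open>auto simp: spec_mat_def\<close>)
    have "A = U * A' * U"
      unfolding A'_def using Uc A mult_cancel_left_inverse[of U "Suc n" U]
      by (simp add: assoc_mult_square[of _ "Suc n"] mult_carrier_square[of _ "Suc n"] del: assoc_mult_mat)
    also have "\<dots> = spec_mat (Suc n) (U * V) (\<lambda>k. complex_of_real (f k))"
      unfolding A'_eq using spec_mat_conj[OF Uc(1) Vc] by (simp add: U(2))
    finally show ?case using unitary_mat_mult[OF U(1) VU] by blast
  qed
  then show thesis using that by blast
qed

section \<open>Functional calculus: powers, exponentials, positivity\<close>

lemma spec_mat_dim [simp]:
  "V \<in> carrier_mat n n \<Longrightarrow> dim_row (spec_mat n V f) = n"
  "V \<in> carrier_mat n n \<Longrightarrow> dim_col (spec_mat n V f) = n"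
  by (auto simp: spec_mat_def)

lemma spec_mat_smult:
  assumes "V \<in> carrier_mat n n"
  shows "c \<cdot>\<^sub>m spec_mat n V f = spec_mat n V (\<lambda>k. c * f k)"
proof (rule eq_matI)
  have d: "dim_row (spec_mat n V g) = n" "dim_col (spec_mat n V g) = n" for g
    using assms by (auto simp: spec_mat_def)
  fix i j assume "i < dim_row (spec_mat n V (\<lambda>k. c * f k))" "j < dim_col (spec_mat n V (\<lambda>k. c * f k))"
  then have "i < n" "j < n" by (auto simp: d)
  then show "(c \<cdot>\<^sub>m spec_mat n V f) $$ (i, j) = spec_mat n V (\<lambda>k. c * f k) $$ (i, j)"
    by (simp add: d spec_mat_index[OF assms] sum_distrib_left mult_ac)
qed (use assms in \<open>auto simp: spec_mat_def\<close>)

lemma spec_mat_minus: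
  assumes "V \<in> carrier_mat n n"
  shows "spec_mat n V f - spec_mat n V g = spec_mat n V (\<lambda>k. f k - g k)"
proof (rule eq_matI)
  have d: "dim_row (spec_mat n V g) = n" "dim_col (spec_mat n V g) = n" for g
    using assms by (auto simp: spec_mat_def)
  fix i j assume "i < dim_row (spec_mat n V (\<lambda>k. f k - g k))" "j < dim_col (spec_mat n V (\<lambda>k. f k - g k))"
  then have "i < n" "j < n" by (auto simp: d)
  then show "(spec_mat n V f - spec_mat n V g) $$ (i, j) = spec_mat n V (\<lambda>k. f k - g k) $$ (i, j)"
    by (simp add: d spec_mat_index[OF assms] algebra_simps flip: sum_subtractf)
qed (use assms in \<open>auto simp: spec_mat_def\<close>)

lemma spec_mat_pow:
  assumes "unitary_mat n V"
  shows "spec_mat n V f ^\<^sub>m m = spec_mat n V (\<lambda>k. f k ^ m)"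
proof (induction m)
  case 0
  then show ?case using assms unitary_matD(1)[OF assms] by (simp add: spec_mat_one)
next
  case (Suc m)
  then show ?case by (simp add: spec_mat_mult[OF assms] mult.commute)
qed

text \<open>Powers act on the eigenvalues, so every entry of the exponential series is a fixed
  finite linear combination of convergent scalar exponential series.\<close>

lemma mat_exp_spec_mat:
  assumes "unitary_mat n V"
  shows "mat_exp (spec_mat n V f) = spec_mat n V (\<lambda>k. exp (f k))"
proof (rule eq_matI)
  note V = unitary_matD(1)[OF assms]
  have d: "dim_row (spec_mat n V g) = n" "dim_col (spec_mat n V g) = n" for g
    using V by (auto simp: spec_mat_def)
  fix i j assume "i < dim_row (spec_mat n V (\<lambda>k. exp (f k)))" "j < dim_col (spec_mat n V (\<lambda>k. exp (f k)))"
  then have ij: "i < n" "j < n" by (auto simp: d)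
  have "(\<lambda>m. \<Sum>k<n. V $$ (i, k) * (f k ^ m /\<^sub>R fact m) * cnj (V $$ (j, k)))
      sums (\<Sum>k<n. V $$ (i, k) * exp (f k) * cnj (V $$ (j, k)))"
    by (intro sums_sum sums_mult sums_mult2 exp_converges)
  moreover have "(\<lambda>m. \<Sum>k<n. V $$ (i, k) * (f k ^ m /\<^sub>R fact m) * cnj (V $$ (j, k)))
      = (\<lambda>m. (spec_mat n V f ^\<^sub>m m) $$ (i, j) / of_nat (fact m))"
    by (simp add: fun_eq_iff spec_mat_pow[OF assms] spec_mat_index[OF V ij] sum_divide_distrib
        scaleR_conv_of_real divide_inverse sum_distrib_left mult_ac)
  ultimately show "mat_exp (spec_mat n V f) $$ (i, j) = spec_mat n V (\<lambda>k. exp (f k)) $$ (i, j)"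
    using ij sums_unique by (fastforce simp: mat_exp_def d spec_mat_index[OF V ij])
qed (use unitary_matD(1)[OF assms] in \<open>auto simp: spec_mat_def mat_exp_def\<close>)

text \<open>In the coordinates of \<open>v\<close> along the columns of \<open>V\<close> the form is
  diagonal with weights \<open>f\<close>.\<close>

lemma quadratic_form_spec_mat:
  assumes "V \<in> carrier_mat n n"
  shows "(\<Sum>i<n. \<Sum>j<n. cnj (v i) * spec_mat n V f $$ (i, j) * v j)
    = (\<Sum>k<n. f k * of_real ((cmod (\<Sum>i<n. cnj (V $$ (i, k)) * v i))\<^sup>2))"
proof -
  have "(\<Sum>i<n. \<Sum>j<n. cnj (v i) * spec_mat n V f $$ (i, j) * v j)
      = (\<Sum>i<n. \<Sum>j<n. \<Sum>k<n. f k * (cnj (v i) * V $$ (i, k)) * (cnj (V $$ (j, k)) * v j))"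
    by (intro sum.cong refl) (simp add: spec_mat_index[OF assms] sum_distrib_left sum_distrib_right mult_ac)
  also have "\<dots> = (\<Sum>i<n. \<Sum>k<n. \<Sum>j<n. f k * (cnj (v i) * V $$ (i, k)) * (cnj (V $$ (j, k)) * v j))"
    by (intro sum.cong refl sum.swap)
  also have "\<dots> = (\<Sum>k<n. \<Sum>i<n. \<Sum>j<n. f k * (cnj (v i) * V $$ (i, k)) * (cnj (V $$ (j, k)) * v j))"
    by (rule sum.swap)
  also have "\<dots> = (\<Sum>k<n. f k * (cnj (\<Sum>i<n. cnj (V $$ (i, k)) * v i) * (\<Sum>j<n. cnj (V $$ (j, k)) * v j)))"
    by (intro sum.cong refl) (simp add: sum_product sum_distrib_left mult_ac)
  also have "\<dots> = (\<Sum>k<n. f k * of_real ((cmod (\<Sum>i<n. cnj (V $$ (i, k)) * v i))\<^sup>2))"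
    by (intro sum.cong refl) (simp only: complex_norm_square mult.commute)
  finally show ?thesis .
qed

lemma psd_spec_mat:
  assumes "V \<in> carrier_mat n n" "\<And>k. k < n \<Longrightarrow> f k \<ge> 0"
  shows "psd_mat n (spec_mat n V (\<lambda>k. complex_of_real (f k)))"
  using assms
  by (auto simp: psd_mat_def cadj_spec_mat quadratic_form_spec_mat simp flip: of_real_mult of_real_sum
      intro!: sum_nonneg)

lemma unitary_conj_diag_entry:
  assumes "V \<in> carrier_mat n n" "S \<in> carrier_mat n n" "k < n"
  shows "(cadj V * S * V) $$ (k, k) = (\<Sum>i<n. \<Sum>j<n. cnj (V $$ (i, k)) * S $$ (i, j) * V $$ (j, k))"
proof -
  have "(cadj V * S * V) $$ (k, k) = (\<Sum>j<n. (\<Sum>i<n. cnj (V $$ (i, k)) * S $$ (i, j)) * V $$ (j, k))"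
    using assms by (subst mat_index_mult_sum[of _ n n _ n])
      (auto simp: mult_carrier_square mat_index_mult_sum[of _ n n _ n] simp del: index_mult_mat intro!: sum.cong)
  then show ?thesis by (subst sum.swap) (simp add: sum_distrib_right)
qed

text \<open>A diagonal entry after the change of basis is the quadratic form of \<open>S\<close> at
  a column of \<open>V\<close>.\<close>

lemma psd_conj_diag_nonneg:
  assumes "psd_mat n S" "V \<in> carrier_mat n n" "k < n"
  shows "0 \<le> Re ((cadj V * S * V) $$ (k, k))"
proof -
  have S: "S \<in> carrier_mat n n" using assms by (simp add: psd_mat_def)
  have "\<forall>v. 0 \<le> Re (\<Sum>i<n. \<Sum>j<n. cnj (v i) * S $$ (i, j) * v j)"
    using assms(1) by (simp add: psd_mat_def)
  from spec[OF this, of "\<lambda>i. V $$ (i, k)"] show ?thesis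
    unfolding unitary_conj_diag_entry[OF assms(2) S assms(3)] .
qed

lemma unitary_conj_spec_mat:
  assumes "unitary_mat n V"
  shows "cadj V * spec_mat n V f * V = mat_diag n f"
proof -
  note V = unitary_matD[OF assms]
  have "cadj V * spec_mat n V f * V = cadj V * (V * (mat_diag n f * (cadj V * V)))"
    unfolding spec_mat_def using V(1,2)
    by (simp add: assoc_mult_square[of _ n] mult_carrier_square[of _ n] del: assoc_mult_mat)
  also have "\<dots> = cadj V * (V * mat_diag n f)"
    unfolding V(3) by (simp add: right_mult_one_mat[of _ n n])
  also have "\<dots> = mat_diag n f"
    using V by (intro mult_cancel_left_inverse[of _ n _ _ n]) auto
  finally show ?thesis .
qed

lemma psd_eigenvalues:
  assumes "psd_mat n A"
  obtains V f where "unitary_mat n V" "A = spec_mat n V (\<lambda>k. complex_of_real (f k))"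
    "\<And>k. k < n \<Longrightarrow> f k \<ge> 0"
proof -
  obtain V f where V: "unitary_mat n V" "A = spec_mat n V (\<lambda>k. complex_of_real (f k))"
    using hermitian_diagonalisable[of A n] assms by (auto simp: psd_mat_def)
  have "f k \<ge> 0" if "k < n" for k
    using psd_conj_diag_nonneg[OF assms unitary_matD(1)[OF V(1)] that] that
    unfolding V(2) unitary_conj_spec_mat[OF V(1)] by (simp add: mat_diag_def)
  then show thesis using that V by blast
qed

text \<open>In an eigenbasis of \<open>S - T\<close> with eigenvalues \<open>f\<close>, the diagonal of \<open>S\<^sup>2 - T\<^sup>2 = 0\<close> reads
  \<open>f k * (S k k + T k k) = 0\<close>.\<close>

lemma psd_sqrt_unique:
  assumes S: "psd_mat n S" and T: "psd_mat n T" and eq: "S * S = T * T"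
  shows "S = T"
proof -
  have Sc: "S \<in> carrier_mat n n" "cadj S = S" and Tc: "T \<in> carrier_mat n n" "cadj T = T"
    using S T by (auto simp: psd_mat_def)
  obtain V f where V: "unitary_mat n V" "S - T = spec_mat n V (\<lambda>k. complex_of_real (f k))"
  proof -
    have "S - T \<in> carrier_mat n n" "cadj (S - T) = S - T"
      using Sc Tc by (auto simp: cadj_minus[of _ n n])
    then show thesis using hermitian_diagonalisable that by blast
  qed
  note Vc = unitary_matD[OF V(1)]
  define S' where "S' = cadj V * S * V"
  define T' where "T' = cadj V * T * V"
  have conj_sq: "(cadj V * X * V) * (cadj V * X * V) = cadj V * (X * X) * V" if X: "X \<in> carrier_mat n n" for X
  proof -
    have "(cadj V * X * V) * (cadj V * X * V) = cadj V * (X * (V * (cadj V * (X * V))))"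
      using X Vc(1,2) by (simp add: assoc_mult_square[of _ n] mult_carrier_square[of _ n] del: assoc_mult_mat)
    also have "V * (cadj V * (X * V)) = X * V"
      using X Vc by (intro mult_cancel_left_inverse[of _ n _ _ n]) auto
    finally show ?thesis
      using X Vc(1,2) by (simp add: assoc_mult_square[of _ n] mult_carrier_square[of _ n] del: assoc_mult_mat)
  qed
  have S'c: "S' \<in> carrier_mat n n" and T'c: "T' \<in> carrier_mat n n"
    using Sc Tc Vc by (auto simp: S'_def T'_def)
  have sq: "S' * S' = T' * T'"
    using conj_sq Sc Tc eq by (simp add: S'_def T'_def)
  have diff: "S' - T' = mat_diag n (\<lambda>k. complex_of_real (f k))"
  proof -
    have "S' - T' = cadj V * (S - T) * V"
      unfolding S'_def T'_def using Sc Tc Vc(1,2)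
      by (simp add: mult_minus_distrib_mat[of _ n n _ n] minus_mult_distrib_mat[of _ n n _ _ n] mult_carrier_square[of _ n])
    then show ?thesis unfolding V(2) by (simp add: unitary_conj_spec_mat[OF V(1)])
  qed
  have ent: "S' $$ (i, j) = T' $$ (i, j) + (if i = j then complex_of_real (f i) else 0)"
    if "i < n" "j < n" for i j
    using arg_cong[OF diff, of "\<lambda>X. X $$ (i, j)"] that S'c T'c by (simp add: mat_diag_def diff_eq_eq split: if_splits)
  have "f k = 0" if k: "k < n" for k
  proof -
    have "(\<Sum>j<n. S' $$ (k, j) * S' $$ (j, k)) = (\<Sum>j<n. T' $$ (k, j) * T' $$ (j, k))"
      using arg_cong[OF sq, of "\<lambda>X. X $$ (k, k)"] k S'c T'c
      by (simp add: mat_index_mult_sum[of _ n n _ n] del: index_mult_mat)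
    \<comment> \<open>\<open>S'\<close> and \<open>T'\<close> differ only on the diagonal, so the
      terms with j different from k agree on both sides and cancel.\<close>
    then have "S' $$ (k, k) * S' $$ (k, k) = T' $$ (k, k) * T' $$ (k, k)"
      using k by (simp add: sum.remove[of "{..<n}" k] ent)
    then have "complex_of_real (f k) * (S' $$ (k, k) + T' $$ (k, k)) = 0"
      using ent[OF k k] by (simp add: algebra_simps)
    \<comment> \<open>In the second case two nonnegative numbers add up to 0, so both vanish and
      with them their difference \<open>f k\<close>.\<close>
    then have "f k = 0 \<or> Re (S' $$ (k, k)) + Re (T' $$ (k, k)) = 0"
      by (auto simp: complex_eq_iff)
    moreover have "0 \<le> Re (S' $$ (k, k))" "0 \<le> Re (T' $$ (k, k))"
      using psd_conj_diag_nonneg[OF S Vc(1) k] psd_conj_diag_nonneg[OF T Vc(1) k]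
      by (auto simp: S'_def T'_def)
    moreover have "f k = Re (S' $$ (k, k)) - Re (T' $$ (k, k))"
      using ent[OF k k] by simp
    ultimately show ?thesis by linarith
  qed
  then have "S $$ (i, j) - T $$ (i, j) = 0" if "i < n" "j < n" for i j
    using arg_cong[OF V(2), of "\<lambda>X. X $$ (i, j)"] that Sc Tc Vc(1)
    by (simp add: spec_mat_index)
  then show ?thesis using Sc Tc by (intro eq_matI) auto
qed

text \<open>Uniqueness gives the definite description in \<open>psd_sqrt\<close> its value, so a
  positive root read off from a diagonalisation may be used.\<close>

lemma psd_sqrt_eqI:
  assumes "psd_mat n S" "S * S = M" "M \<in> carrier_mat n n"
  shows "psd_sqrt M = S"
  unfolding psd_sqrt_def using assms psd_sqrt_unique by (intro the_equality) auto

section \<open>Operator norm bounds\<close>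

definition vnorm :: "complex vec \<Rightarrow> real" where
  "vnorm v = L2_set (\<lambda>i. cmod (v $ i)) {..<dim_vec v}"

text \<open>A relation in place of the operator norm: bounds can be added and multiplied without
  forming a supremum.\<close>

definition op_bound :: "real \<Rightarrow> complex mat \<Rightarrow> bool" where
  "op_bound c A \<longleftrightarrow> 0 \<le> c \<and> (\<forall>v\<in>carrier_vec (dim_col A). vnorm (A *\<^sub>v v) \<le> c * vnorm v)"

lemma op_boundI:
  assumes "0 \<le> c" "A \<in> carrier_mat m n" "\<And>v. v \<in> carrier_vec n \<Longrightarrow> vnorm (A *\<^sub>v v) \<le> c * vnorm v"
  shows "op_bound c A"
  using assms by (auto simp: op_bound_def)

lemma op_boundD:
  assumes "op_bound c A" "A \<in> carrier_mat m n" "v \<in> carrier_vec n"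
  shows "vnorm (A *\<^sub>v v) \<le> c * vnorm v"
  using assms by (auto simp: op_bound_def)

lemma op_bound_nonneg: "op_bound c A \<Longrightarrow> 0 \<le> c"
  by (simp add: op_bound_def)

lemma vnorm_nonneg [simp]: "0 \<le> vnorm v"
  by (simp add: vnorm_def L2_set_nonneg)

lemma vnorm_add:
  assumes "v \<in> carrier_vec n" "w \<in> carrier_vec n"
  shows "vnorm (v + w) \<le> vnorm v + vnorm w"
proof -
  have "vnorm (v + w) \<le> L2_set (\<lambda>i. cmod (v $ i) + cmod (w $ i)) {..<n}"
    unfolding vnorm_def using assms by (auto intro!: L2_set_mono norm_triangle_ineq)
  also have "\<dots> \<le> vnorm v + vnorm w"
    unfolding vnorm_def using assms by (auto intro: L2_set_triangle_ineq)
  finally show ?thesis .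
qed

lemma vnorm_smult: "vnorm (c \<cdot>\<^sub>v v) = cmod c * vnorm v"
proof -
  have "vnorm (c \<cdot>\<^sub>v v) = L2_set (\<lambda>i. cmod c * cmod (v $ i)) {..<dim_vec v}"
    unfolding vnorm_def by (rule L2_set_cong) (auto simp: norm_mult)
  then show ?thesis by (simp add: vnorm_def L2_set_right_distrib)
qed

lemma op_bound_mult:
  assumes "op_bound a A" "op_bound b B" "A \<in> carrier_mat m n" "B \<in> carrier_mat n p"
  shows "op_bound (a * b) (A * B)"
proof (rule op_boundI)
  fix v :: "complex vec" assume v: "v \<in> carrier_vec p"
  have "vnorm (A * B *\<^sub>v v) = vnorm (A *\<^sub>v (B *\<^sub>v v))"
    using assms v by simp
  also have "\<dots> \<le> a * vnorm (B *\<^sub>v v)"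
    using assms v by (intro op_boundD) auto
  also have "\<dots> \<le> a * (b * vnorm v)"
    using assms v by (intro mult_left_mono op_boundD) (auto simp: op_bound_nonneg)
  finally show "vnorm (A * B *\<^sub>v v) \<le> a * b * vnorm v" by (simp add: mult.assoc)
qed (use assms in \<open>auto simp: op_bound_nonneg\<close>)

lemma op_bound_add:
  assumes "op_bound a A" "op_bound b B" "A \<in> carrier_mat m n" "B \<in> carrier_mat m n"
  shows "op_bound (a + b) (A + B)"
proof (rule op_boundI)
  fix v :: "complex vec" assume v: "v \<in> carrier_vec n"
  have "vnorm ((A + B) *\<^sub>v v) \<le> vnorm (A *\<^sub>v v) + vnorm (B *\<^sub>v v)"
    using assms v by (subst add_mult_distrib_mat_vec[of _ m n]) (auto intro!: vnorm_add[of _ m])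
  also have "\<dots> \<le> a * vnorm v + b * vnorm v"
    using assms v by (intro add_mono op_boundD) auto
  finally show "vnorm ((A + B) *\<^sub>v v) \<le> (a + b) * vnorm v" by (simp add: algebra_simps)
qed (use assms in \<open>auto simp: op_bound_nonneg\<close>)

lemma op_bound_smult:
  assumes "op_bound a A" "A \<in> carrier_mat m n"
  shows "op_bound (cmod c * a) (c \<cdot>\<^sub>m A)"
proof (rule op_boundI)
  fix v :: "complex vec" assume v: "v \<in> carrier_vec n"
  have "(c \<cdot>\<^sub>m A) *\<^sub>v v = c \<cdot>\<^sub>v (A *\<^sub>v v)"
    using assms(2) v by (intro eq_vecI) (auto simp: scalar_prod_def sum_distrib_left mult.assoc)
  then show "vnorm ((c \<cdot>\<^sub>m A) *\<^sub>v v) \<le> cmod c * a * vnorm v"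
    using op_boundD[OF assms v] by (simp add: vnorm_smult mult.assoc mult_left_mono)
qed (use assms in \<open>auto simp: op_bound_nonneg\<close>)

lemma op_bound_mat_diag:
  assumes "0 \<le> c" "\<And>k. k < n \<Longrightarrow> cmod (f k) \<le> c"
  shows "op_bound c (mat_diag n f)"
proof (rule op_boundI[of _ _ n])
  fix v :: "complex vec" assume v: "v \<in> carrier_vec n"
  have "(mat_diag n f *\<^sub>v v) $ i = f i * v $ i" if "i < n" for i
  proof -
    have "(mat_diag n f *\<^sub>v v) $ i = (\<Sum>j<n. if j = i then f i * v $ i else 0)"
      using that v unfolding mat_diag_def
      by (simp add: scalar_prod_def atLeast0LessThan del: sum.delta sum.delta') (intro sum.cong, auto)
    then show ?thesis using that by simp
  qed
  then have "vnorm (mat_diag n f *\<^sub>v v) = L2_set (\<lambda>i. cmod (f i) * cmod (v $ i)) {..<n}"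
    unfolding vnorm_def by (auto simp: norm_mult mat_diag_def intro!: L2_set_cong)
  also have "\<dots> \<le> L2_set (\<lambda>i. c * cmod (v $ i)) {..<n}"
    using assms by (intro L2_set_mono) (auto intro: mult_right_mono)
  also have "\<dots> = c * vnorm v"
    using assms v by (simp add: L2_set_right_distrib vnorm_def)
  finally show "vnorm (mat_diag n f *\<^sub>v v) \<le> c * vnorm v" .
qed (rule assms(1), rule mat_diag_dim)

lemma vnorm_square: "complex_of_real ((vnorm v)\<^sup>2) = (\<Sum>i<dim_vec v. cnj (v $ i) * v $ i)"
proof -
  have "(vnorm v)\<^sup>2 = (\<Sum>i<dim_vec v. (cmod (v $ i))\<^sup>2)"
    by (simp add: vnorm_def L2_set_def sum_nonneg)
  then show ?thesis by (simp only: of_real_sum complex_norm_square mult.commute)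
qed

text \<open>Expanding the squared norm of the image of \<open>v\<close> puts
  \<open>cadj U * U\<close>, the identity, between the coordinates of \<open>v\<close>.\<close>

lemma op_bound_isometry:
  assumes "U \<in> carrier_mat m n" "cadj U * U = 1\<^sub>m n"
  shows "op_bound 1 U"
proof (rule op_boundI)
  fix v :: "complex vec" assume v: "v \<in> carrier_vec n"
  have UU: "(\<Sum>i<m. cnj (U $$ (i, j)) * U $$ (i, k)) = (if j = k then 1 else 0)" if "j < n" "k < n" for j k
    using arg_cong[OF assms(2), of "\<lambda>X. X $$ (j, k)"] that assms(1)
    by (simp add: scalar_prod_def atLeast0LessThan)
  have "complex_of_real ((vnorm (U *\<^sub>v v))\<^sup>2)
      = (\<Sum>i<m. (\<Sum>j<n. cnj (U $$ (i, j)) * cnj (v $ j)) * (\<Sum>k<n. U $$ (i, k) * v $ k))"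
    unfolding vnorm_square using assms(1) v by (simp add: scalar_prod_def atLeast0LessThan)
  also have "\<dots> = (\<Sum>i<m. \<Sum>j<n. \<Sum>k<n. cnj (v $ j) * v $ k * (cnj (U $$ (i, j)) * U $$ (i, k)))"
    unfolding sum_product by (intro sum.cong refl) (simp only: mult_ac)
  also have "\<dots> = (\<Sum>j<n. \<Sum>i<m. \<Sum>k<n. cnj (v $ j) * v $ k * (cnj (U $$ (i, j)) * U $$ (i, k)))"
    by (rule sum.swap)
  also have "\<dots> = (\<Sum>j<n. \<Sum>k<n. \<Sum>i<m. cnj (v $ j) * v $ k * (cnj (U $$ (i, j)) * U $$ (i, k)))"
    by (intro sum.cong refl sum.swap)
  also have "\<dots> = (\<Sum>j<n. \<Sum>k<n. if k = j then cnj (v $ j) * v $ j else 0)"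
    unfolding sum_distrib_left[symmetric] by (intro sum.cong refl) (auto simp: UU)
  also have "\<dots> = complex_of_real ((vnorm v)\<^sup>2)"
    unfolding vnorm_square using v by simp
  finally have "(vnorm (U *\<^sub>v v))\<^sup>2 = (vnorm v)\<^sup>2" by (simp only: of_real_eq_iff)
  then show "vnorm (U *\<^sub>v v) \<le> 1 * vnorm v" by (simp add: power2_eq_iff_nonneg)
qed (use assms in auto)

lemma op_bound_unitary:
  assumes "unitary_mat n U"
  shows "op_bound 1 U" "op_bound 1 (cadj U)"
  using op_bound_isometry[of U n n] op_bound_isometry[of "cadj U" n n] unitary_matD[OF assms] by simp_all

lemma op_bound_spec_mat:
  assumes "unitary_mat n V" "0 \<le> c" "\<And>k. k < n \<Longrightarrow> cmod (f k) \<le> c"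
  shows "op_bound c (spec_mat n V f)"
proof -
  note V = unitary_matD[OF assms(1)]
  have "op_bound (1 * c * 1) (V * mat_diag n f * cadj V)"
    using V by (intro op_bound_mult[of _ _ _ _ n n n] op_bound_unitary[OF assms(1)] op_bound_mat_diag assms) auto
  then show ?thesis by (simp add: spec_mat_def)
qed

text \<open>The entry is one coordinate of the image of a unit vector.\<close>

lemma op_bound_entry:
  assumes "op_bound c A" "A \<in> carrier_mat n n" "k < n"
  shows "cmod (A $$ (k, k)) \<le> c"
proof -
  have "vnorm (unit_vec n k) = 1"
    using assms(3) by (simp add: vnorm_def L2_set_def if_distrib[of cmod] if_distrib[of "\<lambda>x. x ^ _"]
        unit_vec_def cong: if_cong)
  moreover have "cmod (A $$ (k, k)) \<le> vnorm (A *\<^sub>v unit_vec n k)"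
    unfolding vnorm_def using assms member_le_L2_set[of "{..<n}" k "\<lambda>i. cmod ((A *\<^sub>v unit_vec n k) $ i)"]
    by simp
  ultimately show ?thesis using op_boundD[OF assms(1,2), of "unit_vec n k"] by simp
qed

section \<open>Dual description of the trace norm\<close>

text \<open>The trace norm as a dual norm, again as a relation. Letting \<open>e\<close> range over
  all bounds, and not only over 1, allows the test operator \<open>Z\<close> to absorb factors of
  any norm.\<close>

definition trace_bound :: "nat \<Rightarrow> real \<Rightarrow> complex mat \<Rightarrow> bool" where
  "trace_bound n c X \<longleftrightarrow>
    (\<forall>Z\<in>carrier_mat n n. \<forall>e. op_bound e Z \<longrightarrow> cmod (mtrace (Z * X)) \<le> e * c)"

lemma trace_bound_add:
  assumes "trace_bound n a X" "trace_bound n b Y" "X \<in> carrier_mat n n" "Y \<in> carrier_mat n n"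
  shows "trace_bound n (a + b) (X + Y)"
  unfolding trace_bound_def
proof (intro ballI allI impI)
  fix Z :: "complex mat" and e assume Z: "Z \<in> carrier_mat n n" "op_bound e Z"
  have "mtrace (Z * (X + Y)) = mtrace (Z * X) + mtrace (Z * Y)"
    using Z assms by (subst mult_add_distrib_mat[of _ n n]) (auto intro!: mtrace_add[of _ n])
  also have "cmod \<dots> \<le> e * a + e * b"
    using assms Z by (intro order.trans[OF norm_triangle_ineq] add_mono) (auto simp: trace_bound_def)
  finally show "cmod (mtrace (Z * (X + Y))) \<le> e * (a + b)" by (simp add: distrib_left)
qed

lemma trace_bound_smult:
  assumes "trace_bound n a X" "X \<in> carrier_mat n n"
  shows "trace_bound n (cmod c * a) (c \<cdot>\<^sub>m X)"
  unfolding trace_bound_def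
proof (intro ballI allI impI)
  fix Z :: "complex mat" and e assume Z: "Z \<in> carrier_mat n n" "op_bound e Z"
  have "mtrace (Z * (c \<cdot>\<^sub>m X)) = c * mtrace (Z * X)"
    using Z assms by (subst mult_smult_distrib[of _ n n]) (auto intro!: mtrace_smult[of _ n])
  moreover have "cmod c * cmod (mtrace (Z * X)) \<le> cmod c * (e * a)"
    using assms Z by (intro mult_left_mono) (auto simp: trace_bound_def)
  ultimately show "cmod (mtrace (Z * (c \<cdot>\<^sub>m X))) \<le> e * (cmod c * a)"
    by (simp add: norm_mult mult_ac)
qed

lemma trace_bound_mono:
  assumes "trace_bound n a X" "a \<le> b"
  shows "trace_bound n b X"
  unfolding trace_bound_def
proof (intro ballI allI impI)
  fix Z :: "complex mat" and e assume Z: "Z \<in> carrier_mat n n" "op_bound e Z"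
  then have "cmod (mtrace (Z * X)) \<le> e * a" using assms(1) by (simp add: trace_bound_def)
  also have "\<dots> \<le> e * b" using assms(2) op_bound_nonneg[OF Z(2)] by (simp add: mult_left_mono)
  finally show "cmod (mtrace (Z * X)) \<le> e * b" .
qed

text \<open>Cyclicity of the trace moves \<open>B\<close> to the front, so testing the product with
  \<open>Z\<close> is testing \<open>X\<close> with \<open>B * Z * A\<close>.\<close>

lemma trace_bound_mult:
  assumes "trace_bound n c X" "op_bound a A" "op_bound b B"
    "A \<in> carrier_mat n n" "B \<in> carrier_mat n n" "X \<in> carrier_mat n n"
  shows "trace_bound n (a * b * c) (A * X * B)"
  unfolding trace_bound_def
proof (intro ballI allI impI)
  fix Z :: "complex mat" and e assume Z: "Z \<in> carrier_mat n n" "op_bound e Z"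
  have "mtrace (Z * (A * X * B)) = mtrace ((Z * A * X) * B)"
    using Z assms by (simp add: assoc_mult_square[of _ n] mult_carrier_square[of _ n] del: assoc_mult_mat)
  also have "\<dots> = mtrace (B * (Z * A * X))"
    using Z assms by (intro mtrace_mult_comm[of _ n n]) auto
  also have "\<dots> = mtrace (B * Z * A * X)"
    using Z assms by (simp add: assoc_mult_square[of _ n] mult_carrier_square[of _ n] del: assoc_mult_mat)
  finally have "mtrace (Z * (A * X * B)) = mtrace (B * Z * A * X)" .
  moreover have "op_bound (b * e * a) (B * Z * A)"
    using Z assms by (intro op_bound_mult[of _ _ _ _ n n n]) auto
  moreover have "B * Z * A \<in> carrier_mat n n"
    using Z assms by (simp add: mult_carrier_square[of _ n])
  ultimately have "cmod (mtrace (Z * (A * X * B))) \<le> b * e * a * c"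
    using assms(1) unfolding trace_bound_def by auto
  then show "cmod (mtrace (Z * (A * X * B))) \<le> e * (a * b * c)"
    by (simp only: mult_ac)
qed

section \<open>Density operators through their spectrum\<close>

lemma density_carrier: "density n \<sigma> \<Longrightarrow> \<sigma> \<in> carrier_mat n n"
  by (simp add: density_def psd_mat_def)

lemma density_spectrum:
  assumes "density n \<sigma>"
  obtains V p where "unitary_mat n V" "\<sigma> = spec_mat n V (\<lambda>k. complex_of_real (p k))"
    "\<And>k. k < n \<Longrightarrow> p k \<ge> 0" "(\<Sum>k<n. p k) = 1"
proof -
  obtain V p where V: "unitary_mat n V" "\<sigma> = spec_mat n V (\<lambda>k. complex_of_real (p k))"
    "\<And>k. k < n \<Longrightarrow> p k \<ge> 0"
    using psd_eigenvalues[of n \<sigma>] assms unfolding density_def by blast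
  have "complex_of_real (\<Sum>k<n. p k) = 1"
    using assms mtrace_spec_mat[OF V(1), of "\<lambda>k. complex_of_real (p k)"] V(2) by (simp add: density_def)
  then have "(\<Sum>k<n. p k) = 1" using of_real_eq_1_iff by blast
  then show thesis using that V by blast
qed

text \<open>In an eigenbasis of \<sigma>, the trace of \<open>Z * \<sigma>\<close> is a convex
  combination of diagonal entries of the conjugated \<open>Z\<close>, each of modulus at most
  \<open>e\<close>.\<close>

lemma trace_bound_density:
  assumes "density n \<sigma>"
  shows "trace_bound n 1 \<sigma>"
  unfolding trace_bound_def
proof (intro ballI allI impI)
  fix Z :: "complex mat" and e assume Z: "Z \<in> carrier_mat n n" "op_bound e Z"
  obtain V p where V: "unitary_mat n V" "\<sigma> = spec_mat n V (\<lambda>k. complex_of_real (p k))"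
    and p: "\<And>k. k < n \<Longrightarrow> p k \<ge> 0" "(\<Sum>k<n. p k) = 1"
    using density_spectrum[OF assms] by blast
  note Vc = unitary_matD[OF V(1)]
  define W where "W = cadj V * Z * V"
  have W: "W \<in> carrier_mat n n" using Vc Z by (simp add: W_def mult_carrier_square[of _ n])
  have Wb: "op_bound e W"
    using op_bound_mult[of 1 "cadj V" e Z n n n] op_bound_mult[of e "cadj V * Z" 1 V n n n]
      op_bound_unitary[OF V(1)] Vc(1,2) Z
    by (simp add: W_def mult_carrier_square[of _ n] del: assoc_mult_mat)
  have "mtrace (Z * \<sigma>) = mtrace ((Z * V * mat_diag n (\<lambda>k. complex_of_real (p k))) * cadj V)"
    unfolding V(2) spec_mat_def using Z Vc(1,2)
    by (simp add: assoc_mult_square[of _ n] mult_carrier_square[of _ n] del: assoc_mult_mat)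
  also have "\<dots> = mtrace (cadj V * (Z * V * mat_diag n (\<lambda>k. complex_of_real (p k))))"
    using Z Vc by (intro mtrace_mult_comm[of _ n n]) (auto intro!: mult_carrier_square)
  also have "\<dots> = mtrace (W * mat_diag n (\<lambda>k. complex_of_real (p k)))"
    using Z Vc(1,2) unfolding W_def
    by (simp add: assoc_mult_square[of _ n] mult_carrier_square[of _ n] del: assoc_mult_mat)
  also have "\<dots> = (\<Sum>k<n. W $$ (k, k) * complex_of_real (p k))"
    using W by (simp add: mtrace_def mat_diag_mult_right)
  finally have "cmod (mtrace (Z * \<sigma>)) \<le> (\<Sum>k<n. cmod (W $$ (k, k)) * p k)"
    by (auto intro!: order.trans[OF norm_sum] sum_mono simp: norm_mult p)
  also have "\<dots> \<le> (\<Sum>k<n. e * p k)"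
    using op_bound_entry[OF Wb W] p by (intro sum_mono mult_right_mono) auto
  also have "\<dots> = e * 1" by (simp only: p flip: sum_distrib_left)
  finally show "cmod (mtrace (Z * \<sigma>)) \<le> e * 1" .
qed

text \<open>The eigenvalues are nonnegative with sum 1, so none exceeds 1.\<close>

lemma op_bound_density:
  assumes "density n \<sigma>"
  shows "op_bound 1 \<sigma>"
proof -
  obtain V p where V: "unitary_mat n V" "\<sigma> = spec_mat n V (\<lambda>k. complex_of_real (p k))"
    and p: "\<And>k. k < n \<Longrightarrow> p k \<ge> 0" "(\<Sum>k<n. p k) = 1"
    using density_spectrum[OF assms] by blast
  have "p k \<le> 1" if "k < n" for k
    using member_le_sum[of k "{..<n}" p] p that by auto
  then show ?thesis unfolding V(2) using p by (intro op_bound_spec_mat V) auto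
qed

text \<open>For Hermitian \<open>X\<close> the right test operator is the sign of \<open>X\<close>:
  it is bounded by 1 and multiplies \<open>X\<close> to its absolute value, which is the positive
  root of \<open>X * cadj X\<close>.\<close>

lemma trace_norm_le:
  assumes "X \<in> carrier_mat n n" "cadj X = X" "trace_bound n c X"
  shows "trace_norm X \<le> c"
proof -
  obtain V f where V: "unitary_mat n V" "X = spec_mat n V (\<lambda>k. complex_of_real (f k))"
    using hermitian_diagonalisable[OF assms(1,2)] .
  note Vc = unitary_matD[OF V(1)]
  define S where "S = spec_mat n V (\<lambda>k. complex_of_real \<bar>f k\<bar>)"
  have "psd_sqrt (X * cadj X) = S"
  proof (rule psd_sqrt_eqI)
    show "psd_mat n S" unfolding S_def by (intro psd_spec_mat Vc) auto
    show "S * S = X * cadj X"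
      unfolding assms(2) S_def by (simp add: V spec_mat_mult flip: of_real_mult)
  qed (use assms in auto)
  moreover have "spec_mat n V (\<lambda>k. complex_of_real (sgn (f k))) * X = S"
    unfolding S_def by (simp add: V spec_mat_mult mult.commute abs_sgn flip: of_real_mult)
  moreover have "op_bound 1 (spec_mat n V (\<lambda>k. complex_of_real (sgn (f k))))"
    by (intro op_bound_spec_mat V) (auto simp: abs_sgn_eq)
  moreover have "spec_mat n V (\<lambda>k. complex_of_real (sgn (f k))) \<in> carrier_mat n n"
    using Vc by simp
  ultimately have "cmod (mtrace (psd_sqrt (X * cadj X))) \<le> 1 * c"
    using assms(3) unfolding trace_bound_def by metis
  then show ?thesis unfolding trace_norm_def
    using complex_Re_le_cmod[of "mtrace (psd_sqrt (X * cadj X))"] by simp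
qed

section \<open>Tensor products\<close>

lemma kron_carrier [simp]:
  "A \<in> carrier_mat a c \<Longrightarrow> B \<in> carrier_mat b d \<Longrightarrow> kron A B \<in> carrier_mat (a * b) (c * d)"
  by (auto simp: kron_def)

lemma mult_add_div_mod [simp]:
  "(j::nat) < b \<Longrightarrow> (i * b + j) div b = i" "j < b \<Longrightarrow> (i * b + j) mod b = j"
  by auto

lemma kron_index:
  assumes "A \<in> carrier_mat a c" "B \<in> carrier_mat b d" "i < a" "k < b" "j < c" "l < d"
  shows "kron A B $$ (i * b + k, j * d + l) = A $$ (i, j) * B $$ (k, l)"
proof -
  have "i * b + k < a * b" "j * d + l < c * d" using assms by (auto intro: mult_add_less_mult)
  then show ?thesis using assms by (simp add: kron_def)
qed

lemma mult_index_cases: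
  assumes "(p::nat) < a * b"
  obtains i k where "i < a" "k < b" "p = i * b + k"
proof -
  have "b > 0" using assms by (cases b) auto
  then show thesis
    using that[of "p div b" "p mod b"] assms by (simp add: less_mult_imp_div_less)
qed

lemma eq_mat_productI:
  assumes "X \<in> carrier_mat (a * b) (c * d)" "Y \<in> carrier_mat (a * b) (c * d)"
    "\<And>i k j l. i < a \<Longrightarrow> k < b \<Longrightarrow> j < c \<Longrightarrow> l < d \<Longrightarrow>
      X $$ (i * b + k, j * d + l) = Y $$ (i * b + k, j * d + l)"
  shows "X = Y"
proof (rule eq_matI)
  fix p q assume "p < dim_row Y" "q < dim_col Y"
  then have "p < a * b" "q < c * d" using assms by auto
  then show "X $$ (p, q) = Y $$ (p, q)" using assms(3) by (auto elim!: mult_index_cases)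
qed (use assms in auto)

lemma kron_one_mult_index:
  assumes "A \<in> carrier_mat m n" "X \<in> carrier_mat (n * b) p" "i < m" "k < b" "q < p"
  shows "(kron A (1\<^sub>m b) * X) $$ (i * b + k, q) = (\<Sum>j<n. A $$ (i, j) * X $$ (j * b + k, q))"
proof -
  have "(kron A (1\<^sub>m b) * X) $$ (i * b + k, q)
      = (\<Sum>r<n * b. kron A (1\<^sub>m b) $$ (i * b + k, r) * X $$ (r, q))"
    using assms by (intro mat_index_mult_sum[of _ "m * b" _ _ p]) (auto intro: mult_add_less_mult)
  also have "\<dots> = (\<Sum>j<n. \<Sum>l<b. if l = k then A $$ (i, j) * X $$ (j * b + k, q) else 0)"
    unfolding sum_lessThan_mult using assms
    by (intro sum.cong refl) (auto simp: kron_index[of A m n "1\<^sub>m b" b b])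
  finally show ?thesis using assms by simp
qed

lemma mult_kron_one_index:
  assumes "A \<in> carrier_mat m n" "X \<in> carrier_mat p (m * b)" "i < n" "k < b" "q < p"
  shows "(X * kron A (1\<^sub>m b)) $$ (q, i * b + k) = (\<Sum>j<m. X $$ (q, j * b + k) * A $$ (j, i))"
proof -
  have "(X * kron A (1\<^sub>m b)) $$ (q, i * b + k)
      = (\<Sum>r<m * b. X $$ (q, r) * kron A (1\<^sub>m b) $$ (r, i * b + k))"
    using assms by (intro mat_index_mult_sum[of _ p _ _ "n * b"]) (auto intro: mult_add_less_mult)
  also have "\<dots> = (\<Sum>j<m. \<Sum>l<b. if l = k then X $$ (q, j * b + k) * A $$ (j, i) else 0)"
    unfolding sum_lessThan_mult using assms
    by (intro sum.cong refl) (auto simp: kron_index[of A m n "1\<^sub>m b" b b])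
  finally show ?thesis using assms by simp
qed

lemma kron_one_mult:
  assumes "A \<in> carrier_mat m n" "B \<in> carrier_mat n p"
  shows "kron A (1\<^sub>m b) * kron B (1\<^sub>m b) = kron (A * B) (1\<^sub>m b)"
proof (rule eq_mat_productI)
  fix i k j l assume ij: "i < m" "k < b" "j < p" "l < b"
  have "(kron A (1\<^sub>m b) * kron B (1\<^sub>m b)) $$ (i * b + k, j * b + l)
      = (\<Sum>r<n. A $$ (i, r) * (B $$ (r, j) * 1\<^sub>m b $$ (k, l)))"
    using assms ij by (subst kron_one_mult_index[OF assms(1), of _ _ "p * b"])
      (auto intro!: mult_add_less_mult sum.cong simp: kron_index[of B n p "1\<^sub>m b" b b])
  also have "\<dots> = (A * B) $$ (i, j) * 1\<^sub>m b $$ (k, l)"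
    by (simp only: mat_index_mult_sum[OF assms ij(1,3)] sum_distrib_right mult.assoc)
  also have "\<dots> = kron (A * B) (1\<^sub>m b) $$ (i * b + k, j * b + l)"
    using assms ij by (subst kron_index[of "A * B" m p "1\<^sub>m b" b b]) auto
  finally show "(kron A (1\<^sub>m b) * kron B (1\<^sub>m b)) $$ (i * b + k, j * b + l)
      = kron (A * B) (1\<^sub>m b) $$ (i * b + k, j * b + l)" .
qed (use assms in \<open>auto intro!: mult_carrier_mat[of _ _ "n * b"]\<close>)

lemma cadj_kron_one:
  assumes "A \<in> carrier_mat m n"
  shows "cadj (kron A (1\<^sub>m b)) = kron (cadj A) (1\<^sub>m b)"
proof (rule eq_mat_productI)
  fix i k j l assume ij: "i < n" "k < b" "j < m" "l < b"
  then have "i * b + k < n * b" "j * b + l < m * b" by (auto intro: mult_add_less_mult)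
  moreover have "dim_row (kron A (1\<^sub>m b)) = m * b" "dim_col (kron A (1\<^sub>m b)) = n * b"
    using assms by (auto simp: kron_def)
  ultimately show "cadj (kron A (1\<^sub>m b)) $$ (i * b + k, j * b + l) = kron (cadj A) (1\<^sub>m b) $$ (i * b + k, j * b + l)"
    using assms ij
    by (simp add: kron_index[of A m n "1\<^sub>m b" b b] kron_index[of "cadj A" n m "1\<^sub>m b" b b])
qed (use assms in auto)

lemma kron_one_one: "kron (1\<^sub>m a) (1\<^sub>m b) = 1\<^sub>m (a * b)"
proof (rule eq_mat_productI)
  fix i k j l assume ij: "i < a" "k < b" "j < a" "l < b"
  then have "i * b + k < a * b" "j * b + l < a * b" by (auto intro: mult_add_less_mult)
  moreover have "i * b + k = j * b + l \<longleftrightarrow> i = j \<and> k = l"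
    using ij mult_add_div_mod by metis
  ultimately show "kron (1\<^sub>m a) (1\<^sub>m b) $$ (i * b + k, j * b + l) = 1\<^sub>m (a * b) $$ (i * b + k, j * b + l)"
    using ij by (simp add: kron_index[of "1\<^sub>m a" a a "1\<^sub>m b" b b])
qed auto

lemma kron_one_minus:
  assumes "A \<in> carrier_mat m n" "B \<in> carrier_mat m n"
  shows "kron (A - B) (1\<^sub>m b) = kron A (1\<^sub>m b) - kron B (1\<^sub>m b)"
proof (rule eq_mat_productI)
  fix i k j l assume ij: "i < m" "k < b" "j < n" "l < b"
  then have "i * b + k < m * b" "j * b + l < n * b" by (auto intro: mult_add_less_mult)
  moreover have "dim_row (kron B (1\<^sub>m b)) = m * b" "dim_col (kron B (1\<^sub>m b)) = n * b"
    using assms by (auto simp: kron_def)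
  ultimately show "kron (A - B) (1\<^sub>m b) $$ (i * b + k, j * b + l)
      = (kron A (1\<^sub>m b) - kron B (1\<^sub>m b)) $$ (i * b + k, j * b + l)"
    using assms ij
    by (simp add: kron_index[of A m n "1\<^sub>m b" b b] kron_index[of B m n "1\<^sub>m b" b b]
        kron_index[of "A - B" m n "1\<^sub>m b" b b] minus_carrier_mat[of B m n])
qed (use assms in \<open>auto intro!: kron_carrier minus_carrier_mat\<close>)

text \<open>Fixing the index of the second factor cuts a vector into \<open>b\<close> slices
  \<open>w k\<close>. The matrix acts as \<open>A\<close> on each slice separately, and squared
  norms add up over the slices.\<close>

lemma op_bound_kron_one:
  assumes "op_bound c A" "A \<in> carrier_mat m n"
  shows "op_bound c (kron A (1\<^sub>m b))"
proof (rule op_boundI)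
  show "0 \<le> c" using assms op_bound_nonneg by blast
  show K: "kron A (1\<^sub>m b) \<in> carrier_mat (m * b) (n * b)" using assms by simp
  fix v :: "complex vec" assume v: "v \<in> carrier_vec (n * b)"
  define w where "w k = vec n (\<lambda>j. v $ (j * b + k))" for k
  have sq: "(vnorm x)\<^sup>2 = (\<Sum>i<dim_vec x. (cmod (x $ i))\<^sup>2)" for x
    by (simp add: vnorm_def L2_set_def sum_nonneg)
  have ent: "(kron A (1\<^sub>m b) *\<^sub>v v) $ (i * b + k) = (A *\<^sub>v w k) $ i" if "i < m" "k < b" for i k
  proof -
    have lt: "i * b + k < m * b" using that by (rule mult_add_less_mult)
    have "(kron A (1\<^sub>m b) *\<^sub>v v) $ (i * b + k) = (\<Sum>r<n * b. kron A (1\<^sub>m b) $$ (i * b + k, r) * v $ r)"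
      using K v lt by (simp add: scalar_prod_def atLeast0LessThan)
    also have "\<dots> = (\<Sum>j<n. \<Sum>l<b. if l = k then A $$ (i, j) * v $ (j * b + k) else 0)"
      unfolding sum_lessThan_mult using assms that
      by (intro sum.cong refl) (auto simp: kron_index[of A m n "1\<^sub>m b" b b])
    also have "\<dots> = (A *\<^sub>v w k) $ i"
      using assms that by (simp add: w_def scalar_prod_def atLeast0LessThan)
    finally show ?thesis .
  qed
  have "(vnorm (kron A (1\<^sub>m b) *\<^sub>v v))\<^sup>2 = (\<Sum>i<m * b. (cmod ((kron A (1\<^sub>m b) *\<^sub>v v) $ i))\<^sup>2)"
    using K by (simp add: sq)
  also have "\<dots> = (\<Sum>i<m. \<Sum>k<b. (cmod ((A *\<^sub>v w k) $ i))\<^sup>2)"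
    unfolding sum_lessThan_mult by (intro sum.cong refl) (simp add: ent)
  also have "\<dots> = (\<Sum>k<b. (vnorm (A *\<^sub>v w k))\<^sup>2)"
    unfolding sq using assms by (subst sum.swap) simp
  also have "\<dots> \<le> (\<Sum>k<b. (c * vnorm (w k))\<^sup>2)"
    using op_boundD[OF assms] by (intro sum_mono power_mono) (auto simp: w_def)
  also have "\<dots> = c\<^sup>2 * (\<Sum>k<b. \<Sum>j<n. (cmod (v $ (j * b + k)))\<^sup>2)"
    by (simp add: power_mult_distrib sq w_def sum_distrib_left)
  also have "\<dots> = (c * vnorm v)\<^sup>2"
    unfolding power_mult_distrib sq using v by (subst sum.swap) (simp add: sum_lessThan_mult)
  finally show "vnorm (kron A (1\<^sub>m b) *\<^sub>v v) \<le> c * vnorm v"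
    by (rule power2_le_imp_le) (simp add: \<open>0 \<le> c\<close>)
qed

lemma hermitian_index:
  assumes "cadj X = X" "X \<in> carrier_mat n n" "i < n" "j < n"
  shows "cnj (X $$ (j, i)) = X $$ (i, j)"
  using cadj_index[of i X j] assms by auto

text \<open>Only \<open>A\<close> is diagonalised. Contracting \<open>v\<close> with the m-th
  eigenvector leaves a vector \<open>y m\<close> on the second factor, and the form becomes the sum
  of the forms of \<open>B\<close> at the \<open>y m\<close> with the eigenvalues \<open>p m\<close>
  as weights.\<close>

lemma psd_mat_kron:
  assumes A: "psd_mat a A" and B: "psd_mat b B"
  shows "psd_mat (a * b) (kron A B)"
proof -
  obtain V p where V: "unitary_mat a V" "A = spec_mat a V (\<lambda>k. complex_of_real (p k))"
    and p: "\<And>k. k < a \<Longrightarrow> p k \<ge> 0"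
    using psd_eigenvalues[OF A] by blast
  note Vc = unitary_matD(1)[OF V(1)]
  have Ac: "A \<in> carrier_mat a a" "cadj A = A" and Bc: "B \<in> carrier_mat b b" "cadj B = B"
    using A B by (auto simp: psd_mat_def)
  have K: "kron A B \<in> carrier_mat (a * b) (a * b)" using Ac Bc by simp
  have Kd: "dim_row (kron A B) = a * b" "dim_col (kron A B) = a * b" using K by auto
  have "cadj (kron A B) = kron A B"
  proof (rule eq_mat_productI)
    fix i k j l assume ij: "i < a" "k < b" "j < a" "l < b"
    then have "i * b + k < a * b" "j * b + l < a * b" by (auto intro: mult_add_less_mult)
    then show "cadj (kron A B) $$ (i * b + k, j * b + l) = kron A B $$ (i * b + k, j * b + l)"
      using ij by (simp add: Kd kron_index[OF Ac(1) Bc(1)] hermitian_index[OF Ac(2,1)] hermitian_index[OF Bc(2,1)])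
  qed (use K in auto)
  moreover have "0 \<le> Re (\<Sum>i<a * b. \<Sum>j<a * b. cnj (v i) * kron A B $$ (i, j) * v j)" for v
  proof -
    define y where "y m k = (\<Sum>i<a. cnj (V $$ (i, m)) * v (i * b + k))" for m k
    define T where "T i k j l m = complex_of_real (p m) *
        ((cnj (v (i * b + k)) * V $$ (i, m)) * B $$ (k, l) * (cnj (V $$ (j, m)) * v (j * b + l)))" for i k j l m
    have "(\<Sum>i<a * b. \<Sum>j<a * b. cnj (v i) * kron A B $$ (i, j) * v j)
        = (\<Sum>i<a. \<Sum>k<b. \<Sum>j<a. \<Sum>l<b. \<Sum>m<a. T i k j l m)"
      unfolding sum_lessThan_mult
      by (intro sum.cong refl)
        (simp add: kron_index[OF Ac(1) Bc(1)], simp add: V(2) spec_mat_index[OF Vc] T_def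
          sum_distrib_left sum_distrib_right mult_ac)
    also have "\<dots> = (\<Sum>m<a. \<Sum>k<b. \<Sum>l<b. \<Sum>j<a. \<Sum>i<a. T i k j l m)"
      unfolding sum.cartesian_product
      by (rule sum.reindex_bij_witness[of _ "\<lambda>(m, k, l, j, i). (i, k, j, l, m)" "\<lambda>(i, k, j, l, m). (m, k, l, j, i)"]) auto
    also have "\<dots> = (\<Sum>m<a. complex_of_real (p m) * (\<Sum>k<b. \<Sum>l<b. cnj (y m k) * B $$ (k, l) * y m l))"
      unfolding T_def y_def cnj_sum sum_distrib_left sum_distrib_right
      by (intro sum.cong refl) (simp add: mult_ac sum_distrib_left)
    also have "Re \<dots> = (\<Sum>m<a. p m * Re (\<Sum>k<b. \<Sum>l<b. cnj (y m k) * B $$ (k, l) * y m l))"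
      unfolding Re_sum[of _ "{..<a}"] by (intro sum.cong refl) simp
    finally have "Re (\<Sum>i<a * b. \<Sum>j<a * b. cnj (v i) * kron A B $$ (i, j) * v j)
        = (\<Sum>m<a. p m * Re (\<Sum>k<b. \<Sum>l<b. cnj (y m k) * B $$ (k, l) * y m l))" .
    also have "\<dots> \<ge> 0"
      using B p by (intro sum_nonneg mult_nonneg_nonneg) (auto simp: psd_mat_def)
    finally show ?thesis .
  qed
  ultimately show ?thesis using K by (simp add: psd_mat_def)
qed

section \<open>Channels and their composition\<close>

lemma sum_list_map_sum:
  "(\<Sum>x\<leftarrow>xs. \<Sum>a\<in>A. f x a) = (\<Sum>a\<in>A. \<Sum>x\<leftarrow>xs. f x a :: 'a::comm_monoid_add)"
  by (induction xs) (auto simp: sum.distrib)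

lemma sum_list_map_cong: "(\<And>x. x \<in> set xs \<Longrightarrow> f x = g x) \<Longrightarrow> (\<Sum>x\<leftarrow>xs. f x) = (\<Sum>x\<leftarrow>xs. g x)"
  by (metis map_cong)

lemma conj_index:
  assumes "M \<in> carrier_mat m n" "X \<in> carrier_mat n n" "i < m" "j < m"
  shows "(M * X * cadj M) $$ (i, j) = (\<Sum>a<n. \<Sum>b<n. M $$ (i, a) * X $$ (a, b) * cnj (M $$ (j, b)))"
proof -
  have "(M * X * cadj M) $$ (i, j) = (\<Sum>b<n. (M * X) $$ (i, b) * cadj M $$ (b, j))"
    using assms by (intro mat_index_mult_sum[of _ m _ _ m] mult_carrier_mat[of _ _ n] cadj_carrier) auto
  also have "\<dots> = (\<Sum>b<n. \<Sum>a<n. M $$ (i, a) * X $$ (a, b) * cnj (M $$ (j, b)))"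
    using assms by (intro sum.cong refl) (simp add: mat_index_mult_sum[OF assms(1,2)] sum_distrib_right del: index_mult_mat)
  also have "\<dots> = (\<Sum>a<n. \<Sum>b<n. M $$ (i, a) * X $$ (a, b) * cnj (M $$ (j, b)))"
    by (rule sum.swap)
  finally show ?thesis .
qed

text \<open>The form of \<open>K * X * cadj K\<close> at \<open>v\<close> is the form of
  \<open>X\<close> at \<open>cadj K\<close> applied to \<open>v\<close>, which is
  \<open>w K\<close>.\<close>

lemma psd_mat_kraus_apply:
  assumes X: "psd_mat n X" and Ks: "\<And>K. K \<in> set Ks \<Longrightarrow> K \<in> carrier_mat m n"
  shows "psd_mat m (kraus_apply m Ks X)"
proof -
  have Xc: "X \<in> carrier_mat n n" "cadj X = X" using X by (auto simp: psd_mat_def)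
  have carrier: "kraus_apply m Ks X \<in> carrier_mat m m" by (simp add: kraus_apply_def)
  have ent: "kraus_apply m Ks X $$ (i, j) = (\<Sum>K\<leftarrow>Ks. \<Sum>a<n. \<Sum>b<n. K $$ (i, a) * X $$ (a, b) * cnj (K $$ (j, b)))"
    if "i < m" "j < m" for i j
    using that Ks by (simp add: kraus_apply_def) (intro sum_list_map_cong conj_index Xc, auto)
  have "cadj (kraus_apply m Ks X) = kraus_apply m Ks X"
  proof (rule cadj_eqI[OF carrier])
    fix i j assume ij: "i < m" "j < m"
    have "cnj (kraus_apply m Ks X $$ (j, i))
        = (\<Sum>K\<leftarrow>Ks. \<Sum>a<n. \<Sum>b<n. cnj (K $$ (j, a) * X $$ (a, b) * cnj (K $$ (i, b))))"
      unfolding ent[OF ij(2,1)] by (induction Ks) auto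
    also have "\<dots> = (\<Sum>K\<leftarrow>Ks. \<Sum>a<n. \<Sum>b<n. K $$ (i, b) * X $$ (b, a) * cnj (K $$ (j, a)))"
      by (intro sum_list_map_cong sum.cong refl) (simp add: hermitian_index[OF Xc(2,1)])
    also have "\<dots> = (\<Sum>K\<leftarrow>Ks. \<Sum>b<n. \<Sum>a<n. K $$ (i, b) * X $$ (b, a) * cnj (K $$ (j, a)))"
      by (intro sum_list_map_cong sum.swap)
    finally show "cnj (kraus_apply m Ks X $$ (j, i)) = kraus_apply m Ks X $$ (i, j)"
      using ent[OF ij] by simp
  qed
  moreover have "0 \<le> Re (\<Sum>i<m. \<Sum>j<m. cnj (v i) * kraus_apply m Ks X $$ (i, j) * v j)" for v
  proof -
    define w where "w K b = (\<Sum>j<m. cnj (K $$ (j, b)) * v j)" for K :: "complex mat" and b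
    define T where "T K i j a b = cnj (v i) * (K $$ (i, a) * X $$ (a, b) * cnj (K $$ (j, b))) * v j"
      for K :: "complex mat" and i j a b
    have "(\<Sum>i<m. \<Sum>j<m. cnj (v i) * kraus_apply m Ks X $$ (i, j) * v j)
        = (\<Sum>i<m. \<Sum>j<m. \<Sum>K\<leftarrow>Ks. \<Sum>a<n. \<Sum>b<n. T K i j a b)"
    proof (intro sum.cong refl)
      fix i j assume ij: "i \<in> {..<m}" "j \<in> {..<m}"
      have "kraus_apply m Ks X $$ (i, j) = (\<Sum>K\<leftarrow>Ks. \<Sum>a<n. \<Sum>b<n. K $$ (i, a) * X $$ (a, b) * cnj (K $$ (j, b)))"
        using ij by (intro ent) auto
      then show "cnj (v i) * kraus_apply m Ks X $$ (i, j) * v j = (\<Sum>K\<leftarrow>Ks. \<Sum>a<n. \<Sum>b<n. T K i j a b)"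
        by (simp only: T_def sum_distrib_left[symmetric] sum_distrib_right[symmetric]
            sum_list_mult_const sum_list_const_mult)
    qed
    also have "\<dots> = (\<Sum>K\<leftarrow>Ks. \<Sum>i<m. \<Sum>j<m. \<Sum>a<n. \<Sum>b<n. T K i j a b)"
      by (simp only: sum_list_map_sum)
    also have "\<dots> = (\<Sum>K\<leftarrow>Ks. \<Sum>a<n. \<Sum>b<n. \<Sum>j<m. \<Sum>i<m. T K i j a b)"
    proof (intro sum_list_map_cong)
      fix K
      show "(\<Sum>i<m. \<Sum>j<m. \<Sum>a<n. \<Sum>b<n. T K i j a b) = (\<Sum>a<n. \<Sum>b<n. \<Sum>j<m. \<Sum>i<m. T K i j a b)"
        unfolding sum.cartesian_product
        by (rule sum.reindex_bij_witness[of _ "\<lambda>(a, b, j, i). (i, j, a, b)" "\<lambda>(i, j, a, b). (a, b, j, i)"]) auto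
    qed
    also have "\<dots> = (\<Sum>K\<leftarrow>Ks. \<Sum>a<n. \<Sum>b<n. cnj (w K a) * X $$ (a, b) * w K b)"
      unfolding w_def cnj_sum sum_distrib_left sum_distrib_right T_def
      by (intro sum_list_map_cong sum.cong refl) (simp add: mult_ac)
    finally have "(\<Sum>i<m. \<Sum>j<m. cnj (v i) * kraus_apply m Ks X $$ (i, j) * v j)
        = (\<Sum>K\<leftarrow>Ks. \<Sum>a<n. \<Sum>b<n. cnj (w K a) * X $$ (a, b) * w K b)" .
    moreover have "0 \<le> Re (\<Sum>K\<leftarrow>Ks. \<Sum>a<n. \<Sum>b<n. cnj (w K a) * X $$ (a, b) * w K b)"
      using X unfolding psd_mat_def by (induction Ks) (auto simp del: Re_sum)
    ultimately show ?thesis by simp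
  qed
  ultimately show ?thesis using carrier by (simp add: psd_mat_def)
qed

text \<open>The indices \<open>k\<close> and \<open>l\<close> of the untouched second factor are
  merely carried along; this reduces all computations with the ancilla B to sums over the first
  factor.\<close>

lemma kron_conj_index:
  assumes "K \<in> carrier_mat d n" "X \<in> carrier_mat (n * b) (n * b)" "i < d" "k < b" "j < d" "l < b"
  shows "(kron K (1\<^sub>m b) * X * cadj (kron K (1\<^sub>m b))) $$ (i * b + k, j * b + l)
    = (\<Sum>q<n. \<Sum>q'<n. K $$ (i, q) * X $$ (q * b + k, q' * b + l) * cnj (K $$ (j, q')))"
proof -
  have lt: "i * b + k < d * b" "\<And>q'. q' < n \<Longrightarrow> q' * b + l < n * b"
    using assms by (auto intro: mult_add_less_mult)
  have "(kron K (1\<^sub>m b) * X * cadj (kron K (1\<^sub>m b))) $$ (i * b + k, j * b + l)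
      = (\<Sum>q'<n. (kron K (1\<^sub>m b) * X) $$ (i * b + k, q' * b + l) * cadj K $$ (q', j))"
    unfolding cadj_kron_one[OF assms(1)] using assms lt
    by (intro mult_kron_one_index[of _ n d _ "d * b"] mult_carrier_mat[of _ _ "n * b"]) auto
  also have "\<dots> = (\<Sum>q'<n. (\<Sum>q<n. K $$ (i, q) * X $$ (q * b + k, q' * b + l)) * cnj (K $$ (j, q')))"
    using assms lt by (intro sum.cong refl)
      (simp add: kron_one_mult_index[OF assms(1,2)] del: index_mult_mat)
  also have "\<dots> = (\<Sum>q<n. \<Sum>q'<n. K $$ (i, q) * X $$ (q * b + k, q' * b + l) * cnj (K $$ (j, q')))"
    unfolding sum_distrib_right by (rule sum.swap)
  finally show ?thesis .
qed

lemma kraus_kron_index: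
  assumes "\<And>K. K \<in> set Ks \<Longrightarrow> K \<in> carrier_mat d n" "X \<in> carrier_mat (n * b) (n * b)"
    "i < d" "k < b" "j < d" "l < b"
  shows "kraus_apply (d * b) (map (\<lambda>K. kron K (1\<^sub>m b)) Ks) X $$ (i * b + k, j * b + l)
    = (\<Sum>K\<leftarrow>Ks. \<Sum>q<n. \<Sum>q'<n. K $$ (i, q) * X $$ (q * b + k, q' * b + l) * cnj (K $$ (j, q')))"
proof -
  have "i * b + k < d * b" "j * b + l < d * b" using assms by (auto intro: mult_add_less_mult)
  then have "kraus_apply (d * b) (map (\<lambda>K. kron K (1\<^sub>m b)) Ks) X $$ (i * b + k, j * b + l)
      = (\<Sum>K\<leftarrow>Ks. (kron K (1\<^sub>m b) * X * cadj (kron K (1\<^sub>m b))) $$ (i * b + k, j * b + l))"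
    by (simp add: kraus_apply_def comp_def del: index_mult_mat)
  also have "\<dots> = (\<Sum>K\<leftarrow>Ks. \<Sum>q<n. \<Sum>q'<n. K $$ (i, q) * X $$ (q * b + k, q' * b + l) * cnj (K $$ (j, q')))"
    using assms by (intro sum_list_map_cong kron_conj_index) auto
  finally show ?thesis .
qed

lemma is_channel_iff:
  "is_channel n d Ks \<longleftrightarrow> (\<forall>K\<in>set Ks. K \<in> carrier_mat d n) \<and>
    (\<forall>q<n. \<forall>q'<n. (\<Sum>K\<leftarrow>Ks. \<Sum>i<d. cnj (K $$ (i, q)) * K $$ (i, q')) = (if q = q' then 1 else 0))"
proof -
  have "mat n n (\<lambda>(i, j). \<Sum>K\<leftarrow>Ks. (cadj K * K) $$ (i, j)) = 1\<^sub>m n \<longleftrightarrow>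
      (\<forall>q<n. \<forall>q'<n. (\<Sum>K\<leftarrow>Ks. (cadj K * K) $$ (q, q')) = (if q = q' then 1 else 0))"
    by (auto simp: mat_eq_iff simp del: index_mult_mat(1))
  moreover have "(\<Sum>K\<leftarrow>Ks. (cadj K * K) $$ (q, q')) = (\<Sum>K\<leftarrow>Ks. \<Sum>i<d. cnj (K $$ (i, q)) * K $$ (i, q'))"
    if "\<forall>K\<in>set Ks. K \<in> carrier_mat d n" "q < n" "q' < n" for q q'
  proof (intro sum_list_map_cong)
    fix K assume "K \<in> set Ks"
    then have "K \<in> carrier_mat d n" using that by blast
    then show "(cadj K * K) $$ (q, q') = (\<Sum>i<d. cnj (K $$ (i, q)) * K $$ (i, q'))"
      using that by (simp add: scalar_prod_def atLeast0LessThan)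
  qed
  ultimately show ?thesis unfolding is_channel_def by auto
qed

section \<open>Sequential composition of Kraus families\<close>

text \<open>Apply \<open>K\<close> to the part \<open>p2 Q\<close> of the index \<open>Q\<close>, then \<open>L\<close> to the part \<open>p1 Q\<close> together
  with the output of \<open>K\<close>.\<close>

definition compose_op ::
    "nat \<Rightarrow> nat \<Rightarrow> (nat \<Rightarrow> nat) \<Rightarrow> (nat \<Rightarrow> nat) \<Rightarrow> complex mat \<Rightarrow> complex mat \<Rightarrow> complex mat" where
  "compose_op d n p1 p2 L K = mat d n (\<lambda>(i, Q). \<Sum>w<d. L $$ (i, p1 Q * d + w) * K $$ (w, p2 Q))"

definition compose_ops ::
    "nat \<Rightarrow> nat \<Rightarrow> (nat \<Rightarrow> nat) \<Rightarrow> (nat \<Rightarrow> nat) \<Rightarrow> complex mat list \<Rightarrow> complex mat list \<Rightarrow> complex mat list" where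
  "compose_ops d n p1 p2 Ls Ks = concat (map (\<lambda>L. map (compose_op d n p1 p2 L) Ks) Ls)"

lemma sum_list_compose_ops:
  "(\<Sum>J\<leftarrow>compose_ops d n p1 p2 Ls Ks. f J) = (\<Sum>L\<leftarrow>Ls. \<Sum>K\<leftarrow>Ks. f (compose_op d n p1 p2 L K))"
  by (induction Ls) (auto simp: compose_ops_def comp_def)

lemma compose_ops_carrier: "J \<in> set (compose_ops d n p1 p2 Ls Ks) \<Longrightarrow> J \<in> carrier_mat d n"
  by (auto simp: compose_ops_def compose_op_def)

text \<open>Completeness of \<open>Ls\<close> identifies the parts \<open>p1\<close> and the
  intermediate indices \<open>w\<close>, \<open>w'\<close>. The diagonal sum over \<open>w\<close>
  that remains is completeness of \<open>Ks\<close>, which identifies the parts \<open>p2\<close>;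
  by injectivity both parts together determine \<open>Q\<close>.\<close>

lemma is_channel_compose_ops:
  assumes Ls: "is_channel (e * d) d Ls" and Ks: "is_channel m d Ks"
    and bij: "bij_betw (\<lambda>Q. (p1 Q, p2 Q)) {..<n} ({..<e} \<times> {..<m})"
  shows "is_channel n d (compose_ops d n p1 p2 Ls Ks)"
  unfolding is_channel_iff
proof (intro conjI ballI allI impI compose_ops_carrier)
  fix Q Q' assume Q: "Q < n" "Q' < n"
  have p: "p1 Q < e" "p2 Q < m" "p1 Q' < e" "p2 Q' < m"
    using bij_betwE[OF bij] Q by auto
  have inj: "p1 Q = p1 Q' \<and> p2 Q = p2 Q' \<longleftrightarrow> Q = Q'"
    using bij_betw_imp_inj_on[OF bij] Q by (auto dest: inj_onD)
  define a where "a w = p1 Q * d + w" for w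
  define a' where "a' w = p1 Q' * d + w" for w
  have a: "a w < e * d" "a' w < e * d" if "w < d" for w
    using p that by (auto simp: a_def a'_def intro: mult_add_less_mult)
  have a_eq: "a w = a' w' \<longleftrightarrow> p1 Q = p1 Q' \<and> w = w'" if "w < d" "w' < d" for w w'
    unfolding a_def a'_def using that mult_add_div_mod by metis
  have "(\<Sum>J\<leftarrow>compose_ops d n p1 p2 Ls Ks. \<Sum>i<d. cnj (J $$ (i, Q)) * J $$ (i, Q'))
      = (\<Sum>L\<leftarrow>Ls. \<Sum>K\<leftarrow>Ks. \<Sum>i<d. \<Sum>w<d. \<Sum>w'<d.
          (cnj (L $$ (i, a w)) * L $$ (i, a' w')) * (cnj (K $$ (w, p2 Q)) * K $$ (w', p2 Q')))"
    unfolding sum_list_compose_ops using Q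
    by (intro sum_list_map_cong sum.cong refl)
      (simp add: compose_op_def sum_product a_def a'_def, intro sum.cong refl, simp add: mult_ac)
  also have "\<dots> = (\<Sum>L\<leftarrow>Ls. \<Sum>K\<leftarrow>Ks. \<Sum>w<d. \<Sum>w'<d. \<Sum>i<d.
          (cnj (L $$ (i, a w)) * L $$ (i, a' w')) * (cnj (K $$ (w, p2 Q)) * K $$ (w', p2 Q')))"
    by (intro sum_list_map_cong, rule trans[OF sum.swap], rule sum.cong[OF refl], rule sum.swap)
  also have "\<dots> = (\<Sum>w<d. \<Sum>w'<d. (\<Sum>L\<leftarrow>Ls. \<Sum>i<d. cnj (L $$ (i, a w)) * L $$ (i, a' w'))
          * (\<Sum>K\<leftarrow>Ks. cnj (K $$ (w, p2 Q)) * K $$ (w', p2 Q')))"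
    by (simp only: sum_list_map_sum sum_distrib_right[symmetric] sum_list_const_mult sum_list_mult_const)
  also have "\<dots> = (\<Sum>w<d. \<Sum>w'<d. if w' = w then (if p1 Q = p1 Q' then
          (\<Sum>K\<leftarrow>Ks. cnj (K $$ (w, p2 Q)) * K $$ (w, p2 Q')) else 0) else 0)"
    using Ls a a_eq by (intro sum.cong refl) (auto simp: is_channel_iff)
  also have "\<dots> = (if p1 Q = p1 Q' then \<Sum>K\<leftarrow>Ks. \<Sum>w<d. cnj (K $$ (w, p2 Q)) * K $$ (w, p2 Q') else 0)"
    by (simp add: sum_list_map_sum)
  also have "\<dots> = (if Q = Q' then 1 else 0)"
    using Ks p inj by (auto simp: is_channel_iff)
  finally show "(\<Sum>J\<leftarrow>compose_ops d n p1 p2 Ls Ks. \<Sum>i<d. cnj (J $$ (i, Q)) * J $$ (i, Q'))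
      = (if Q = Q' then 1 else 0)" .
qed

lemma sum_index_pair:
  assumes "bij_betw (\<lambda>Q. (p1 Q, p2 Q)) {..<n} ({..<e} \<times> {..<m})"
  shows "(\<Sum>Q<n. f (p1 Q) (p2 Q)) = (\<Sum>q<e. \<Sum>r<m. f q r)"
  using sum.reindex_bij_betw[OF assms, of "\<lambda>(q, r). f q r"] by (simp add: sum.cartesian_product)

text \<open>\<open>XRY\<close> factors \<open>X\<close> only after a relabelling through
  \<open>p1\<close> and \<open>p2\<close>, so the tensor factors that the outer channel consumes may
  sit anywhere in the input. The inner channel acts on \<open>Y\<close>, and its output is the last
  factor of what the outer channel receives.\<close>

lemma kraus_apply_compose_ops:
  assumes Ls: "\<And>L. L \<in> set Ls \<Longrightarrow> L \<in> carrier_mat d (e * d)" and Ks: "\<And>K. K \<in> set Ks \<Longrightarrow> K \<in> carrier_mat d m"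
    and bij: "bij_betw (\<lambda>Q. (p1 Q, p2 Q)) {..<n} ({..<e} \<times> {..<m})"
    and R: "R \<in> carrier_mat e e" and Y: "Y \<in> carrier_mat (m * b) (m * b)" and X: "X \<in> carrier_mat (n * b) (n * b)"
    and XRY: "\<And>Q Q' k l. Q < n \<Longrightarrow> Q' < n \<Longrightarrow> k < b \<Longrightarrow> l < b \<Longrightarrow>
      X $$ (Q * b + k, Q' * b + l) = R $$ (p1 Q, p1 Q') * Y $$ (p2 Q * b + k, p2 Q' * b + l)"
  shows "kraus_apply (d * b) (map (\<lambda>K. kron K (1\<^sub>m b)) (compose_ops d n p1 p2 Ls Ks)) X
    = kraus_apply (d * b) (map (\<lambda>K. kron K (1\<^sub>m b)) Ls)
        (kron R (kraus_apply (d * b) (map (\<lambda>K. kron K (1\<^sub>m b)) Ks) Y))" (is "?l = ?r")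
proof (rule eq_mat_productI)
  define Z where "Z = kraus_apply (d * b) (map (\<lambda>K. kron K (1\<^sub>m b)) Ks) Y"
  have Z: "Z \<in> carrier_mat (d * b) (d * b)" by (simp add: Z_def kraus_apply_def)
  have RZ: "kron R Z \<in> carrier_mat (e * d * b) (e * d * b)"
    using kron_carrier[OF R Z] by (simp add: mult.assoc)
  fix i k j l assume ij: "i < d" "k < b" "j < d" "l < b"
  define T where "T L K q w q' w' r r' = L $$ (i, q * d + w) * K $$ (w, r) * (R $$ (q, q') * Y $$ (r * b + k, r' * b + l))
      * (cnj (L $$ (j, q' * d + w')) * cnj (K $$ (w', r')))" for L K :: "complex mat" and q w q' w' r r'
  have "?l $$ (i * b + k, j * b + l) = (\<Sum>L\<leftarrow>Ls. \<Sum>K\<leftarrow>Ks. \<Sum>Q<n. \<Sum>Q'<n.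
      (\<Sum>w<d. L $$ (i, p1 Q * d + w) * K $$ (w, p2 Q)) * (R $$ (p1 Q, p1 Q') * Y $$ (p2 Q * b + k, p2 Q' * b + l))
      * (\<Sum>w'<d. cnj (L $$ (j, p1 Q' * d + w')) * cnj (K $$ (w', p2 Q'))))"
    using ij X by (subst kraus_kron_index[OF compose_ops_carrier])
      (auto simp: sum_list_compose_ops compose_op_def XRY intro!: sum_list_map_cong sum.cong)
  also have "\<dots> = (\<Sum>L\<leftarrow>Ls. \<Sum>K\<leftarrow>Ks. \<Sum>q<e. \<Sum>r<m. \<Sum>q'<e. \<Sum>r'<m.
      (\<Sum>w<d. L $$ (i, q * d + w) * K $$ (w, r)) * (R $$ (q, q') * Y $$ (r * b + k, r' * b + l))
      * (\<Sum>w'<d. cnj (L $$ (j, q' * d + w')) * cnj (K $$ (w', r'))))"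
  proof (intro sum_list_map_cong)
    fix L K :: "complex mat"
    define f where "f q r q' r' = (\<Sum>w<d. L $$ (i, q * d + w) * K $$ (w, r)) * (R $$ (q, q') * Y $$ (r * b + k, r' * b + l))
      * (\<Sum>w'<d. cnj (L $$ (j, q' * d + w')) * cnj (K $$ (w', r')))" for q r q' r'
    have "(\<Sum>Q<n. \<Sum>Q'<n. f (p1 Q) (p2 Q) (p1 Q') (p2 Q')) = (\<Sum>Q<n. \<Sum>q'<e. \<Sum>r'<m. f (p1 Q) (p2 Q) q' r')"
      by (intro sum.cong refl sum_index_pair[OF bij])
    also have "\<dots> = (\<Sum>q<e. \<Sum>r<m. \<Sum>q'<e. \<Sum>r'<m. f q r q' r')"
      by (rule sum_index_pair[OF bij])
    finally show "(\<Sum>Q<n. \<Sum>Q'<n. (\<Sum>w<d. L $$ (i, p1 Q * d + w) * K $$ (w, p2 Q)) * (R $$ (p1 Q, p1 Q') * Y $$ (p2 Q * b + k, p2 Q' * b + l))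
      * (\<Sum>w'<d. cnj (L $$ (j, p1 Q' * d + w')) * cnj (K $$ (w', p2 Q')))) = (\<Sum>q<e. \<Sum>r<m. \<Sum>q'<e. \<Sum>r'<m.
      (\<Sum>w<d. L $$ (i, q * d + w) * K $$ (w, r)) * (R $$ (q, q') * Y $$ (r * b + k, r' * b + l))
      * (\<Sum>w'<d. cnj (L $$ (j, q' * d + w')) * cnj (K $$ (w', r'))))" by (simp only: f_def)
  qed
  also have "\<dots> = (\<Sum>L\<leftarrow>Ls. \<Sum>K\<leftarrow>Ks. \<Sum>q<e. \<Sum>r<m. \<Sum>q'<e. \<Sum>r'<m. \<Sum>w'<d. \<Sum>w<d. T L K q w q' w' r r')"
    by (simp only: T_def sum_distrib_left sum_distrib_right)
  also have "\<dots> = (\<Sum>L\<leftarrow>Ls. \<Sum>K\<leftarrow>Ks. \<Sum>q<e. \<Sum>w<d. \<Sum>q'<e. \<Sum>w'<d. \<Sum>r<m. \<Sum>r'<m. T L K q w q' w' r r')"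
    unfolding sum.cartesian_product
    by (intro sum_list_map_cong sum.reindex_bij_witness[of _ "\<lambda>(q, w, q', w', r, r'). (q, r, q', r', w', w)"
          "\<lambda>(q, r, q', r', w', w). (q, w, q', w', r, r')"]) auto
  also have "\<dots> = (\<Sum>L\<leftarrow>Ls. \<Sum>q<e. \<Sum>w<d. \<Sum>q'<e. \<Sum>w'<d. L $$ (i, q * d + w) * (R $$ (q, q') *
      (\<Sum>K\<leftarrow>Ks. \<Sum>r<m. \<Sum>r'<m. K $$ (w, r) * Y $$ (r * b + k, r' * b + l) * cnj (K $$ (w', r'))))
      * cnj (L $$ (j, q' * d + w')))"
  proof -
    have "(\<Sum>K\<leftarrow>Ks. \<Sum>r<m. \<Sum>r'<m. T L K q w q' w' r r') = L $$ (i, q * d + w) * (R $$ (q, q') *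
      (\<Sum>K\<leftarrow>Ks. \<Sum>r<m. \<Sum>r'<m. K $$ (w, r) * Y $$ (r * b + k, r' * b + l) * cnj (K $$ (w', r'))))
      * cnj (L $$ (j, q' * d + w'))" for L q w q' w'
      unfolding sum_list_const_mult[symmetric] sum_list_mult_const[symmetric] sum_distrib_left sum_distrib_right
      by (intro sum_list_map_cong sum.cong refl) (simp add: T_def mult_ac)
    then show ?thesis by (simp only: sum_list_map_sum)
  qed
  also have "\<dots> = (\<Sum>L\<leftarrow>Ls. \<Sum>q<e. \<Sum>w<d. \<Sum>q'<e. \<Sum>w'<d. L $$ (i, q * d + w) *
      kron R Z $$ ((q * d + w) * b + k, (q' * d + w') * b + l) * cnj (L $$ (j, q' * d + w')))"
  proof (intro sum_list_map_cong sum.cong refl)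
    fix q w q' w' L assume "q \<in> {..<e}" "w \<in> {..<d}" "q' \<in> {..<e}" "w' \<in> {..<d}"
    then have "kron R Z $$ (q * (d * b) + (w * b + k), q' * (d * b) + (w' * b + l))
        = R $$ (q, q') * Z $$ (w * b + k, w' * b + l)"
      using ij by (intro kron_index[OF R Z]) (auto intro: mult_add_less_mult)
    moreover have "Z $$ (w * b + k, w' * b + l) =
        (\<Sum>K\<leftarrow>Ks. \<Sum>r<m. \<Sum>r'<m. K $$ (w, r) * Y $$ (r * b + k, r' * b + l) * cnj (K $$ (w', r')))"
      unfolding Z_def using ij \<open>w \<in> _\<close> \<open>w' \<in> _\<close> by (intro kraus_kron_index Ks Y) auto
    \<comment> \<open>\<open>kron R Z\<close> splits an index behind the factor of dimension
      \<open>e\<close>, \<open>kraus_kron_index\<close> in front of the factor of dimension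
      \<open>b\<close>.\<close>
    moreover have "(q * d + w) * b + k = q * (d * b) + (w * b + k)" "(q' * d + w') * b + l = q' * (d * b) + (w' * b + l)"
      by (auto simp: algebra_simps)
    ultimately show "L $$ (i, q * d + w) * (R $$ (q, q') *
      (\<Sum>K\<leftarrow>Ks. \<Sum>r<m. \<Sum>r'<m. K $$ (w, r) * Y $$ (r * b + k, r' * b + l) * cnj (K $$ (w', r'))))
      * cnj (L $$ (j, q' * d + w')) = L $$ (i, q * d + w) *
      kron R Z $$ ((q * d + w) * b + k, (q' * d + w') * b + l) * cnj (L $$ (j, q' * d + w'))"
      by (simp only:)
  qed
  also have "\<dots> = ?r $$ (i * b + k, j * b + l)"
    unfolding Z_def[symmetric] using ij RZ Ls by (subst kraus_kron_index) (auto simp: sum_lessThan_mult)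
  finally show "?l $$ (i * b + k, j * b + l) = ?r $$ (i * b + k, j * b + l)" .
qed (auto simp: kraus_apply_def)

section \<open>The one-step channel\<close>

text \<open>A rotation of three base-\<open>d\<close> digits: (x, y, z) becomes (z, x, y). The
  inverse rotation \<open>uncyc\<close> yields (y, z, x).\<close>

definition cyc :: "nat \<Rightarrow> nat \<Rightarrow> nat" where
  "cyc d q = (q mod d) * (d * d) + q div d"

definition uncyc :: "nat \<Rightarrow> nat \<Rightarrow> nat" where
  "uncyc d q = (q mod (d * d)) * d + q div (d * d)"

lemma cyc_index:
  assumes "x < d" "y < d" "z < d"
  shows "cyc d ((x * d + y) * d + z) = (z * d + x) * d + y"
  unfolding cyc_def mult_add_div_mod[OF assms(3)] by (simp add: algebra_simps)

lemma uncyc_index: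
  assumes "x < d" "y < d" "z < d"
  shows "uncyc d ((x * d + y) * d + z) = (y * d + z) * d + x"
proof -
  have "(x * d + y) * d + z = x * (d * d) + (y * d + z)" by (simp add: algebra_simps)
  moreover have "y * d + z < d * d" using assms by (intro mult_add_less_mult)
  ultimately show ?thesis unfolding uncyc_def by (simp only: mult_add_div_mod)
qed

lemma triple_index_cases:
  assumes "(q::nat) < d * d * d"
  obtains x y z where "x < d" "y < d" "z < d" "q = (x * d + y) * d + z"
  using assms by (auto elim!: mult_index_cases)

lemma triple_index_less: "x < d \<Longrightarrow> y < d \<Longrightarrow> z < d \<Longrightarrow> (x * d + y) * d + z < d * d * (d::nat)"
  by (intro mult_add_less_mult)

lemma cyc_bij:
  assumes "q < d * d * d"
  shows "cyc d q < d * d * d" "uncyc d q < d * d * d" "uncyc d (cyc d q) = q" "cyc d (uncyc d q) = q"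
  using assms by (auto elim!: triple_index_cases simp: cyc_index uncyc_index triple_index_less)

text \<open>With \<open>\<pi>\<close> the cyclic shift of the three tensor factors, these are the Kraus operators
  \<open>\<langle>p| (c + c g \<pi>)\<close> obtained by measuring the first two factors.\<close>

definition shift_op :: "nat \<Rightarrow> real \<Rightarrow> complex \<Rightarrow> (nat \<Rightarrow> nat) \<Rightarrow> nat \<Rightarrow> complex mat" where
  "shift_op d c g \<pi> p = mat d (d * d * d) (\<lambda>(i, q).
     (if q = p * d + i then complex_of_real c else 0) + (if q = \<pi> (p * d + i) then complex_of_real c * g else 0))"

text \<open>With g = -i \<tau> cis \<phi>, the number \<open>- cnj g\<close> is -i \<tau> cis
  (-\<phi>), the coefficient that belongs to the adjoint of the weighted shift.\<close>

definition step_ops :: "nat \<Rightarrow> real \<Rightarrow> complex \<Rightarrow> complex mat list" where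
  "step_ops d c g = map (shift_op d c g (cyc d)) [0..<d * d] @ map (shift_op d c (- cnj g) (uncyc d)) [0..<d * d]"

lemma sum_list_upt: "(\<Sum>p\<leftarrow>[0..<n]. f p) = (\<Sum>p<n. f p :: 'a::comm_monoid_add)"
  by (simp add: interv_sum_list_conv_sum_set_nat atLeast0LessThan)

lemma sum_list_step_ops:
  "(\<Sum>K\<leftarrow>step_ops d c g. f K)
    = (\<Sum>p<d * d. f (shift_op d c g (cyc d) p)) + (\<Sum>p<d * d. f (shift_op d c (- cnj g) (uncyc d) p))"
  by (simp add: step_ops_def comp_def sum_list_upt)

lemma step_ops_carrier: "K \<in> set (step_ops d c g) \<Longrightarrow> K \<in> carrier_mat d (d * d * d)"
  by (auto simp: step_ops_def shift_op_def)

text \<open>Over all outcomes \<open>p\<close> and outputs \<open>i\<close>, the number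
  \<open>p * d + i\<close> runs through every basis index of the three factors. The sum is therefore
  the Gram matrix of c + c g \<pi> on the whole space: measuring the first two factors loses
  nothing.\<close>

lemma shift_op_gram:
  assumes inv: "\<And>q. q < d * d * d \<Longrightarrow> \<pi> q < d * d * d \<and> \<pi>' q < d * d * d \<and> \<pi>' (\<pi> q) = q \<and> \<pi> (\<pi>' q) = q"
    and q: "q < d * d * d" "q' < d * d * d"
  shows "(\<Sum>p<d * d. \<Sum>i<d. cnj (shift_op d c g \<pi> p $$ (i, q)) * shift_op d c g \<pi> p $$ (i, q'))
    = (complex_of_real c)\<^sup>2 * ((if q = q' then 1 + g * cnj g else 0) + (if q = \<pi>' q' then g else 0)
        + (if q' = \<pi>' q then cnj g else 0))"
proof -
  define C where "C = complex_of_real c"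
  \<comment> \<open>The column \<open>q\<close> of c + c g \<pi>. Its two positions coincide at
    fixed points of \<pi>, hence a sum and not a case distinction.\<close>
  define h where "h q P = (if P = q then C else 0) + (if P = \<pi>' q then C * g else 0)" for q P
  have ent: "shift_op d c g \<pi> p $$ (i, r) = h r (p * d + i)" if "p < d * d" "i < d" "r < d * d * d" for p i r
  proof -
    have "p * d + i < d * d * d" using that by (intro mult_add_less_mult)
    then have "r = \<pi> (p * d + i) \<longleftrightarrow> p * d + i = \<pi>' r" using inv that by metis
    then show ?thesis using that by (auto simp: shift_op_def h_def C_def)
  qed
  have "(\<Sum>p<d * d. \<Sum>i<d. cnj (shift_op d c g \<pi> p $$ (i, q)) * shift_op d c g \<pi> p $$ (i, q'))
      = (\<Sum>P<d * d * d. cnj (h q P) * h q' P)"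
    unfolding sum_lessThan_mult[of _ "d * d" d] using q by (intro sum.cong refl) (simp add: ent)
  also have "\<dots> = (\<Sum>P<d * d * d. (if P = q then C * h q' q else 0) + (if P = \<pi>' q then C * cnj g * h q' (\<pi>' q) else 0))"
    by (intro sum.cong refl) (auto simp: h_def C_def algebra_simps)
  also have "\<dots> = C * h q' q + C * cnj g * h q' (\<pi>' q)"
    using q inv by (simp add: sum.distrib)
  also have "\<dots> = C\<^sup>2 * ((if q = q' then 1 + g * cnj g else 0) + (if q = \<pi>' q' then g else 0)
        + (if q' = \<pi>' q then cnj g else 0))"
  proof -
    have "\<pi>' q = \<pi>' q' \<longleftrightarrow> q = q'" using inv q by metis
    then show ?thesis by (auto simp: h_def power2_eq_square algebra_simps)
  qed
  finally show ?thesis by (simp add: C_def)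
qed

text \<open>The cross terms of the second family, with coefficient \<open>- cnj g\<close> and the
  inverse rotation, are the negatives of those of the first. Only the diagonal parts survive, and
  the assumption normalises them.\<close>

lemma is_channel_step_ops:
  assumes "2 * c\<^sup>2 * (1 + (cmod g)\<^sup>2) = 1"
  shows "is_channel (d * d * d) d (step_ops d c g)"
  unfolding is_channel_iff sum_list_step_ops
proof (intro conjI ballI allI impI step_ops_carrier)
  fix q q' assume q: "q < d * d * d" "q' < d * d * d"
  have c: "2 * (complex_of_real c)\<^sup>2 * (1 + g * cnj g) = 1"
  proof -
    have "(complex_of_real (cmod g))\<^sup>2 = g * cnj g" using complex_norm_square[of g] by simp
    then show ?thesis
      using arg_cong[OF assms, of complex_of_real]
      by (simp only: of_real_mult of_real_add of_real_1 of_real_numeral of_real_power)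
  qed
  have "q = uncyc d q' \<longleftrightarrow> q' = cyc d q" "q' = uncyc d q \<longleftrightarrow> q = cyc d q'"
    using cyc_bij q by metis+
  then have "(\<Sum>p<d * d. \<Sum>i<d. cnj (shift_op d c g (cyc d) p $$ (i, q)) * shift_op d c g (cyc d) p $$ (i, q')) +
      (\<Sum>p<d * d. \<Sum>i<d. cnj (shift_op d c (- cnj g) (uncyc d) p $$ (i, q)) * shift_op d c (- cnj g) (uncyc d) p $$ (i, q'))
      = (if q = q' then 2 * (complex_of_real c)\<^sup>2 * (1 + g * cnj g) else 0)"
    using cyc_bij q
    by (simp add: shift_op_gram[where \<pi>' = "uncyc d"] shift_op_gram[where \<pi>' = "cyc d"]) (simp add: algebra_simps)
  then show "(\<Sum>p<d * d. \<Sum>i<d. cnj (shift_op d c g (cyc d) p $$ (i, q)) * shift_op d c g (cyc d) p $$ (i, q')) +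
      (\<Sum>p<d * d. \<Sum>i<d. cnj (shift_op d c (- cnj g) (uncyc d) p $$ (i, q)) * shift_op d c (- cnj g) (uncyc d) p $$ (i, q'))
      = (if q = q' then 1 else 0)" unfolding c .
qed

text \<open>Every row of a \<open>shift_op\<close> is a combination of two coordinate functionals,
  so a conjugation has four terms.\<close>

lemma shift_op_sandwich:
  assumes "p < d * d" "i < d" "j < d" and \<pi>: "\<And>q. q < d * d * d \<Longrightarrow> \<pi> q < d * d * d"
  shows "(\<Sum>q<d * d * d. \<Sum>q'<d * d * d. shift_op d c g \<pi> p $$ (i, q) * F q q' * cnj (shift_op d c g \<pi> p $$ (j, q')))
    = (complex_of_real c)\<^sup>2 * (F (p * d + i) (p * d + j) + g * F (\<pi> (p * d + i)) (p * d + j)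
        + cnj g * F (p * d + i) (\<pi> (p * d + j)) + g * cnj g * F (\<pi> (p * d + i)) (\<pi> (p * d + j)))"
proof -
  define C where "C = complex_of_real c"
  have row: "(\<Sum>q<d * d * d. shift_op d c g \<pi> p $$ (i, q) * G q)
      = C * G (p * d + i) + C * g * G (\<pi> (p * d + i))" if "i < d" for i G
  proof -
    have lt: "p * d + i < d * d * d" using that assms(1) by (rule mult_add_less_mult[rotated])
    have "(\<Sum>q<d * d * d. shift_op d c g \<pi> p $$ (i, q) * G q)
        = (\<Sum>q<d * d * d. (if q = p * d + i then C * G (p * d + i) else 0)
          + (if q = \<pi> (p * d + i) then C * g * G (\<pi> (p * d + i)) else 0))"
      using that by (intro sum.cong refl) (auto simp: shift_op_def C_def algebra_simps)
    also have "\<dots> = C * G (p * d + i) + C * g * G (\<pi> (p * d + i))"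
      using lt \<pi>[OF lt] by (simp add: sum.distrib)
    finally show ?thesis .
  qed
  have row': "(\<Sum>q<d * d * d. G q * cnj (shift_op d c g \<pi> p $$ (j, q)))
      = C * G (p * d + j) + C * cnj g * G (\<pi> (p * d + j))" for G
    using arg_cong[OF row[OF assms(3), of "\<lambda>q. cnj (G q)"], of cnj]
    by (simp add: C_def mult.commute)
  have "(\<Sum>q<d * d * d. \<Sum>q'<d * d * d. shift_op d c g \<pi> p $$ (i, q) * F q q' * cnj (shift_op d c g \<pi> p $$ (j, q')))
      = (\<Sum>q<d * d * d. shift_op d c g \<pi> p $$ (i, q) * (C * F q (p * d + j) + C * cnj g * F q (\<pi> (p * d + j))))"
  proof (rule sum.cong[OF refl])
    fix q
    have "(\<Sum>q'<d * d * d. shift_op d c g \<pi> p $$ (i, q) * F q q' * cnj (shift_op d c g \<pi> p $$ (j, q')))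
        = shift_op d c g \<pi> p $$ (i, q) * (\<Sum>q'<d * d * d. F q q' * cnj (shift_op d c g \<pi> p $$ (j, q')))"
      by (simp only: sum_distrib_left mult.assoc)
    then show "(\<Sum>q'<d * d * d. shift_op d c g \<pi> p $$ (i, q) * F q q' * cnj (shift_op d c g \<pi> p $$ (j, q')))
        = shift_op d c g \<pi> p $$ (i, q) * (C * F q (p * d + j) + C * cnj g * F q (\<pi> (p * d + j)))"
      unfolding row' .
  qed
  also have "\<dots> = C\<^sup>2 * (F (p * d + i) (p * d + j) + g * F (\<pi> (p * d + i)) (p * d + j)
        + cnj g * F (p * d + i) (\<pi> (p * d + j)) + g * cnj g * F (\<pi> (p * d + i)) (\<pi> (p * d + j)))"
    by (simp only: row[OF assms(2)]) (simp add: power2_eq_square algebra_simps)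
  finally show ?thesis by (simp add: C_def)
qed

lemma sum_product_const:
  "(\<Sum>x\<in>A. \<Sum>y\<in>B. f x * g y * c) = sum f A * sum g B * (c :: 'a::comm_semiring_0)"
  by (subst sum_product) (simp only: sum_distrib_right)

definition ptrace :: "nat \<Rightarrow> nat \<Rightarrow> complex mat \<Rightarrow> complex mat" where
  "ptrace d b X = mat b b (\<lambda>(k, l). \<Sum>m<d. X $$ (m * b + k, m * b + l))"

text \<open>Rotating only the row or only the column index chains the traced-out indices into a
  product of the three matrices. Rotating both closes one copy into its trace 1, sends the other
  copy to the output, and traces A out of \<open>s\<close>. The commutator arises because each
  product of \<open>r1\<close> and \<open>r2\<close> occurs on the left from one rotation and on the
  right from the other.\<close>

lemma step_output_index:
  assumes r: "r1 \<in> carrier_mat d d" "r2 \<in> carrier_mat d d" "mtrace r1 = 1" "mtrace r2 = 1"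
    and s: "s \<in> carrier_mat (d * b) (d * b)" and ij: "i < d" "k < b" "j < d" "l < b"
  shows "kraus_apply (d * b) (map (\<lambda>K. kron K (1\<^sub>m b)) (step_ops d c g)) (kron (kron r1 r2) s) $$ (i * b + k, j * b + l)
    = (complex_of_real c)\<^sup>2 * (2 * s $$ (i * b + k, j * b + l)
      + (\<Sum>m<d. (g * (r1 * r2) $$ (i, m) - cnj g * (r2 * r1) $$ (i, m)) * s $$ (m * b + k, j * b + l))
      - (\<Sum>m<d. s $$ (i * b + k, m * b + l) * (g * (r1 * r2) $$ (m, j) - cnj g * (r2 * r1) $$ (m, j)))
      + g * cnj g * (r1 $$ (i, j) + r2 $$ (i, j)) * ptrace d b s $$ (k, l))"
proof -
  \<comment> \<open>The indices \<open>k\<close> and \<open>l\<close> of B stay fixed;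
    \<open>q\<close> and \<open>q'\<close> range over the three copies of A.\<close>
  define F where "F q q' = kron (kron r1 r2) s $$ (q * b + k, q' * b + l)" for q q'
  have F: "F ((x * d + y) * d + z) ((x' * d + y') * d + z')
      = r1 $$ (x, x') * r2 $$ (y, y') * s $$ (z * b + k, z' * b + l)"
    if "x < d" "y < d" "z < d" "x' < d" "y' < d" "z' < d" for x y z x' y' z'
  proof -
    have "((x * d + y) * d + z) * b + k = (x * d + y) * (d * b) + (z * b + k)"
      "((x' * d + y') * d + z') * b + l = (x' * d + y') * (d * b) + (z' * b + l)"
      by (auto simp: algebra_simps)
    then have "F ((x * d + y) * d + z) ((x' * d + y') * d + z')
        = kron r1 r2 $$ (x * d + y, x' * d + y') * s $$ (z * b + k, z' * b + l)"
      unfolding F_def using that ij r s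
      by (simp only:) (intro kron_index[of _ "d * d" "d * d" _ "d * b" "d * b"], auto intro: mult_add_less_mult)
    then show ?thesis using that r by (simp add: kron_index[of r1 d d r2 d d])
  qed
  have X: "kron (kron r1 r2) s \<in> carrier_mat (d * d * d * b) (d * d * d * b)"
    using kron_carrier[OF kron_carrier[OF r(1,2)] s] by (simp add: mult.assoc)
  have tr: "(\<Sum>x<d. r1 $$ (x, x)) = 1" "(\<Sum>x<d. r2 $$ (x, x)) = 1"
    using r by (auto simp: mtrace_def)
  note mult = mat_index_mult_sum[OF r(1,2)] mat_index_mult_sum[OF r(2,1)]
  define P where "P = s $$ (i * b + k, j * b + l)"
  \<comment> \<open>\<open>x\<close> and \<open>y\<close> are the traced-out digits. Fact 1 is the
    unrotated term that the two families share; facts 2 to 4 apply \<open>cyc\<close> to the row,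
    the column and both, and facts 5 to 7 do so with \<open>uncyc\<close>.\<close>
  have 1: "(\<Sum>x<d. \<Sum>y<d. F ((x * d + y) * d + i) ((x * d + y) * d + j)) = P"
  proof -
    have "(\<Sum>x<d. \<Sum>y<d. F ((x * d + y) * d + i) ((x * d + y) * d + j))
        = (\<Sum>x<d. r1 $$ (x, x)) * (\<Sum>y<d. r2 $$ (y, y)) * P"
      unfolding sum_product_const[symmetric] P_def using ij by (intro sum.cong refl) (simp add: F)
    then show ?thesis by (simp add: tr)
  qed
  have 2: "(\<Sum>x<d. \<Sum>y<d. F (cyc d ((x * d + y) * d + i)) ((x * d + y) * d + j))
      = (\<Sum>m<d. (r1 * r2) $$ (i, m) * s $$ (m * b + k, j * b + l))"
    using ij by (subst sum.swap) (simp add: mult sum_distrib_right cyc_index F del: index_mult_mat)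
  have 3: "(\<Sum>x<d. \<Sum>y<d. F ((x * d + y) * d + i) (cyc d ((x * d + y) * d + j)))
      = (\<Sum>m<d. s $$ (i * b + k, m * b + l) * (r2 * r1) $$ (m, j))"
    using ij by (subst sum.swap) (simp add: mult sum_distrib_left cyc_index F del: index_mult_mat, simp add: mult_ac)
  have 4: "(\<Sum>x<d. \<Sum>y<d. F (cyc d ((x * d + y) * d + i)) (cyc d ((x * d + y) * d + j)))
      = r1 $$ (i, j) * ptrace d b s $$ (k, l)"
  proof -
    have "(\<Sum>x<d. \<Sum>y<d. F (cyc d ((x * d + y) * d + i)) (cyc d ((x * d + y) * d + j)))
        = (\<Sum>x<d. r2 $$ (x, x)) * (\<Sum>y<d. s $$ (y * b + k, y * b + l)) * r1 $$ (i, j)"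
      unfolding sum_product_const[symmetric] using ij by (intro sum.cong refl) (simp add: F cyc_index)
    then show ?thesis using ij by (simp add: tr ptrace_def)
  qed
  have 5: "(\<Sum>x<d. \<Sum>y<d. F (uncyc d ((x * d + y) * d + i)) ((x * d + y) * d + j))
      = (\<Sum>m<d. (r2 * r1) $$ (i, m) * s $$ (m * b + k, j * b + l))"
    using ij by (simp add: mult sum_distrib_right uncyc_index F del: index_mult_mat, simp add: mult_ac)
  have 6: "(\<Sum>x<d. \<Sum>y<d. F ((x * d + y) * d + i) (uncyc d ((x * d + y) * d + j)))
      = (\<Sum>m<d. s $$ (i * b + k, m * b + l) * (r1 * r2) $$ (m, j))"
    using ij by (simp add: mult sum_distrib_left uncyc_index F del: index_mult_mat, simp add: mult_ac)
  have 7: "(\<Sum>x<d. \<Sum>y<d. F (uncyc d ((x * d + y) * d + i)) (uncyc d ((x * d + y) * d + j)))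
      = r2 $$ (i, j) * ptrace d b s $$ (k, l)"
  proof -
    have "(\<Sum>x<d. \<Sum>y<d. F (uncyc d ((x * d + y) * d + i)) (uncyc d ((x * d + y) * d + j)))
        = (\<Sum>x<d. s $$ (x * b + k, x * b + l)) * (\<Sum>y<d. r1 $$ (y, y)) * r2 $$ (i, j)"
      unfolding sum_product_const[symmetric] using ij by (intro sum.cong refl) (simp add: F uncyc_index)
    then show ?thesis using ij by (simp add: tr ptrace_def)
  qed
  define A where "A = (\<Sum>m<d. (r1 * r2) $$ (i, m) * s $$ (m * b + k, j * b + l))"
  define B where "B = (\<Sum>m<d. (r2 * r1) $$ (i, m) * s $$ (m * b + k, j * b + l))"
  define A' where "A' = (\<Sum>m<d. s $$ (i * b + k, m * b + l) * (r1 * r2) $$ (m, j))"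
  define B' where "B' = (\<Sum>m<d. s $$ (i * b + k, m * b + l) * (r2 * r1) $$ (m, j))"
  define t where "t = ptrace d b s $$ (k, l)"
  note sums = 1 2[folded A_def] 3[folded B'_def] 4[folded t_def] 5[folded B_def] 6[folded A'_def] 7[folded t_def]
  have "kraus_apply (d * b) (map (\<lambda>K. kron K (1\<^sub>m b)) (step_ops d c g)) (kron (kron r1 r2) s) $$ (i * b + k, j * b + l)
      = (\<Sum>K\<leftarrow>step_ops d c g. \<Sum>q<d * d * d. \<Sum>q'<d * d * d. K $$ (i, q) * F q q' * cnj (K $$ (j, q')))"
    unfolding F_def by (intro kraus_kron_index X ij step_ops_carrier)
  also have "\<dots> = (\<Sum>p<d * d. (complex_of_real c)\<^sup>2 * (F (p * d + i) (p * d + j) + g * F (cyc d (p * d + i)) (p * d + j)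
          + cnj g * F (p * d + i) (cyc d (p * d + j)) + g * cnj g * F (cyc d (p * d + i)) (cyc d (p * d + j))))
      + (\<Sum>p<d * d. (complex_of_real c)\<^sup>2 * (F (p * d + i) (p * d + j) + - cnj g * F (uncyc d (p * d + i)) (p * d + j)
          + cnj (- cnj g) * F (p * d + i) (uncyc d (p * d + j))
          + - cnj g * cnj (- cnj g) * F (uncyc d (p * d + i)) (uncyc d (p * d + j))))"
    unfolding sum_list_step_ops
    using ij by (intro arg_cong2[of _ _ _ _ plus] sum.cong refl shift_op_sandwich cyc_bij) auto
  also have "\<dots> = (complex_of_real c)\<^sup>2 * (P + g * A + cnj g * B' + g * cnj g * (r1 $$ (i, j) * t))
      + (complex_of_real c)\<^sup>2 * (P + - cnj g * B + cnj (- cnj g) * A' + - cnj g * cnj (- cnj g) * (r2 $$ (i, j) * t))"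
    unfolding sum_distrib_left[symmetric] sum.distrib sum_lessThan_mult[of _ d d] sums ..
  also have "\<dots> = (complex_of_real c)\<^sup>2 * (2 * P + (g * A - cnj g * B) - (g * A' - cnj g * B')
      + g * cnj g * (r1 $$ (i, j) + r2 $$ (i, j)) * t)"
    by (simp add: algebra_simps)
  also have "g * A - cnj g * B = (\<Sum>m<d. (g * (r1 * r2) $$ (i, m) - cnj g * (r2 * r1) $$ (i, m)) * s $$ (m * b + k, j * b + l))"
    unfolding A_def B_def sum_distrib_left sum_subtractf[symmetric]
    by (intro sum.cong refl) (simp add: algebra_simps del: index_mult_mat)
  also have "g * A' - cnj g * B' = (\<Sum>m<d. s $$ (i * b + k, m * b + l) * (g * (r1 * r2) $$ (m, j) - cnj g * (r2 * r1) $$ (m, j)))"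
    unfolding A'_def B'_def sum_distrib_left sum_subtractf[symmetric]
    by (intro sum.cong refl) (simp add: algebra_simps del: index_mult_mat)
  finally show ?thesis unfolding P_def t_def .
qed

section \<open>Iterating the step\<close>

text \<open>A basis index of \<open>\<rho>1 \<otimes> \<rho>1\<^sup>n \<otimes> \<rho>2 \<otimes> \<rho>2\<^sup>n \<otimes> A\<close> is split into the first copies of \<open>\<rho>1\<close> and \<open>\<rho>2\<close>,
  which the last step consumes, and the remaining factors (\<open>e = d\<^sup>n\<close>).\<close>

definition head_index :: "nat \<Rightarrow> nat \<Rightarrow> nat \<Rightarrow> nat" where
  "head_index d e Q = (Q div d div (d * e) div e) * d + (Q div d mod (d * e)) div e"

definition tail_index :: "nat \<Rightarrow> nat \<Rightarrow> nat \<Rightarrow> nat" where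
  "tail_index d e Q = ((Q div d div (d * e)) mod e * e + (Q div d mod (d * e)) mod e) * d + Q mod d"

lemma head_tail_index:
  assumes "x < d" "u < e" "y < d" "v < e" "z < d"
  shows "head_index d e (((x * e + u) * (d * e) + (y * e + v)) * d + z) = x * d + y"
    "tail_index d e (((x * e + u) * (d * e) + (y * e + v)) * d + z) = (u * e + v) * d + z"
proof -
  have "y * e + v < d * e" using assms by (intro mult_add_less_mult)
  then show "head_index d e (((x * e + u) * (d * e) + (y * e + v)) * d + z) = x * d + y"
    "tail_index d e (((x * e + u) * (d * e) + (y * e + v)) * d + z) = (u * e + v) * d + z"
    using assms unfolding head_index_def tail_index_def by (simp_all only: mult_add_div_mod)
qed

lemma mult_add_eq_iff:
  "(j::nat) < b \<Longrightarrow> j' < b \<Longrightarrow> i * b + j = i' * b + j' \<longleftrightarrow> i = i' \<and> j = j'"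
  using mult_add_div_mod by metis

lemma copies_index_cases:
  assumes "Q < (d * e) * (d * e) * (d::nat)"
  obtains x u y v z where "x < d" "u < e" "y < d" "v < e" "z < d"
    "Q = ((x * e + u) * (d * e) + (y * e + v)) * d + z"
proof -
  obtain R z where R: "R < (d * e) * (d * e)" "z < d" "Q = R * d + z"
    using assms by (rule mult_index_cases)
  obtain p q where pq: "p < d * e" "q < d * e" "R = p * (d * e) + q"
    using R(1) by (rule mult_index_cases)
  obtain x u where "x < d" "u < e" "p = x * e + u" using pq(1) by (rule mult_index_cases)
  moreover obtain y v where "y < d" "v < e" "q = y * e + v" using pq(2) by (rule mult_index_cases)
  ultimately show thesis using that R pq by simp
qed

lemma head_tail_bij:
  "bij_betw (\<lambda>Q. (head_index d e Q, tail_index d e Q)) {..<(d * e) * (d * e) * d} ({..<d * d} \<times> {..<e * e * d})"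
proof (rule bij_betwI')
  fix Q Q' assume "Q \<in> {..<(d * e) * (d * e) * d}" "Q' \<in> {..<(d * e) * (d * e) * d}"
  then have "Q < (d * e) * (d * e) * d" "Q' < (d * e) * (d * e) * d" by auto
  then show "((head_index d e Q, tail_index d e Q) = (head_index d e Q', tail_index d e Q')) = (Q = Q')"
    by (elim copies_index_cases) (simp only: prod.inject head_tail_index mult_add_eq_iff mult_add_less_mult, blast)
next
  fix Q assume "Q \<in> {..<(d * e) * (d * e) * d}"
  then have "Q < (d * e) * (d * e) * d" by simp
  then show "(head_index d e Q, tail_index d e Q) \<in> {..<d * d} \<times> {..<e * e * d}"
    by (elim copies_index_cases) (simp add: head_tail_index mult_add_less_mult)
next
  fix y assume "y \<in> {..<d * d} \<times> {..<e * e * d}"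
  then obtain q r where y: "y = (q, r)" "q < d * d" "r < e * e * d" by auto
  obtain x y' where q: "x < d" "y' < d" "q = x * d + y'" using y(2) by (rule mult_index_cases)
  obtain r' z where r': "r' < e * e" "z < d" "r = r' * d + z" using y(3) by (rule mult_index_cases)
  obtain u v where uv: "u < e" "v < e" "r' = u * e + v" using r'(1) by (rule mult_index_cases)
  show "\<exists>Q\<in>{..<(d * e) * (d * e) * d}. y = (head_index d e Q, tail_index d e Q)"
    by (rule bexI[of _ "((x * e + u) * (d * e) + (y' * e + v)) * d + z"])
      (use q r' uv y(1) in \<open>auto simp: head_tail_index intro!: mult_add_less_mult\<close>)
qed

text \<open>The recursion peels off the first copies, as \<open>kron_pow\<close> does. No state and
  no dimension of B enters, which gives the required independence; without copies the single
  operator is the identity channel.\<close>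

primrec protocol :: "nat \<Rightarrow> real \<Rightarrow> complex \<Rightarrow> nat \<Rightarrow> complex mat list" where
  "protocol d c g 0 = [1\<^sub>m d]"
| "protocol d c g (Suc n) = compose_ops d ((d * d ^ n) * (d * d ^ n) * d)
     (head_index d (d ^ n)) (tail_index d (d ^ n)) (step_ops d c g) (protocol d c g n)"

lemma is_channel_protocol:
  assumes "2 * c\<^sup>2 * (1 + (cmod g)\<^sup>2) = 1"
  shows "is_channel (d ^ n * d ^ n * d) d (protocol d c g n)"
proof (induction n)
  case 0
  have "(\<Sum>i<d. cnj (1\<^sub>m d $$ (i, q)) * 1\<^sub>m d $$ (i, q')) = (if q = q' then 1 else 0 :: complex)"
    if "q < d" "q' < d" for q q'
  proof -
    have "(\<Sum>i<d. cnj (1\<^sub>m d $$ (i, q)) * 1\<^sub>m d $$ (i, q') :: complex)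
        = (\<Sum>i<d. if i = q then (if q = q' then 1 else 0) else 0)"
      using that by (intro sum.cong) auto
    then show ?thesis using that by simp
  qed
  then show ?case by (simp add: is_channel_iff)
next
  case (Suc n)
  then show ?case
    using is_channel_compose_ops[OF is_channel_step_ops[OF assms] Suc head_tail_bij[of d "d ^ n"]] by simp
qed

lemma kron_pow_carrier: "A \<in> carrier_mat d d \<Longrightarrow> kron_pow A n \<in> carrier_mat (d ^ n) (d ^ n)"
  by (induction n) auto

definition protocol_output ::
    "nat \<Rightarrow> nat \<Rightarrow> real \<Rightarrow> complex \<Rightarrow> complex mat \<Rightarrow> complex mat \<Rightarrow> complex mat \<Rightarrow> nat \<Rightarrow> complex mat" where
  "protocol_output d b c g r1 r2 s n = kraus_apply (d * b) (map (\<lambda>K. kron K (1\<^sub>m b)) (protocol d c g n))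
     (kron (kron (kron_pow r1 n) (kron_pow r2 n)) s)"

definition step_output ::
    "nat \<Rightarrow> nat \<Rightarrow> real \<Rightarrow> complex \<Rightarrow> complex mat \<Rightarrow> complex mat \<Rightarrow> complex mat \<Rightarrow> complex mat" where
  "step_output d b c g r1 r2 s = kraus_apply (d * b) (map (\<lambda>K. kron K (1\<^sub>m b)) (step_ops d c g))
     (kron (kron r1 r2) s)"

lemma kron_one_left: "kron (1\<^sub>m 1) A = A"
  by (rule eq_matI) (auto simp: kron_def)

lemma protocol_output_0:
  assumes "s \<in> carrier_mat (d * b) (d * b)"
  shows "protocol_output d b c g r1 r2 s 0 = s"
proof -
  have "1\<^sub>m (d * b) * s * cadj (1\<^sub>m (d * b)) = s"
    using left_mult_one_mat[OF assms] right_mult_one_mat[OF assms] by simp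
  then show ?thesis
    unfolding protocol_output_def kraus_apply_def using assms
    by (intro eq_matI) (simp_all add: kron_one_left kron_one_one del: One_nat_def)
qed

text \<open>The grouped order of the copies is undone here: up to relabelling, the input is one pair
  of copies tensored with the input of the shorter protocol, and the last step acts on that pair and
  the output of the shorter protocol.\<close>

lemma protocol_output_Suc:
  assumes r: "r1 \<in> carrier_mat d d" "r2 \<in> carrier_mat d d" and s: "s \<in> carrier_mat (d * b) (d * b)"
  shows "protocol_output d b c g r1 r2 s (Suc n)
    = step_output d b c g r1 r2 (protocol_output d b c g r1 r2 s n)"
proof -
  define e where "e = d ^ n"
  define P1 where "P1 = kron_pow r1 n"
  define P2 where "P2 = kron_pow r2 n"
  have P: "P1 \<in> carrier_mat e e" "P2 \<in> carrier_mat e e"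
    using r by (simp_all add: P1_def P2_def e_def kron_pow_carrier)
  let ?X = "kron (kron (kron r1 P1) (kron r2 P2)) s"
  let ?Y = "kron (kron P1 P2) s"
  have carriers: "kron r1 P1 \<in> carrier_mat (d * e) (d * e)" "kron r2 P2 \<in> carrier_mat (d * e) (d * e)"
    "kron r1 r2 \<in> carrier_mat (d * d) (d * d)" "kron P1 P2 \<in> carrier_mat (e * e) (e * e)"
    using r P by auto
  have X: "?X \<in> carrier_mat ((d * e) * (d * e) * d * b) ((d * e) * (d * e) * d * b)"
    using kron_carrier[OF kron_carrier[OF carriers(1,2)] s] by (simp add: mult.assoc)
  have Y: "?Y \<in> carrier_mat (e * e * d * b) (e * e * d * b)"
    using kron_carrier[OF carriers(4) s] by (simp add: mult.assoc)
  \<comment> \<open>The digits of \<open>Q\<close> come in the order x, u, y, v, z, with heads x, y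
    and tails u, v. As entries are scalars, regrouping them only permutes the factors of a
    product.\<close>
  have XY: "?X $$ (Q * b + k, Q' * b + l)
      = kron r1 r2 $$ (head_index d e Q, head_index d e Q') * ?Y $$ (tail_index d e Q * b + k, tail_index d e Q' * b + l)"
    if Q: "Q < (d * e) * (d * e) * d" "Q' < (d * e) * (d * e) * d" and kl: "k < b" "l < b" for Q Q' k l
  proof -
    obtain x u y v z where i: "x < d" "u < e" "y < d" "v < e" "z < d"
      "Q = ((x * e + u) * (d * e) + (y * e + v)) * d + z"
      using Q(1) by (rule copies_index_cases)
    obtain x' u' y' v' z' where i': "x' < d" "u' < e" "y' < d" "v' < e" "z' < d"
      "Q' = ((x' * e + u') * (d * e) + (y' * e + v')) * d + z'"
      using Q(2) by (rule copies_index_cases)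
    have assoc: "(a * d + c) * b + m = a * (d * b) + (c * b + m)" for a c m :: nat
      by (simp add: algebra_simps)
    have "?X $$ (Q * b + k, Q' * b + l) = r1 $$ (x, x') * P1 $$ (u, u') * (r2 $$ (y, y') * P2 $$ (v, v'))
        * s $$ (z * b + k, z' * b + l)"
      unfolding i(6) i'(6) assoc using i(1-5) i'(1-5) kl
      by (simp add: kron_index[OF kron_carrier[OF carriers(1,2)] s] kron_index[OF carriers(1,2)]
          kron_index[OF r(1) P(1)] kron_index[OF r(2) P(2)] mult_add_less_mult)
    moreover have "?Y $$ (((u * e + v) * d + z) * b + k, ((u' * e + v') * d + z') * b + l)
        = P1 $$ (u, u') * P2 $$ (v, v') * s $$ (z * b + k, z' * b + l)"
      unfolding assoc using i(1-5) i'(1-5) kl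
      by (simp add: kron_index[OF carriers(4) s] kron_index[OF P] mult_add_less_mult)
    moreover have "kron r1 r2 $$ (x * d + y, x' * d + y') = r1 $$ (x, x') * r2 $$ (y, y')"
      using i i' by (simp add: kron_index[OF r])
    ultimately show ?thesis
      unfolding i(6) i'(6) head_tail_index[OF i(1-5)] head_tail_index[OF i'(1-5)] by (simp only: mult_ac)
  qed
  have "protocol_output d b c g r1 r2 s (Suc n)
      = kraus_apply (d * b) (map (\<lambda>K. kron K (1\<^sub>m b)) (compose_ops d ((d * e) * (d * e) * d)
          (head_index d e) (tail_index d e) (step_ops d c g) (protocol d c g n))) ?X"
    by (simp add: protocol_output_def e_def P1_def P2_def)
  also have "\<dots> = kraus_apply (d * b) (map (\<lambda>K. kron K (1\<^sub>m b)) (step_ops d c g))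
      (kron (kron r1 r2) (kraus_apply (d * b) (map (\<lambda>K. kron K (1\<^sub>m b)) (protocol d c g n)) ?Y))"
  proof (rule kraus_apply_compose_ops[OF step_ops_carrier _ head_tail_bij carriers(3) Y X])
    \<comment> \<open>For n = 0 the list is not a composition; there \<open>e = 1\<close>, so the
      dimension is \<open>d\<close>.\<close>
    show "K \<in> carrier_mat d (e * e * d)" if "K \<in> set (protocol d c g n)" for K
      using that
    proof (cases n)
      case (Suc m)
      then show ?thesis using that compose_ops_carrier by (auto simp: e_def)
    qed (auto simp: e_def)
  qed (use XY in auto)
  also have "\<dots> = step_output d b c g r1 r2 (protocol_output d b c g r1 r2 s n)"
    by (simp add: step_output_def protocol_output_def e_def P1_def P2_def)
  finally show ?thesis .
qed

section \<open>Error of one step\<close>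

text \<open>By Euler's formula. For Hermitian \<open>r1\<close> and \<open>r2\<close> this exhibits
  H as the Hermitian part of cis \<phi> times \<open>r1 * r2\<close>, the form in which the two
  shifts produce it.\<close>

lemma ham_eq:
  assumes "r1 \<in> carrier_mat d d" "r2 \<in> carrier_mat d d"
  shows "ham \<phi> r1 r2 = (cis \<phi> / 2) \<cdot>\<^sub>m (r1 * r2) + (cis (- \<phi>) / 2) \<cdot>\<^sub>m (r2 * r1)"
proof (rule eq_matI)
  have c: "cis \<phi> = of_real (cos \<phi>) + \<i> * of_real (sin \<phi>)" "cis (- \<phi>) = of_real (cos \<phi>) - \<i> * of_real (sin \<phi>)"
    by (auto simp: complex_eq_iff)
  fix i j assume "i < dim_row ((cis \<phi> / 2) \<cdot>\<^sub>m (r1 * r2) + (cis (- \<phi>) / 2) \<cdot>\<^sub>m (r2 * r1))"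
    "j < dim_col ((cis \<phi> / 2) \<cdot>\<^sub>m (r1 * r2) + (cis (- \<phi>) / 2) \<cdot>\<^sub>m (r2 * r1))"
  then have "i < d" "j < d" using assms by auto
  then show "ham \<phi> r1 r2 $$ (i, j) = ((cis \<phi> / 2) \<cdot>\<^sub>m (r1 * r2) + (cis (- \<phi>) / 2) \<cdot>\<^sub>m (r2 * r1)) $$ (i, j)"
    using assms unfolding c ham_def by (simp add: field_simps del: index_mult_mat(1))
qed (use assms in \<open>auto simp: ham_def\<close>)

lemma ham_carrier: "r1 \<in> carrier_mat d d \<Longrightarrow> r2 \<in> carrier_mat d d \<Longrightarrow> ham \<phi> r1 r2 \<in> carrier_mat d d"
  by (simp add: ham_eq mult_carrier_square)

lemma cadj_ham:
  assumes "density d r1" "density d r2"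
  shows "cadj (ham \<phi> r1 r2) = ham \<phi> r1 r2"
proof -
  have r: "r1 \<in> carrier_mat d d" "r2 \<in> carrier_mat d d" "cadj r1 = r1" "cadj r2 = r2"
    using assms by (auto simp: density_def psd_mat_def)
  have "cadj (ham \<phi> r1 r2) = (cis (- \<phi>) / 2) \<cdot>\<^sub>m (r2 * r1) + (cis \<phi> / 2) \<cdot>\<^sub>m (r1 * r2)"
    unfolding ham_eq[OF r(1,2)] using r
    by (simp add: cadj_add[of _ d d] cadj_smult cadj_mult[of _ d d _ d] mult_carrier_square cis_cnj)
  also have "\<dots> = ham \<phi> r1 r2"
    unfolding ham_eq[OF r(1,2)] using r by (intro comm_add_mat[of _ d d]) auto
  finally show ?thesis .
qed

text \<open>A mean of two products of contractions, up to phases.\<close>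

lemma op_bound_ham:
  assumes "density d r1" "density d r2"
  shows "op_bound 1 (ham \<phi> r1 r2)"
proof -
  note r = density_carrier[OF assms(1)] density_carrier[OF assms(2)]
  have "op_bound (cmod (cis \<phi> / 2) * (1 * 1) + cmod (cis (- \<phi>) / 2) * (1 * 1)) (ham \<phi> r1 r2)"
    unfolding ham_eq[OF r] using r
    by (intro op_bound_add[of _ _ _ _ d d] op_bound_smult[of _ _ d d] op_bound_mult[of _ _ _ _ d d d]
        op_bound_density[OF assms(1)] op_bound_density[OF assms(2)]) auto
  then show ?thesis by (simp add: norm_divide)
qed

text \<open>The real part cos x - 1 and the imaginary part x - sin x are each at most x^2 / 2 in
  modulus.\<close>

lemma cmod_exp_minus_linear_le:
  fixes x :: real
  shows "cmod (exp (- \<i> * complex_of_real x) - (1 - \<i> * complex_of_real x)) \<le> x\<^sup>2"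
proof -
  have "\<bar>x - sin x\<bar> \<le> x\<^sup>2 / 2"
    using Maclaurin_sin_bound[of x 2] by (simp add: sin_coeff_def eval_nat_numeral abs_minus_commute)
  moreover have "\<bar>cos x - 1\<bar> \<le> x\<^sup>2 / 2"
  proof -
    have "1 - cos x = 2 * (sin (x / 2))\<^sup>2" using cos_double_sin[of "x / 2"] by simp
    moreover have "(sin (x / 2))\<^sup>2 \<le> (x / 2)\<^sup>2"
      using power_mono[OF abs_sin_x_le_abs_x[of "x / 2"], of 2] by (simp add: power_divide)
    ultimately show ?thesis by (simp add: power_divide)
  qed
  moreover have "exp (- \<i> * complex_of_real x) - (1 - \<i> * complex_of_real x) = Complex (cos x - 1) (x - sin x)"
    by (simp add: complex_eq_iff exp_eq_polar Re_exp Im_exp)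
  moreover have "cmod (Complex (cos x - 1) (x - sin x)) \<le> \<bar>cos x - 1\<bar> + \<bar>x - sin x\<bar>"
    using cmod_le[of "Complex (cos x - 1) (x - sin x)"] by simp
  ultimately show ?thesis by simp
qed

text \<open>For an eigenvalue \<open>h\<close> of H these numbers are the eigenvalues of L. The
  bound 1 holds since |1 - i \<tau> h| is at most sqrt (1 + \<tau>^2), the inverse of
  \<open>a\<close>. In the difference, one \<tau>^2 is the Taylor remainder and the other is the
  price of the factor \<open>a\<close>.\<close>

lemma cmod_step_symbol:
  fixes h \<tau> :: real
  assumes "\<bar>h\<bar> \<le> 1"
  defines "a \<equiv> 1 / sqrt (1 + \<tau>\<^sup>2)"
  shows "cmod (complex_of_real a * (1 - \<i> * complex_of_real (\<tau> * h))) \<le> 1" (is ?bound)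
    and "cmod (exp (- \<i> * complex_of_real (\<tau> * h)) - complex_of_real a * (1 - \<i> * complex_of_real (\<tau> * h))) \<le> 2 * \<tau>\<^sup>2" (is ?diff)
proof -
  define x where "x = \<tau> * h"
  have x: "x\<^sup>2 \<le> \<tau>\<^sup>2"
  proof -
    have "h\<^sup>2 \<le> 1" using assms(1) by (simp add: abs_square_le_1)
    then show ?thesis unfolding x_def power_mult_distrib by (simp add: mult_left_le)
  qed
  define S where "S = sqrt (1 + \<tau>\<^sup>2)"
  have S: "1 \<le> S" by (simp add: S_def)
  have aS: "a = 1 / S" by (simp add: a_def S_def)
  have a: "0 < a" "a \<le> 1" using S by (auto simp: aS)
  have L: "cmod (1 - \<i> * complex_of_real x) = sqrt (1 + x\<^sup>2)"
    by (simp add: cmod_def)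
  have xS: "sqrt (1 + x\<^sup>2) \<le> S" using x by (simp add: S_def)
  have "a * sqrt (1 + x\<^sup>2) \<le> a * S"
    using xS a by (intro mult_left_mono) auto
  also have "\<dots> = 1" using S by (simp add: aS)
  finally have aL: "a * sqrt (1 + x\<^sup>2) \<le> 1" .
  then show ?bound using a unfolding x_def[symmetric] norm_mult L by simp
  have "(1 - a) * sqrt (1 + x\<^sup>2) \<le> (1 - a) * S"
    using xS a by (intro mult_left_mono) auto
  also have "\<dots> = S - 1" using S by (simp add: aS algebra_simps)
  also have "\<dots> \<le> \<tau>\<^sup>2"
  proof -
    have "1 + \<tau>\<^sup>2 \<le> (1 + \<tau>\<^sup>2)\<^sup>2" by (rule self_le_power) auto
    then have "S \<le> 1 + \<tau>\<^sup>2" unfolding S_def by (intro real_le_lsqrt) auto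
    then show ?thesis by simp
  qed
  finally have rest: "(1 - a) * sqrt (1 + x\<^sup>2) \<le> \<tau>\<^sup>2" .
  have "exp (- \<i> * complex_of_real x) - complex_of_real a * (1 - \<i> * complex_of_real x)
      = (exp (- \<i> * complex_of_real x) - (1 - \<i> * complex_of_real x)) + complex_of_real (1 - a) * (1 - \<i> * complex_of_real x)"
    by (simp add: algebra_simps)
  then have "cmod (exp (- \<i> * complex_of_real x) - complex_of_real a * (1 - \<i> * complex_of_real x))
      \<le> cmod (exp (- \<i> * complex_of_real x) - (1 - \<i> * complex_of_real x)) + cmod (complex_of_real (1 - a) * (1 - \<i> * complex_of_real x))"
    using norm_triangle_ineq by metis
  also have "\<dots> \<le> x\<^sup>2 + (1 - a) * sqrt (1 + x\<^sup>2)"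
    using cmod_exp_minus_linear_le[of x] a by (simp only: norm_mult L norm_of_real)
  also have "\<dots> \<le> 2 * \<tau>\<^sup>2" using x rest by simp
  finally show ?diff by (simp add: x_def)
qed

section \<open>Densities under tensor products and partial traces\<close>

lemma mtrace_kron:
  assumes "A \<in> carrier_mat a a" "B \<in> carrier_mat b b"
  shows "mtrace (kron A B) = mtrace A * mtrace B"
proof -
  have "dim_row (kron A B) = a * b" using assms by (simp add: kron_def)
  then have "mtrace (kron A B) = (\<Sum>i<a. \<Sum>k<b. A $$ (i, i) * B $$ (k, k))"
    unfolding mtrace_def using assms by (simp add: sum_lessThan_mult kron_index[OF assms])
  then show ?thesis using assms by (simp add: mtrace_def sum_product)
qed

lemma density_kron: "density a A \<Longrightarrow> density b B \<Longrightarrow> density (a * b) (kron A B)"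
  by (simp add: density_def psd_mat_kron mtrace_kron[of _ a _ b] psd_mat_def[of a A] psd_mat_def[of b B])

text \<open>Positivity follows from a Kraus form of the partial trace over the first factor; the
  trace is the same double sum in another order.\<close>

lemma density_ptrace:
  assumes "density (d * b) s"
  shows "density b (ptrace d b s)"
proof -
  \<comment> \<open>The m-th basis bra on the first factor, tensored with the identity on the
    second.\<close>
  define K :: "nat \<Rightarrow> complex mat" where "K m = mat b (d * b) (\<lambda>(k, q). if q = m * b + k then 1 else 0)" for m
  have s: "s \<in> carrier_mat (d * b) (d * b)" using assms by (rule density_carrier)
  have "ptrace d b s = kraus_apply b (map K [0..<d]) s"
  proof (rule eq_matI)
    fix k l assume "k < dim_row (kraus_apply b (map K [0..<d]) s)" "l < dim_col (kraus_apply b (map K [0..<d]) s)"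
    then have kl: "k < b" "l < b" by (auto simp: kraus_apply_def)
    have "(K m * s * cadj (K m)) $$ (k, l) = s $$ (m * b + k, m * b + l)" if m: "m < d" for m
    proof -
      have lt: "m * b + k < d * b" "m * b + l < d * b" using m kl by (auto intro: mult_add_less_mult)
      have "(K m * s * cadj (K m)) $$ (k, l)
          = (\<Sum>p<d * b. \<Sum>q<d * b. K m $$ (k, p) * s $$ (p, q) * cnj (K m $$ (l, q)))"
        using kl s by (intro conj_index) (auto simp: K_def)
      also have "\<dots> = (\<Sum>p<d * b. if p = m * b + k then s $$ (m * b + k, m * b + l) else 0)"
      proof (rule sum.cong[OF refl])
        fix p assume p: "p \<in> {..<d * b}"
        have "(\<Sum>q<d * b. K m $$ (k, p) * s $$ (p, q) * cnj (K m $$ (l, q)))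
            = (\<Sum>q<d * b. if q = m * b + l then K m $$ (k, p) * s $$ (p, m * b + l) else 0)"
          using kl by (intro sum.cong refl) (auto simp: K_def)
        then show "(\<Sum>q<d * b. K m $$ (k, p) * s $$ (p, q) * cnj (K m $$ (l, q)))
            = (if p = m * b + k then s $$ (m * b + k, m * b + l) else 0)"
          using lt kl p by (simp add: K_def)
      qed
      finally show ?thesis using lt by simp
    qed
    then show "ptrace d b s $$ (k, l) = kraus_apply b (map K [0..<d]) s $$ (k, l)"
      using kl by (simp add: ptrace_def kraus_apply_def comp_def sum_list_upt del: index_mult_mat)
  qed (auto simp: ptrace_def kraus_apply_def)
  moreover have "psd_mat b (kraus_apply b (map K [0..<d]) s)"
  proof (rule psd_mat_kraus_apply)
    show "psd_mat (d * b) s" using assms by (simp add: density_def)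
  qed (auto simp: K_def)
  moreover have "mtrace (ptrace d b s) = mtrace s"
  proof -
    have "mtrace (ptrace d b s) = (\<Sum>k<b. \<Sum>m<d. s $$ (m * b + k, m * b + k))"
      by (simp add: mtrace_def ptrace_def)
    also have "\<dots> = (\<Sum>m<d. \<Sum>k<b. s $$ (m * b + k, m * b + k))" by (rule sum.swap)
    finally show ?thesis using s by (simp add: mtrace_def sum_lessThan_mult)
  qed
  ultimately show ?thesis using assms by (simp add: density_def)
qed

lemma kron_one_smult:
  assumes "A \<in> carrier_mat m n"
  shows "kron (c \<cdot>\<^sub>m A) (1\<^sub>m b) = c \<cdot>\<^sub>m kron A (1\<^sub>m b)"
proof (rule eq_mat_productI)
  fix i k j l assume ij: "i < m" "k < b" "j < n" "l < b"
  then have "i * b + k < m * b" "j * b + l < n * b" by (auto intro: mult_add_less_mult)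
  moreover have "dim_row (kron A (1\<^sub>m b)) = m * b" "dim_col (kron A (1\<^sub>m b)) = n * b"
    using assms by (auto simp: kron_def)
  ultimately show "kron (c \<cdot>\<^sub>m A) (1\<^sub>m b) $$ (i * b + k, j * b + l) = (c \<cdot>\<^sub>m kron A (1\<^sub>m b)) $$ (i * b + k, j * b + l)"
    using assms ij
    by (simp add: kron_index[of A m n "1\<^sub>m b" b b] kron_index[of "c \<cdot>\<^sub>m A" m n "1\<^sub>m b" b b])
qed (use assms in auto)

text \<open>The substitution g = -i \<tau> cis \<phi> in \<open>step_output_index\<close>: then g
  times its conjugate is \<tau>^2, and c^2 is half of \<kappa>.\<close>

lemma step_output_eq:
  fixes \<tau> \<phi> :: real
  assumes r: "density d r1" "density d r2" and s: "s \<in> carrier_mat (d * b) (d * b)"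
    and c: "2 * c\<^sup>2 * (1 + \<tau>\<^sup>2) = 1"
  defines "H \<equiv> kron (ham \<phi> r1 r2) (1\<^sub>m b)" and "\<kappa> \<equiv> complex_of_real (1 / (1 + \<tau>\<^sup>2))"
  shows "step_output d b c (- \<i> * complex_of_real \<tau> * cis \<phi>) r1 r2 s
    = \<kappa> \<cdot>\<^sub>m (s + (- \<i> * complex_of_real \<tau>) \<cdot>\<^sub>m (H * s) + (\<i> * complex_of_real \<tau>) \<cdot>\<^sub>m (s * H))
      + (\<kappa> * complex_of_real (\<tau>\<^sup>2) / 2) \<cdot>\<^sub>m (kron r1 (ptrace d b s) + kron r2 (ptrace d b s))"
    (is "?l = ?r")
proof (rule eq_mat_productI)
  have rc: "r1 \<in> carrier_mat d d" "r2 \<in> carrier_mat d d" "mtrace r1 = 1" "mtrace r2 = 1"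
    using r by (auto simp: density_def psd_mat_def)
  note hc = ham_carrier[OF rc(1,2), of \<phi>]
  have Hc: "H \<in> carrier_mat (d * b) (d * b)" using hc by (simp add: H_def)
  have pc: "ptrace d b s \<in> carrier_mat b b" by (simp add: ptrace_def)
  have Hs: "H * s \<in> carrier_mat (d * b) (d * b)" "s * H \<in> carrier_mat (d * b) (d * b)"
    using Hc s by (auto intro: mult_carrier_square)
  have kc: "kron r1 (ptrace d b s) \<in> carrier_mat (d * b) (d * b)" "kron r2 (ptrace d b s) \<in> carrier_mat (d * b) (d * b)"
    using rc pc by auto
  show "?l \<in> carrier_mat (d * b) (d * b)" by (simp add: step_output_def kraus_apply_def)
  show "?r \<in> carrier_mat (d * b) (d * b)" using s Hs kc by simp
  fix i k j l assume ij: "i < d" "k < b" "j < d" "l < b"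
  then have lt: "i * b + k < d * b" "j * b + l < d * b" by (auto intro: mult_add_less_mult)
  define g where "g = - \<i> * complex_of_real \<tau> * cis \<phi>"
  have cnj_g: "cnj g = \<i> * complex_of_real \<tau> * cis (- \<phi>)" by (simp add: g_def cis_cnj)
  have gg: "g * cnj g = complex_of_real (\<tau>\<^sup>2)"
    unfolding complex_norm_square[symmetric] by (simp add: g_def norm_mult)
  have cc: "(complex_of_real c)\<^sup>2 = \<kappa> / 2"
  proof -
    have "1 + \<tau>\<^sup>2 > 0" by (simp add: add_pos_nonneg)
    then have "c\<^sup>2 = 1 / (1 + \<tau>\<^sup>2) / 2" using c by (simp add: field_simps)
    then have "complex_of_real (c\<^sup>2) = complex_of_real (1 / (1 + \<tau>\<^sup>2) / 2)" by (rule arg_cong)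
    then show ?thesis unfolding \<kappa>_def by (simp only: of_real_divide of_real_numeral of_real_power)
  qed
  \<comment> \<open>The factor 2 here meets c^2 = \<kappa> / 2, so that H appears with the
    coefficient \<tau> exactly.\<close>
  have ham: "g * (r1 * r2) $$ (x, y) - cnj g * (r2 * r1) $$ (x, y) = - 2 * \<i> * complex_of_real \<tau> * ham \<phi> r1 r2 $$ (x, y)"
    if "x < d" "y < d" for x y
    unfolding ham_eq[OF rc(1,2)] cnj_g g_def using that rc by (simp add: algebra_simps cis_cnj del: index_mult_mat(1))
  define A where "A = (\<Sum>m<d. ham \<phi> r1 r2 $$ (i, m) * s $$ (m * b + k, j * b + l))"
  define B where "B = (\<Sum>m<d. s $$ (i * b + k, m * b + l) * ham \<phi> r1 r2 $$ (m, j))"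
  have A: "(H * s) $$ (i * b + k, j * b + l) = A"
    unfolding H_def A_def using hc s ij lt by (intro kron_one_mult_index[of _ d d _ _ "d * b"]) auto
  have B: "(s * H) $$ (i * b + k, j * b + l) = B"
    unfolding H_def B_def using hc s ij lt by (intro mult_kron_one_index[of _ d d _ "d * b"]) auto
  have "?l $$ (i * b + k, j * b + l) = (complex_of_real c)\<^sup>2 * (2 * s $$ (i * b + k, j * b + l)
      + (\<Sum>m<d. (g * (r1 * r2) $$ (i, m) - cnj g * (r2 * r1) $$ (i, m)) * s $$ (m * b + k, j * b + l))
      - (\<Sum>m<d. s $$ (i * b + k, m * b + l) * (g * (r1 * r2) $$ (m, j) - cnj g * (r2 * r1) $$ (m, j)))
      + g * cnj g * (r1 $$ (i, j) + r2 $$ (i, j)) * ptrace d b s $$ (k, l))"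
    unfolding step_output_def g_def[symmetric] by (rule step_output_index[OF rc s ij])
  also have "(\<Sum>m<d. (g * (r1 * r2) $$ (i, m) - cnj g * (r2 * r1) $$ (i, m)) * s $$ (m * b + k, j * b + l))
      = - 2 * \<i> * complex_of_real \<tau> * A"
    unfolding A_def sum_distrib_left using ij by (intro sum.cong refl) (simp only: ham lessThan_iff mult.assoc)
  also have "(\<Sum>m<d. s $$ (i * b + k, m * b + l) * (g * (r1 * r2) $$ (m, j) - cnj g * (r2 * r1) $$ (m, j)))
      = - 2 * \<i> * complex_of_real \<tau> * B"
    unfolding B_def sum_distrib_left using ij by (intro sum.cong refl) (simp only: ham lessThan_iff mult_ac)
  also have "(complex_of_real c)\<^sup>2 * (2 * s $$ (i * b + k, j * b + l) + - 2 * \<i> * complex_of_real \<tau> * A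
      - - 2 * \<i> * complex_of_real \<tau> * B + g * cnj g * (r1 $$ (i, j) + r2 $$ (i, j)) * ptrace d b s $$ (k, l))
      = \<kappa> * (s $$ (i * b + k, j * b + l) + - \<i> * complex_of_real \<tau> * A + \<i> * complex_of_real \<tau> * B)
        + \<kappa> * complex_of_real (\<tau>\<^sup>2) / 2 * (r1 $$ (i, j) * ptrace d b s $$ (k, l) + r2 $$ (i, j) * ptrace d b s $$ (k, l))"
    unfolding cc gg by (simp add: algebra_simps)
  also have "\<dots> = ?r $$ (i * b + k, j * b + l)"
    using s Hs kc lt carrier_matD[OF kc(1)] carrier_matD[OF kc(2)] carrier_matD[OF Hc]
    by (simp add: A B kron_index[OF rc(1) pc] kron_index[OF rc(2) pc] ij del: index_mult_mat(1))
  finally show "?l $$ (i * b + k, j * b + l) = ?r $$ (i * b + k, j * b + l)" .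
qed

text \<open>The invariant of the iteration, as the error bound of a step is stated for densities. In
  the closed form the commutator is traceless and the two product densities contribute \<tau>^2 / 2
  each, so the trace is \<kappa> (1 + \<tau>^2) = 1.\<close>

lemma density_step_output:
  assumes r: "density d r1" "density d r2" and s: "density (d * b) s"
    and c: "2 * c\<^sup>2 * (1 + \<tau>\<^sup>2) = 1"
  shows "density (d * b) (step_output d b c (- \<i> * complex_of_real \<tau> * cis \<phi>) r1 r2 s)"
proof -
  define H where "H = kron (ham \<phi> r1 r2) (1\<^sub>m b)"
  define \<kappa> where "\<kappa> = complex_of_real (1 / (1 + \<tau>\<^sup>2))"
  note rc = density_carrier[OF r(1)] density_carrier[OF r(2)]
  note sc = density_carrier[OF s]
  have Hc: "H \<in> carrier_mat (d * b) (d * b)" using ham_carrier[OF rc] by (simp add: H_def)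
  have Hs: "H * s \<in> carrier_mat (d * b) (d * b)" "s * H \<in> carrier_mat (d * b) (d * b)"
    using Hc sc by (auto intro: mult_carrier_square)
  note k = density_kron[OF r(1) density_ptrace[OF s]] density_kron[OF r(2) density_ptrace[OF s]]
  note kc = density_carrier[OF k(1)] density_carrier[OF k(2)]
  have tr: "mtrace (s * H) = mtrace (H * s)" using sc Hc by (rule mtrace_mult_comm)
  have tr1: "mtrace s = 1" "mtrace (kron r1 (ptrace d b s)) = 1" "mtrace (kron r2 (ptrace d b s)) = 1"
    using s k by (auto simp: density_def)
  have "mtrace (step_output d b c (- \<i> * complex_of_real \<tau> * cis \<phi>) r1 r2 s) = \<kappa> * (1 + complex_of_real (\<tau>\<^sup>2))"
    unfolding step_output_eq[OF r sc c] H_def[symmetric] \<kappa>_def[symmetric] using sc Hs kc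
    by (simp add: mtrace_add[of _ "d * b"] mtrace_smult[of _ "d * b"] tr tr1) (simp add: algebra_simps)
  also have "\<dots> = complex_of_real (1 / (1 + \<tau>\<^sup>2) * (1 + \<tau>\<^sup>2))"
    unfolding \<kappa>_def by (simp only: of_real_mult of_real_add of_real_1)
  also have "1 / (1 + \<tau>\<^sup>2) * (1 + \<tau>\<^sup>2) = 1"
  proof -
    have "1 + \<tau>\<^sup>2 > 0" by (simp add: add_pos_nonneg)
    then show ?thesis by simp
  qed
  finally have "mtrace (step_output d b c (- \<i> * complex_of_real \<tau> * cis \<phi>) r1 r2 s) = 1" by simp
  moreover have "psd_mat (d * b) (step_output d b c (- \<i> * complex_of_real \<tau> * cis \<phi>) r1 r2 s)"
    unfolding step_output_def
  proof (rule psd_mat_kraus_apply)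
    show "psd_mat (d * d * (d * b)) (kron (kron r1 r2) s)"
      using r s by (intro psd_mat_kron) (auto simp: density_def)
    show "K \<in> carrier_mat (d * b) (d * d * (d * b))"
      if K: "K \<in> set (map (\<lambda>K. kron K (1\<^sub>m b)) (step_ops d c (- \<i> * complex_of_real \<tau> * cis \<phi>)))" for K
    proof -
      obtain K' where K': "K' \<in> set (step_ops d c (- \<i> * complex_of_real \<tau> * cis \<phi>))" "K = kron K' (1\<^sub>m b)"
        using K by auto
      then show ?thesis
        using kron_carrier[OF step_ops_carrier[OF K'(1)] one_carrier_mat[of b]] by (simp add: mult.assoc)
    qed
  qed
  ultimately show ?thesis by (simp add: density_def)
qed

text \<open>Up to the positive corrections \<mu> H s H and (\<mu> / 2) G, with \<mu> = \<tau>^2 / (1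
  + \<tau>^2), the step is conjugation by the contraction L. The evolution is exchanged for L one
  side at a time, which needs only scalar estimates at the eigenvalues of H.\<close>

lemma trace_bound_step:
  assumes r: "density d r1" "density d r2" and s: "density (d * b) s"
    and c: "2 * c\<^sup>2 * (1 + \<tau>\<^sup>2) = 1"
    and V: "unitary_mat d V" "ham \<phi> r1 r2 = spec_mat d V (\<lambda>k. complex_of_real (h k))"
  defines "U \<equiv> kron (spec_mat d V (\<lambda>k. exp (- \<i> * complex_of_real (\<tau> * h k)))) (1\<^sub>m b)"
  shows "trace_bound (d * b) (6 * \<tau>\<^sup>2)
    (U * s * cadj U - step_output d b c (- \<i> * complex_of_real \<tau> * cis \<phi>) r1 r2 s)"
proof -
  define N where "N = d * b"
  \<comment> \<open>\<open>U\<close>, \<open>L\<close> and \<open>H\<close> are all values of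
    \<open>P\<close>, so they are compared through scalar functions of the eigenvalues.\<close>
  define P where "P f = kron (spec_mat d V f) (1\<^sub>m b)" for f
  define a where "a = 1 / sqrt (1 + \<tau>\<^sup>2)"
  define u where "u k = exp (- \<i> * complex_of_real (\<tau> * h k))" for k
  define f where "f k = complex_of_real a * (1 - \<i> * complex_of_real (\<tau> * h k))" for k
  define H where "H = P (\<lambda>k. complex_of_real (h k))"
  define L where "L = P f"
  define G where "G = kron r1 (ptrace d b s) + kron r2 (ptrace d b s)"
  define \<kappa> where "\<kappa> = complex_of_real (1 / (1 + \<tau>\<^sup>2))"
  define E where "E = step_output d b c (- \<i> * complex_of_real \<tau> * cis \<phi>) r1 r2 s"
  note Vc = unitary_matD(1)[OF V(1)]
  note sc = density_carrier[OF s, folded N_def]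
  have Pc: "P f \<in> carrier_mat N N" for f using Vc by (simp add: P_def N_def)
  have P_adj: "cadj (P f) = P (\<lambda>k. cnj (f k))" for f
    unfolding P_def using Vc by (simp add: cadj_kron_one[of _ d d] cadj_spec_mat)
  have P_minus: "P f - P g = P (\<lambda>k. f k - g k)" for f g
    unfolding P_def using Vc by (simp flip: kron_one_minus[of _ d d] spec_mat_minus)
  have P_smult: "P (\<lambda>k. x * f k) = x \<cdot>\<^sub>m P f" for x f
    unfolding P_def using Vc by (simp flip: kron_one_smult[of _ d d] spec_mat_smult)
  have P_one: "P (\<lambda>_. 1) = 1\<^sub>m N"
    unfolding P_def N_def using V by (simp add: spec_mat_one kron_one_one)
  have P_bound: "op_bound x (P f)" if "0 \<le> x" "\<And>k. k < d \<Longrightarrow> cmod (f k) \<le> x" for x f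
    unfolding P_def using that Vc by (intro op_bound_kron_one[of _ _ d d] op_bound_spec_mat V(1)) auto
  \<comment> \<open>The eigenvalues are the diagonal entries of H in its eigenbasis, and H is a
    contraction.\<close>
  have h: "\<bar>h k\<bar> \<le> 1" if "k < d" for k
  proof -
    have "op_bound (1 * 1 * 1) (cadj V * ham \<phi> r1 r2 * V)"
      using Vc ham_carrier[OF density_carrier[OF r(1)] density_carrier[OF r(2)]]
      by (intro op_bound_mult[of _ _ _ _ d d d] op_bound_unitary[OF V(1)] op_bound_ham[OF r])
        (auto intro!: mult_carrier_square)
    then have "op_bound 1 (mat_diag d (\<lambda>k. complex_of_real (h k)))"
      unfolding V(2) unitary_conj_spec_mat[OF V(1)] by simp
    from op_bound_entry[OF this _ that] show ?thesis using that by (simp add: mat_diag_def)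
  qed
  have U: "U = P u" by (simp add: U_def P_def u_def[abs_def])
  have aa: "complex_of_real a * complex_of_real a = \<kappa>"
  proof -
    have "1 + \<tau>\<^sup>2 \<ge> 0" by simp
    then have "a * a = 1 / (1 + \<tau>\<^sup>2)" unfolding a_def by (simp only: times_divide_times_eq real_sqrt_mult_self abs_of_nonneg)
    then show ?thesis unfolding \<kappa>_def by (simp only: flip: of_real_mult)
  qed
  \<comment> \<open>Chosen so that L is a - e H. As \<open>e\<close> is purely imaginary, passing to
    the adjoint flips its sign.\<close>
  define e where "e = \<i> * complex_of_real \<tau> * complex_of_real a"
  have L: "L = complex_of_real a \<cdot>\<^sub>m 1\<^sub>m N - e \<cdot>\<^sub>m H"
    unfolding L_def H_def P_one[symmetric] P_smult[symmetric] P_minus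
    by (rule arg_cong[of _ _ P]) (simp add: f_def e_def fun_eq_iff algebra_simps)
  have L': "cadj L = complex_of_real a \<cdot>\<^sub>m 1\<^sub>m N - (- e) \<cdot>\<^sub>m H"
    unfolding L_def P_adj H_def P_one[symmetric] P_smult[symmetric] P_minus
    by (rule arg_cong[of _ _ P]) (simp add: f_def e_def fun_eq_iff algebra_simps)
  have Hc: "H \<in> carrier_mat N N" and Lc: "L \<in> carrier_mat N N" and Uc: "U \<in> carrier_mat N N"
    using Pc by (auto simp: H_def L_def U)
  have carr: "H * s \<in> carrier_mat N N" "s * H \<in> carrier_mat N N" "H * s * H \<in> carrier_mat N N"
    "cadj L \<in> carrier_mat N N" "cadj U \<in> carrier_mat N N" "L * s * cadj L \<in> carrier_mat N N"
    "U * s * cadj U \<in> carrier_mat N N" "L * s * cadj U \<in> carrier_mat N N" "L * s \<in> carrier_mat N N" "U * s \<in> carrier_mat N N"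
    using Hc sc Lc Uc by (auto intro!: mult_carrier_square)
  have mult1: "(x \<cdot>\<^sub>m 1\<^sub>m N - y \<cdot>\<^sub>m H) * X = x \<cdot>\<^sub>m X - y \<cdot>\<^sub>m (H * X)" if "X \<in> carrier_mat N N" for x y X
    using that Hc by (simp add: minus_mult_distrib_mat[of _ N N _ _ N] mult_smult_assoc_mat[of _ N N _ N] left_mult_one_mat[of _ N N])
  have mult2: "X * (x \<cdot>\<^sub>m 1\<^sub>m N - y \<cdot>\<^sub>m H) = x \<cdot>\<^sub>m X - y \<cdot>\<^sub>m (X * H)" if "X \<in> carrier_mat N N" for x y X
    using that Hc by (simp add: mult_minus_distrib_mat[of _ N N _ N] mult_smult_distrib[of _ N N _ N] right_mult_one_mat[of _ N N])
  have LsL: "L * s * cadj L = complex_of_real a \<cdot>\<^sub>m (complex_of_real a \<cdot>\<^sub>m s - e \<cdot>\<^sub>m (H * s))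
      - (- e) \<cdot>\<^sub>m (complex_of_real a \<cdot>\<^sub>m (s * H) - e \<cdot>\<^sub>m (H * s * H))"
  proof -
    have "L * s = complex_of_real a \<cdot>\<^sub>m s - e \<cdot>\<^sub>m (H * s)" unfolding L using sc by (rule mult1)
    moreover have "(complex_of_real a \<cdot>\<^sub>m s - e \<cdot>\<^sub>m (H * s)) * H = complex_of_real a \<cdot>\<^sub>m (s * H) - e \<cdot>\<^sub>m (H * s * H)"
      using sc Hc carr by (simp add: minus_mult_distrib_mat[of _ N N _ _ N] mult_smult_assoc_mat[of _ N N _ N] del: assoc_mult_mat)
    moreover have "complex_of_real a \<cdot>\<^sub>m s - e \<cdot>\<^sub>m (H * s) \<in> carrier_mat N N" using sc carr by (simp add: minus_carrier_mat)
    ultimately show ?thesis unfolding L' using mult2 by simp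
  qed
  have Hham: "H = kron (ham \<phi> r1 r2) (1\<^sub>m b)" by (simp add: H_def P_def V(2))
  have kd: "density N (kron r1 (ptrace d b s))" "density N (kron r2 (ptrace d b s))"
    unfolding N_def by (intro density_kron r density_ptrace s)+
  have Gc: "G \<in> carrier_mat N N" using kd by (simp add: G_def density_carrier)
  have E: "E = \<kappa> \<cdot>\<^sub>m (s + (- \<i> * complex_of_real \<tau>) \<cdot>\<^sub>m (H * s) + (\<i> * complex_of_real \<tau>) \<cdot>\<^sub>m (s * H))
      + (\<kappa> * complex_of_real (\<tau>\<^sup>2) / 2) \<cdot>\<^sub>m G"
    unfolding E_def G_def \<kappa>_def Hham by (rule step_output_eq[OF r density_carrier[OF s] c])
  define \<mu> where "\<mu> = \<kappa> * complex_of_real (\<tau>\<^sup>2)"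
  have ae: "complex_of_real a * e = \<i> * complex_of_real \<tau> * \<kappa>"
    unfolding e_def aa[symmetric] by simp
  have "e * e = (\<i> * \<i>) * (complex_of_real a * complex_of_real a * (complex_of_real \<tau> * complex_of_real \<tau>))"
    unfolding e_def by (simp only: mult_ac)
  then have ee: "e * e = - \<mu>"
    unfolding aa \<mu>_def by (simp add: power2_eq_square)
  \<comment> \<open>Conjugation by L gives \<kappa> times s - i \<tau> [H, s] and, in addition,
    \<mu> H s H; the channel has (\<mu> / 2) G in place of the latter.\<close>
  have E2: "E = L * s * cadj L + (- \<mu>) \<cdot>\<^sub>m (H * s * H) + (\<mu> / 2) \<cdot>\<^sub>m G"
  proof (rule eq_matI)
    fix i j assume "i < dim_row (L * s * cadj L + (- \<mu>) \<cdot>\<^sub>m (H * s * H) + (\<mu> / 2) \<cdot>\<^sub>m G)"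
      "j < dim_col (L * s * cadj L + (- \<mu>) \<cdot>\<^sub>m (H * s * H) + (\<mu> / 2) \<cdot>\<^sub>m G)"
    then have ij: "i < N" "j < N" using Gc by auto
    define x where "x = s $$ (i, j)"
    define y where "y = (H * s) $$ (i, j)"
    define z where "z = (s * H) $$ (i, j)"
    define w where "w = (H * s * H) $$ (i, j)"
    have "E $$ (i, j) = \<kappa> * (x + - \<i> * complex_of_real \<tau> * y + \<i> * complex_of_real \<tau> * z) + \<mu> / 2 * G $$ (i, j)"
      unfolding E x_def y_def z_def \<mu>_def using ij Gc sc Hc carr by (simp del: index_mult_mat(1))
    also have "\<dots> = complex_of_real a * (complex_of_real a * x - e * y) - - e * (complex_of_real a * z - e * w)
        + - \<mu> * w + \<mu> / 2 * G $$ (i, j)"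
    proof -
      have "complex_of_real a * (complex_of_real a * x - e * y) - - e * (complex_of_real a * z - e * w)
          = complex_of_real a * complex_of_real a * x - complex_of_real a * e * y + complex_of_real a * e * z - e * e * w"
        by (simp add: algebra_simps)
      then show ?thesis unfolding aa ae ee by (simp add: algebra_simps)
    qed
    also have "\<dots> = (L * s * cadj L + (- \<mu>) \<cdot>\<^sub>m (H * s * H) + (\<mu> / 2) \<cdot>\<^sub>m G) $$ (i, j)"
      unfolding LsL x_def y_def z_def w_def using ij Gc sc Hc carr by (simp del: index_mult_mat(1))
    finally show "E $$ (i, j) = (L * s * cadj L + (- \<mu>) \<cdot>\<^sub>m (H * s * H) + (\<mu> / 2) \<cdot>\<^sub>m G) $$ (i, j)" .
  qed (use Gc E sc carr in auto)
  have split: "U * s * cadj U - E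
      = ((U - L) * s * cadj U + L * s * (cadj U - cadj L)) + (\<mu> \<cdot>\<^sub>m (H * s * H) + (- \<mu> / 2) \<cdot>\<^sub>m G)"
  proof -
    have 1: "(U - L) * s * cadj U = U * s * cadj U - L * s * cadj U"
      using Uc Lc sc carr by (simp add: minus_mult_distrib_mat[of _ N N _ _ N] del: assoc_mult_mat)
    have 2: "L * s * (cadj U - cadj L) = L * s * cadj U - L * s * cadj L"
      using carr by (simp add: mult_minus_distrib_mat[of _ N N _ N] del: assoc_mult_mat)
    \<comment> \<open>Used with the hybrid \<open>L * s * cadj U\<close> as
      \<open>B\<close>.\<close>
    have "A - (C + (- \<mu>) \<cdot>\<^sub>m M + (\<mu> / 2) \<cdot>\<^sub>m G) = ((A - B) + (B - C)) + (\<mu> \<cdot>\<^sub>m M + (- \<mu> / 2) \<cdot>\<^sub>m G)"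
      if "A \<in> carrier_mat N N" "B \<in> carrier_mat N N" "C \<in> carrier_mat N N" "M \<in> carrier_mat N N" for A B C M
      by (rule eq_matI) (use that Gc in auto)
    then show ?thesis
      unfolding 1 2 E2 using carr by blast
  qed
  have b1: "trace_bound N (2 * \<tau>\<^sup>2 * 1 * 1) ((U - L) * s * cadj U)"
  proof (rule trace_bound_mult)
    show "op_bound (2 * \<tau>\<^sup>2) (U - L)"
      unfolding U L_def P_minus using h cmod_step_symbol(2) by (intro P_bound) (auto simp: u_def f_def a_def)
    show "op_bound 1 (cadj U)"
      unfolding U P_adj by (intro P_bound) (auto simp: u_def)
    show "trace_bound N 1 s" using trace_bound_density[OF s] by (simp add: N_def)
  qed (use Uc Lc sc carr in \<open>auto intro: minus_carrier_mat\<close>)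
  have b2: "trace_bound N (1 * (2 * \<tau>\<^sup>2) * 1) (L * s * (cadj U - cadj L))"
  proof (rule trace_bound_mult)
    show "op_bound (2 * \<tau>\<^sup>2) (cadj U - cadj L)"
      unfolding U L_def P_minus P_adj complex_cnj_diff[symmetric]
      using h cmod_step_symbol(2) by (intro P_bound) (auto simp: u_def f_def a_def simp del: complex_cnj_diff)
    show "op_bound 1 L"
      unfolding L_def using h cmod_step_symbol(1) by (intro P_bound) (auto simp: f_def a_def)
    show "trace_bound N 1 s" using trace_bound_density[OF s] by (simp add: N_def)
  qed (use Uc Lc sc carr in \<open>auto intro: minus_carrier_mat\<close>)
  have b3: "trace_bound N (1 * 1 * 1) (H * s * H)"
  proof (rule trace_bound_mult)
    show "op_bound 1 H" "op_bound 1 H" unfolding H_def using h by (auto intro!: P_bound)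
    show "trace_bound N 1 s" using trace_bound_density[OF s] by (simp add: N_def)
  qed (use Hc sc in auto)
  have b4: "trace_bound N (1 + 1) G"
    unfolding G_def using kd by (intro trace_bound_add trace_bound_density density_carrier)
  have lam: "cmod \<mu> \<le> \<tau>\<^sup>2"
  proof -
    have "1 / (1 + \<tau>\<^sup>2) \<le> 1" "0 \<le> 1 / (1 + \<tau>\<^sup>2)" by (auto simp: divide_simps add_pos_nonneg)
    then have "\<bar>1 / (1 + \<tau>\<^sup>2)\<bar> * \<tau>\<^sup>2 \<le> 1 * \<tau>\<^sup>2" by (intro mult_right_mono) auto
    then show ?thesis unfolding \<mu>_def \<kappa>_def norm_mult norm_of_real by simp
  qed
  \<comment> \<open>The total is 4 \<tau>^2 + 2 |\<mu>|, and |\<mu>| is at most \<tau>^2.\<close>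
  have "trace_bound N ((2 * \<tau>\<^sup>2 * 1 * 1 + 1 * (2 * \<tau>\<^sup>2) * 1) + (cmod \<mu> * (1 * 1 * 1) + cmod (- \<mu> / 2) * (1 + 1)))
      (U * s * cadj U - E)"
    unfolding split using carr Uc Lc sc Gc
    by (intro trace_bound_add trace_bound_smult b1 b2 b3 b4)
      (auto intro!: mult_carrier_square minus_carrier_mat add_carrier_mat)
  then show ?thesis
    unfolding E_def N_def by (rule trace_bound_mono) (use lam in \<open>simp add: norm_divide\<close>)
qed

section \<open>Accumulation of the errors over n steps\<close>

lemma minus_add_minus_mat:
  fixes A :: "'a::ab_group_add mat"
  assumes "A \<in> carrier_mat m n" "B \<in> carrier_mat m n" "C \<in> carrier_mat m n"
  shows "A - C = (A - B) + (B - C)"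
  by (rule eq_matI) (use assms in auto)

text \<open>One induction carries both claims, because the next one-step bound is applied to the
  density \<open>out n\<close>. Conjugation by the exact step \<open>W\<close> preserves the old
  bound, so errors only add.\<close>

lemma trace_bound_protocol:
  assumes r: "density d r1" "density d r2" and s: "density (d * b) s"
    and c: "2 * c\<^sup>2 * (1 + \<tau>\<^sup>2) = 1"
    and V: "unitary_mat d V" "ham \<phi> r1 r2 = spec_mat d V (\<lambda>k. complex_of_real (h k))"
  defines "U \<equiv> \<lambda>n. kron (spec_mat d V (\<lambda>k. exp (- \<i> * complex_of_real (real n * \<tau> * h k)))) (1\<^sub>m b)"
    and "out \<equiv> protocol_output d b c (- \<i> * complex_of_real \<tau> * cis \<phi>) r1 r2 s"
  shows "density (d * b) (out n) \<and> trace_bound (d * b) (real n * (6 * \<tau>\<^sup>2)) (U n * s * cadj (U n) - out n)"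
proof (induction n)
  case 0
  note sc = density_carrier[OF s]
  have "U 0 = 1\<^sub>m (d * b)"
    unfolding U_def using V by (simp add: spec_mat_one kron_one_one)
  moreover have "out 0 = s" unfolding out_def by (rule protocol_output_0[OF sc])
  moreover have "1\<^sub>m (d * b) * s * cadj (1\<^sub>m (d * b)) - s = 0\<^sub>m (d * b) (d * b)"
    using left_mult_one_mat[OF sc] right_mult_one_mat[OF sc] minus_r_inv_mat[OF sc] by simp
  ultimately show ?case
    using s by (simp add: trace_bound_def mtrace_def)
next
  case (Suc n)
  define N where "N = d * b"
  define W where "W = kron (spec_mat d V (\<lambda>k. exp (- \<i> * complex_of_real (\<tau> * h k)))) (1\<^sub>m b)"
  note Vc = unitary_matD(1)[OF V(1)]
  note sc = density_carrier[OF s, folded N_def]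
  have dens: "density N (out n)" and err: "trace_bound N (real n * (6 * \<tau>\<^sup>2)) (U n * s * cadj (U n) - out n)"
    using Suc by (auto simp: N_def)
  have outc: "out n \<in> carrier_mat N N" using dens by (rule density_carrier)
  have step: "out (Suc n) = step_output d b c (- \<i> * complex_of_real \<tau> * cis \<phi>) r1 r2 (out n)"
    unfolding out_def using r s by (intro protocol_output_Suc density_carrier)
  have dens': "density N (out (Suc n))"
    unfolding step N_def using dens by (intro density_step_output r c) (simp add: N_def)
  have outc': "out (Suc n) \<in> carrier_mat N N" using dens' by (rule density_carrier)
  have Uc: "U n \<in> carrier_mat N N" and Wc: "W \<in> carrier_mat N N"
    using Vc by (simp_all add: U_def W_def N_def)
  have "(\<lambda>k. exp (- \<i> * complex_of_real (real (Suc n) * \<tau> * h k)))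
      = (\<lambda>k. exp (- \<i> * complex_of_real (\<tau> * h k)) * exp (- \<i> * complex_of_real (real n * \<tau> * h k)))"
    by (simp add: fun_eq_iff algebra_simps flip: exp_add)
  then have U_Suc: "U (Suc n) = W * U n"
    unfolding U_def W_def using Vc by (simp only: kron_one_mult[of _ d d _ d] spec_mat_carrier spec_mat_mult[OF V(1)])
  have carr: "U n * s * cadj (U n) \<in> carrier_mat N N" "cadj (U n) \<in> carrier_mat N N" "cadj W \<in> carrier_mat N N"
    "W * out n * cadj W \<in> carrier_mat N N" "W * (U n * s * cadj (U n)) * cadj W \<in> carrier_mat N N"
    "W * out n \<in> carrier_mat N N" "W * (U n * s * cadj (U n)) \<in> carrier_mat N N"
    using Uc Wc sc outc by (auto intro!: mult_carrier_square)
  have "U (Suc n) * s * cadj (U (Suc n)) = W * (U n * s * cadj (U n)) * cadj W"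
    unfolding U_Suc using Uc Wc sc
    by (simp add: cadj_mult[of _ N N _ N] assoc_mult_square[of _ N] mult_carrier_square[of _ N] del: assoc_mult_mat)
  moreover have "W * (U n * s * cadj (U n) - out n) * cadj W
      = W * (U n * s * cadj (U n)) * cadj W - W * out n * cadj W"
    using carr Wc outc
    by (simp add: mult_minus_distrib_mat[of _ N N _ N] minus_mult_distrib_mat[of _ N N _ _ N] del: assoc_mult_mat)
  \<comment> \<open>The hybrid \<open>W * out n * cadj W\<close> evolves the simulated state
    exactly: against the exact state it shows the old error conjugated by \<open>W\<close>, against
    \<open>out (Suc n)\<close> the error of one step.\<close>
  ultimately have split: "U (Suc n) * s * cadj (U (Suc n)) - out (Suc n)
      = W * (U n * s * cadj (U n) - out n) * cadj W + (W * out n * cadj W - out (Suc n))"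
    using minus_add_minus_mat[OF carr(5) carr(4) outc'] by (simp only:)
  have Wb: "op_bound 1 W" "op_bound 1 (cadj W)"
    unfolding W_def cadj_kron_one[OF spec_mat_carrier[OF Vc]] cadj_spec_mat[OF Vc] using Vc
    by (auto intro!: op_bound_kron_one[of _ _ d d] op_bound_spec_mat V(1))
  have "trace_bound N (1 * 1 * (real n * (6 * \<tau>\<^sup>2)) + 6 * \<tau>\<^sup>2) (U (Suc n) * s * cadj (U (Suc n)) - out (Suc n))"
    unfolding split
  proof (rule trace_bound_add)
    show "trace_bound N (1 * 1 * (real n * (6 * \<tau>\<^sup>2))) (W * (U n * s * cadj (U n) - out n) * cadj W)"
      using carr Wc outc by (intro trace_bound_mult err Wb) (auto intro!: minus_carrier_mat)
    show "trace_bound N (6 * \<tau>\<^sup>2) (W * out n * cadj W - out (Suc n))"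
      unfolding step N_def W_def using dens by (intro trace_bound_step r c V) (simp add: N_def)
  qed (use carr Wc outc outc' in \<open>auto intro!: mult_carrier_square minus_carrier_mat\<close>)
  then show ?case using dens' by (simp add: N_def algebra_simps)
qed

section \<open>Choice of the parameters\<close>

theorem mainTheorem10:
  "\<exists>C > 0. \<forall>(dA::nat) (\<phi>::real) (t::real) (\<delta>::real).
     0 \<le> \<phi> \<longrightarrow> \<phi> < 2 * pi \<longrightarrow> \<delta> > 0 \<longrightarrow>
     (\<exists>(n::nat) Ks. real n \<le> C * (t\<^sup>2 / \<delta> + 1) \<and>
        is_channel (dA ^ n * dA ^ n * dA) dA Ks \<and>
        (\<forall>(dB::nat) \<rho>1 \<rho>2 \<sigma>.
           density dA \<rho>1 \<longrightarrow> density dA \<rho>2 \<longrightarrow> density (dA * dB) \<sigma> \<longrightarrow>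
           (let U = kron (mat_exp ((- \<i> * complex_of_real t) \<cdot>\<^sub>m ham \<phi> \<rho>1 \<rho>2)) (1\<^sub>m dB);
                out = kraus_apply (dA * dB) (map (\<lambda>K. kron K (1\<^sub>m dB)) Ks)
                        (kron (kron (kron_pow \<rho>1 n) (kron_pow \<rho>2 n)) \<sigma>)
            in trace_norm (U * \<sigma> * cadj U - out) / 2 \<le> C * \<delta>)))"
\<comment> \<open>Half of the trace norm bound 6 \<delta>; the number of copies, at most t^2 /
  \<delta> + 2, respects the same constant.\<close>
proof (intro exI[of _ "3::real"] conjI allI impI)
  fix d :: nat and \<phi> t \<delta> :: real
  assume \<delta>: "\<delta> > 0"
  \<comment> \<open>The added 1 keeps \<open>n\<close> positive for t = 0, so that n steps of length
    t / n make up the time t.\<close>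
  define n where "n = nat \<lceil>t\<^sup>2 / \<delta>\<rceil> + 1"
  define \<tau> where "\<tau> = t / real n"
  \<comment> \<open>The normalisation of the two Kraus families, since |g| is the modulus of
    \<tau>.\<close>
  define c where "c = sqrt (1 / (2 * (1 + \<tau>\<^sup>2)))"
  define g where "g = - \<i> * complex_of_real \<tau> * cis \<phi>"
  have pos: "1 + \<tau>\<^sup>2 > 0" by (simp add: add_pos_nonneg)
  have "c\<^sup>2 = 1 / (2 * (1 + \<tau>\<^sup>2))" unfolding c_def using pos by (intro real_sqrt_pow2) simp
  then have c: "2 * c\<^sup>2 * (1 + \<tau>\<^sup>2) = 1" using pos by simp
  have n: "t\<^sup>2 / \<delta> \<le> real n" "real n \<le> t\<^sup>2 / \<delta> + 2" "real n > 0"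
  proof -
    have "0 \<le> t\<^sup>2 / \<delta>" using \<delta> by simp
    then have "real (nat \<lceil>t\<^sup>2 / \<delta>\<rceil>) = real_of_int \<lceil>t\<^sup>2 / \<delta>\<rceil>" by simp
    then show "t\<^sup>2 / \<delta> \<le> real n" "real n \<le> t\<^sup>2 / \<delta> + 2" "real n > 0"
      unfolding n_def by linarith+
  qed
  show "\<exists>n Ks. real n \<le> 3 * (t\<^sup>2 / \<delta> + 1) \<and> is_channel (d ^ n * d ^ n * d) d Ks \<and>
      (\<forall>b \<rho>1 \<rho>2 \<sigma>. density d \<rho>1 \<longrightarrow> density d \<rho>2 \<longrightarrow> density (d * b) \<sigma> \<longrightarrow>
         (let U = kron (mat_exp ((- \<i> * complex_of_real t) \<cdot>\<^sub>m ham \<phi> \<rho>1 \<rho>2)) (1\<^sub>m b);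
              out = kraus_apply (d * b) (map (\<lambda>K. kron K (1\<^sub>m b)) Ks)
                      (kron (kron (kron_pow \<rho>1 n) (kron_pow \<rho>2 n)) \<sigma>)
          in trace_norm (U * \<sigma> * cadj U - out) / 2 \<le> 3 * \<delta>))"
  proof (intro exI[of _ n] exI[of _ "protocol d c g n"] conjI allI impI)
    show "real n \<le> 3 * (t\<^sup>2 / \<delta> + 1)"
      using n \<delta> by (smt (verit) divide_nonneg_nonneg zero_le_power2)
    show "is_channel (d ^ n * d ^ n * d) d (protocol d c g n)"
      using c by (intro is_channel_protocol) (simp add: g_def norm_mult)
    fix b \<rho>1 \<rho>2 \<sigma> assume r: "density d \<rho>1" "density d \<rho>2" and s: "density (d * b) \<sigma>"
    note hc = ham_carrier[OF density_carrier[OF r(1)] density_carrier[OF r(2)], of \<phi>]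
    obtain V h where V: "unitary_mat d V" "ham \<phi> \<rho>1 \<rho>2 = spec_mat d V (\<lambda>k. complex_of_real (h k))"
      using hermitian_diagonalisable[OF hc cadj_ham[OF r]] .
    note Vc = unitary_matD(1)[OF V(1)]
    define U where "U = kron (mat_exp ((- \<i> * complex_of_real t) \<cdot>\<^sub>m ham \<phi> \<rho>1 \<rho>2)) (1\<^sub>m b)"
    define out where "out = protocol_output d b c g \<rho>1 \<rho>2 \<sigma> n"
    have U: "U = kron (spec_mat d V (\<lambda>k. exp (- \<i> * complex_of_real (real n * \<tau> * h k)))) (1\<^sub>m b)"
      unfolding U_def V(2) spec_mat_smult[OF Vc] mat_exp_spec_mat[OF V(1)] \<tau>_def using n(3)
      by (simp add: mult.assoc)
    have out: "density (d * b) out" "trace_bound (d * b) (real n * (6 * \<tau>\<^sup>2)) (U * \<sigma> * cadj U - out)"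
      unfolding U out_def g_def using trace_bound_protocol[OF r s c V] by auto
    have sh: "\<sigma> \<in> carrier_mat (d * b) (d * b)" "cadj \<sigma> = \<sigma>" and oh: "out \<in> carrier_mat (d * b) (d * b)" "cadj out = out"
      using s out(1) by (auto simp: density_def psd_mat_def)
    have Uc: "U \<in> carrier_mat (d * b) (d * b)" using Vc by (simp add: U)
    have "trace_norm (U * \<sigma> * cadj U - out) \<le> real n * (6 * \<tau>\<^sup>2)"
    proof (rule trace_norm_le[OF _ _ out(2)])
      have UsU: "U * \<sigma> * cadj U \<in> carrier_mat (d * b) (d * b)" "cadj U \<in> carrier_mat (d * b) (d * b)"
        using Uc sh by (auto intro!: mult_carrier_square)
      then show "U * \<sigma> * cadj U - out \<in> carrier_mat (d * b) (d * b)"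
        using oh by (intro minus_carrier_mat)
      have "cadj (U * \<sigma> * cadj U) = U * \<sigma> * cadj U"
        using Uc sh UsU
        by (simp add: cadj_mult[of _ "d * b" "d * b" _ "d * b"] assoc_mult_square[of _ "d * b"]
            mult_carrier_square[of _ "d * b"] del: assoc_mult_mat)
      then show "cadj (U * \<sigma> * cadj U - out) = U * \<sigma> * cadj U - out"
        using UsU oh by (simp add: cadj_minus[of _ "d * b" "d * b"])
    qed
    also have "\<dots> = 6 * (t\<^sup>2 / real n)"
      using n(3) by (simp add: \<tau>_def power2_eq_square)
    \<comment> \<open>By the choice of \<open>n\<close>, which is at least t^2 / \<delta>.\<close>
    also have "\<dots> \<le> 6 * \<delta>"
      using n \<delta> by (simp add: field_simps)
    finally have "trace_norm (U * \<sigma> * cadj U - out) / 2 \<le> 3 * \<delta>" by simp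
    then show "let U = kron (mat_exp ((- \<i> * complex_of_real t) \<cdot>\<^sub>m ham \<phi> \<rho>1 \<rho>2)) (1\<^sub>m b);
              out = kraus_apply (d * b) (map (\<lambda>K. kron K (1\<^sub>m b)) (protocol d c g n))
                      (kron (kron (kron_pow \<rho>1 n) (kron_pow \<rho>2 n)) \<sigma>)
          in trace_norm (U * \<sigma> * cadj U - out) / 2 \<le> 3 * \<delta>"
      unfolding Let_def U_def out_def protocol_output_def .
  qed
qed simp

end
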